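(* Let $\mathcal{C}$ be a finite family of connected one-dimensional semialgebraic curves in $\mathbb{R}^2$ with connected union and with configuration $[(n_1)_{d_1}:\dots:(n_k)_{d_k}]$; let $\psi=\frac12\sum_{i=1}^kn_i(d_i-2)$, let $\kappa$ be the number of open curves of the family ($\kappa=0$ if all curves are closed), and let $\Delta(\mathcal{C})$ be the associated one-dimensional complex. Then: (i) $H_0(\Delta(\mathcal{C});\mathbb{Z})\cong\mathbb{Z}$; (ii) $H_1(\Delta(\mathcal{C});\mathbb{Z})\cong\mathbb{Z}^{\psi+\kappa+1}$; (iii) $H_q(\Delta(\mathcal{C});\mathbb{Z})=0$ for all $q\ge2$.
   Context: All curves are connected semialgebraic subsets of $\mathbb{R}^2$ of dimension one. A curve is closed if it is compact and homeomorphic to a circle, and open if it is homeomorphic to an interval; a sufficiently large closed disk $U$ can be chosen so that it contains all nodes and bounded parts of the curves and $\partial U$ meets each open curve transversely in exactly two points. A node is a point lying on two or more distinct curves of the family (singular points such as self-intersections of a single curve are also counted). The fold of a node $P$ is the number of connected components of $((\bigcup_{\gamma\in\mathcal{C}}\gamma)\setminus\{P\})\cap V$ for a sufficiently small neighbourhood $V$ of $P$. The configuration $[(n_1)_{d_1}:\dots:(n_k)_{d_k}]$ records that there are finitely many nodes, exactly $n_i$ of them of fold $d_i$. The complex $\Delta(\mathcal{C})$: if $\kappa=0$, its vertices are the nodes and its edges are the arcs of the curves between consecutive nodes. If $\kappa\ge1$, its vertices are the nodes together with the $2\kappa$ intersection points of the open curves with $\partial U$, and its edges are the arcs of the curves inside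 $U$ between consecutive vertices together with the arcs of $\partial U$ between consecutive boundary intersection points. It is a finite connected one-dimensional CW-complex (possibly a multigraph). *)

theory Defs
  imports "HOL-Analysis.Analysis" "HOL-Homology.Homology"
begin

section \<open>Semialgebraic curves in the plane\<close>

text \<open>
  The Boolean algebra generated by the sets where a polynomial is positive.  Equations need no
  clause of their own: \<open>p = 0\<close> is the complement of \<open>p > 0 \<or> - p > 0\<close>.
\<close>

inductive semialgebraic :: "(real^2) set \<Rightarrow> bool" where
  positive: "real_polynomial_function p \<Longrightarrow> semialgebraic {x. p x > 0}"
| compl: "semialgebraic S \<Longrightarrow> semialgebraic (- S)"
| union: "semialgebraic S \<Longrightarrow> semialgebraic T \<Longrightarrow> semialgebraic (S \<union> T)"

text \<open>
  A semialgebraic set is a finite disjoint union of cells homeomorphic to open cubes, and its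
  dimension is the largest dimension of a cell.  By invariance of domain, a planar semialgebraic set
  has dimension one iff it contains an open arc but no open 2-cell.
\<close>

definition one_dimensional :: "(real^2) set \<Rightarrow> bool" where
  "one_dimensional S \<longleftrightarrow>
     (\<exists>A \<subseteq> S. A homeomorphic {0<..<1::real}) \<and>
     \<not> (\<exists>D \<subseteq> S. D homeomorphic ball (0::real^2) 1)"

definition semialgebraic_curve :: "(real^2) set \<Rightarrow> bool" where
  "semialgebraic_curve \<gamma> \<longleftrightarrow> semialgebraic \<gamma> \<and> connected \<gamma> \<and> one_dimensional \<gamma>"

text \<open>
  Curves may cross themselves, so ``homeomorphic to a circle (an interval)'' is understood up to
  finitely many self-intersections: the curve is traced out by a continuous map that is injective
  off finitely many parameters.  If the map is injective this is literally a homeomorphism; see the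
  two lemmas at the end of this section.
\<close>

definition traces :: "('a::topological_space \<Rightarrow> real^2) \<Rightarrow> 'a set \<Rightarrow> (real^2) set \<Rightarrow> bool" where
  "traces f T \<gamma> \<longleftrightarrow>
     continuous_on T f \<and> f ` T = \<gamma> \<and> finite {t \<in> T. \<exists>s \<in> T. s \<noteq> t \<and> f s = f t}"

definition closed_curve :: "(real^2) set \<Rightarrow> bool" where
  "closed_curve \<gamma> \<longleftrightarrow>
     semialgebraic_curve \<gamma> \<and> compact \<gamma> \<and> (\<exists>f. traces f (sphere (0::real^2) 1) \<gamma>)"

text \<open>
  An open curve runs to infinity at both ends: only then does the boundary of every large disk meet
  it in exactly two points.  This rules out segments and half-lines.
\<close>

definition open_curve :: "(real^2) set \<Rightarrow> bool" where
  "open_curve \<gamma> \<longleftrightarrow>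
     semialgebraic_curve \<gamma> \<and>
     (\<exists>f. traces f (UNIV::real set) \<gamma> \<and> filterlim f at_infinity at_infinity)"

lemma closed_curve_if_homeomorphic_circle:
  assumes "semialgebraic_curve \<gamma>" "\<gamma> homeomorphic sphere (0::real^2) 1"
  shows "closed_curve \<gamma>"
proof -
  obtain f g where fg: "homeomorphism (sphere (0::real^2) 1) \<gamma> f g"
    using homeomorphic_sym[THEN iffD1, OF assms(2)] unfolding homeomorphic_def by blast
  then have "inj_on f (sphere 0 1)"
    by (intro inj_on_inverseI[of _ g]) (simp add: homeomorphism_def)
  then have none: "{t \<in> sphere 0 1. \<exists>s \<in> sphere 0 1. s \<noteq> t \<and> f s = f t} = {}"
    unfolding inj_on_def by blast
  have "traces f (sphere 0 1) \<gamma>"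
    unfolding traces_def none using fg by (simp add: homeomorphism_def)
  moreover have "compact \<gamma>"
    using homeomorphic_compactness[OF assms(2)] by simp
  ultimately show ?thesis
    unfolding closed_curve_def using assms(1) by (intro conjI exI)
qed

lemma open_curve_if_homeomorphic_line:
  assumes "semialgebraic_curve \<gamma>" "closed \<gamma>" "\<gamma> homeomorphic (UNIV::real set)"
  shows "open_curve \<gamma>"
proof -
  obtain f g where fg: "homeomorphism (UNIV::real set) \<gamma> f g"
    using homeomorphic_sym[THEN iffD1, OF assms(3)] unfolding homeomorphic_def by blast
  then have "inj f"
    by (intro inj_on_inverseI[of _ g]) (simp add: homeomorphism_def)
  then have none: "{t \<in> UNIV. \<exists>s \<in> UNIV. s \<noteq> t \<and> f s = f t} = {}"
    unfolding inj_on_def by blast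
  have "traces f UNIV \<gamma>"
    unfolding traces_def none using fg by (simp add: homeomorphism_def)
  moreover have "filterlim f at_infinity at_infinity"
    unfolding filterlim_at_infinity[OF order_refl]
  proof (intro allI impI)
    fix R :: real
    have "compact (g ` (\<gamma> \<inter> cball 0 R))"
    proof (rule compact_continuous_image)
      show "continuous_on (\<gamma> \<inter> cball 0 R) g"
        by (rule continuous_on_subset[OF homeomorphism_cont2[OF fg]]) simp
      show "compact (\<gamma> \<inter> cball 0 R)"
        using assms(2) by (simp add: closed_Int_compact)
    qed
    then have "bounded (g ` (\<gamma> \<inter> cball 0 R))"
      by (rule compact_imp_bounded)
    then obtain B where B: "\<forall>t \<in> g ` (\<gamma> \<inter> cball 0 R). norm t \<le> B"
      unfolding bounded_iff by (elim exE)
    have "norm (f t) \<ge> R" if "norm t \<ge> B + 1" for t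
    proof (rule ccontr)
      assume "\<not> norm (f t) \<ge> R"
      then have "f t \<in> \<gamma> \<inter> cball 0 R"
        using fg by (auto simp: homeomorphism_def)
      moreover have "g (f t) = t"
        using fg by (simp add: homeomorphism_def)
      ultimately have "norm t \<le> B"
        using B by (metis imageI)
      with that show False by simp
    qed
    then show "\<forall>\<^sub>F t in at_infinity. norm (f t) \<ge> R"
      unfolding eventually_at_infinity by blast
  qed
  ultimately show ?thesis
    unfolding open_curve_def using assms(1) by (intro conjI exI)
qed

section \<open>Nodes, fold and configuration\<close>

text \<open>
  \<open>smooth_chart \<gamma> P c\<close>: near \<open>P = c 0\<close> the set \<open>\<gamma>\<close> is an embedded smooth arc with regular
  parametrisation \<open>c\<close>; \<open>D j\<close> is the \<open>j\<close>-th derivative of \<open>c\<close>.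
\<close>

definition smooth_chart :: "(real^2) set \<Rightarrow> real^2 \<Rightarrow> (real \<Rightarrow> real^2) \<Rightarrow> bool" where
  "smooth_chart \<gamma> P c \<longleftrightarrow>
     c 0 = P \<and>
     (\<exists>V g. open V \<and> P \<in> V \<and> homeomorphism {-1<..<1} (\<gamma> \<inter> V) c g) \<and>
     (\<exists>D :: nat \<Rightarrow> real \<Rightarrow> real^2. D 0 = c \<and>
        (\<forall>j. \<forall>t \<in> {-1<..<1}. (D j has_vector_derivative D (Suc j) t) (at t)) \<and>
        (\<forall>t \<in> {-1<..<1}. D 1 t \<noteq> 0))"

definition singular_point :: "(real^2) set \<Rightarrow> real^2 \<Rightarrow> bool" where
  "singular_point \<gamma> P \<longleftrightarrow> P \<in> \<gamma> \<and> \<not> (\<exists>c. smooth_chart \<gamma> P c)"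

definition nodes :: "(real^2) set set \<Rightarrow> (real^2) set" where
  "nodes C =
     {P. \<exists>\<gamma> \<in> C. \<exists>\<gamma>' \<in> C. \<gamma> \<noteq> \<gamma>' \<and> P \<in> \<gamma> \<inter> \<gamma>'} \<union> {P. \<exists>\<gamma> \<in> C. singular_point \<gamma> P}"

text \<open>
  A relation rather than a function, so that no junk value arises; the count stabilises for small
  balls because semialgebraic sets are locally conic.
\<close>

definition has_fold :: "(real^2) set set \<Rightarrow> real^2 \<Rightarrow> nat \<Rightarrow> bool" where
  "has_fold C P d \<longleftrightarrow>
     (\<forall>\<^sub>F \<epsilon> in at_right (0::real).
        finite (components ((\<Union>C - {P}) \<inter> ball P \<epsilon>)) \<and>
        card (components ((\<Union>C - {P}) \<inter> ball P \<epsilon>)) = d)"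

text \<open>The configuration \<open>[(n 1)\<^sub>d\<^sub>1 : \<dots> : (n k)\<^sub>d\<^sub>k]\<close>, the \<open>d i\<close> being distinct.\<close>

definition has_configuration ::
    "(real^2) set set \<Rightarrow> nat \<Rightarrow> (nat \<Rightarrow> nat) \<Rightarrow> (nat \<Rightarrow> nat) \<Rightarrow> bool" where
  "has_configuration C k n d \<longleftrightarrow>
     finite (nodes C) \<and>
     inj_on d {1..k} \<and>
     (\<forall>P \<in> nodes C. \<exists>i \<in> {1..k}. has_fold C P (d i)) \<and>
     (\<forall>i \<in> {1..k}. card {P \<in> nodes C. has_fold C P (d i)} = n i)"

definition psi :: "nat \<Rightarrow> (nat \<Rightarrow> nat) \<Rightarrow> (nat \<Rightarrow> nat) \<Rightarrow> real" where
  "psi k n d = 1/2 * (\<Sum>i=1..k. real (n i) * (real (d i) - 2))"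

definition kappa :: "(real^2) set set \<Rightarrow> nat" where
  "kappa C = card {\<gamma> \<in> C. open_curve \<gamma>}"

section \<open>The associated one-dimensional complex\<close>

text \<open>The tangent lines of \<open>\<gamma>\<close> and of the circle with centre \<open>a\<close> through \<open>P\<close> span the plane.\<close>

definition transverse_to_circle :: "(real^2) set \<Rightarrow> real^2 \<Rightarrow> real^2 \<Rightarrow> bool" where
  "transverse_to_circle \<gamma> a P \<longleftrightarrow>
     (\<exists>c. smooth_chart \<gamma> P c \<and>
        span (insert (vector_derivative c (at 0)) {v. v \<bullet> (P - a) = 0}) = UNIV)"

text \<open>
  The disk \<open>U = cball a r\<close> is sufficiently large.  Nodes and closed curves lie in its interior; the
  bounded part of an open curve then lies in \<open>U\<close> as well, since the curve leaves \<open>U\<close> through its two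
  transverse boundary points and runs to infinity at both ends.
\<close>

definition large_disk :: "(real^2) set set \<Rightarrow> real^2 \<Rightarrow> real \<Rightarrow> bool" where
  "large_disk C a r \<longleftrightarrow>
     0 < r \<and>
     nodes C \<subseteq> ball a r \<and>
     (\<forall>\<gamma> \<in> C. closed_curve \<gamma> \<longrightarrow> \<gamma> \<subseteq> ball a r) \<and>
     (\<forall>\<gamma> \<in> C. open_curve \<gamma> \<longrightarrow>
        card (\<gamma> \<inter> sphere a r) = 2 \<and> (\<forall>P \<in> \<gamma> \<inter> sphere a r. transverse_to_circle \<gamma> a P))"

definition Delta_vertices :: "(real^2) set set \<Rightarrow> real^2 \<Rightarrow> real \<Rightarrow> (real^2) set" where
  "Delta_vertices C a r =
     (if kappa C = 0 then nodes C
      else nodes C \<union> {P. \<exists>\<gamma> \<in> C. open_curve \<gamma> \<and> P \<in> \<gamma> \<inter> sphere a r})"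

text \<open>
  The open 1-cells.  The arcs of a curve between consecutive vertices are the components left after
  removing the vertices.  A closed curve without nodes (possible only if it is the only curve)
  is a single loop without vertices.
\<close>

definition Delta_edges :: "(real^2) set set \<Rightarrow> real^2 \<Rightarrow> real \<Rightarrow> (real^2) set set" where
  "Delta_edges C a r =
     (let V = Delta_vertices C a r in
      if kappa C = 0 then (\<Union>\<gamma> \<in> C. components (\<gamma> - V))
      else (\<Union>\<gamma> \<in> C. components (\<gamma> \<inter> cball a r - V)) \<union> components (sphere a r - V))"

definition Delta :: "(real^2) set set \<Rightarrow> real^2 \<Rightarrow> real \<Rightarrow> (real^2) topology" where
  "Delta C a r = top_of_set (Delta_vertices C a r \<union> \<Union>(Delta_edges C a r))"

end

theory Submission
  imports Defs "HOL-Computational_Algebra.Polynomial_Factorial" "HOL-Computational_Algebra.Field_as_Ring"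
begin

text \<open>
  The complex is a finite connected graph embedded in the plane: the curves (cut off at the circle
  if there are open ones) together with that circle, with vertices the nodes and the points of
  the open curves on the circle (a single simple closed curve, which has neither, gets one vertex).
  The homology of a finite connected graph with \<open>v\<close> vertices and \<open>e\<close>
  edges is \<open>\<int>\<close> in degree 0, \<open>\<int>\<^sup>m\<close> with \<open>m = e - v + 1\<close> in degree 1, and zero above, so the theorem
  is a count of vertices and edges.  Each edge has two ends.  The number of ends at a node is its
  fold; at each of the \<open>2 \<kappa>\<close> points on the circle it is three.  Hence
  \<open>2 e = (\<Sum>P. fold P) + 6 \<kappa>\<close> and \<open>v = #nodes + 2 \<kappa>\<close>, which gives \<open>m = \<psi> + \<kappa> + 1\<close>.

  The homology of the graph (\<open>homology\<close> in the locale \<open>finite_graph\<close>) is obtained by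
  removing the midpoints of all edges and putting them back one at a time.  With all midpoints
  removed the graph retracts to its vertices.  Filling the puncture of an edge changes homology only
  through the local group \<open>H\<^sub>1(interval, interval - point) = \<int>\<close>: if the two sides of the
  puncture are already connected to each other, \<open>H\<^sub>1\<close> gains a summand \<open>\<int>\<close>; otherwise two components
  merge and \<open>H\<^sub>1\<close> is unchanged (\<open>homology_fill_puncture\<close>, \<open>free_homology_fill_puncture\<close>).  Either way
  the rank of \<open>H\<^sub>1\<close> minus the number of components goes up by one.

  That the fold of a node is the number of edge ends there (\<open>card_components_near_vertex\<close>) is the
  place where semialgebraicity enters.  For arcs that are merely continuous, or smooth away from the
  node, it fails: the distance to the node can oscillate along an arc so that
  every small ball cuts the arc into, say, exactly two pieces.  For a semialgebraic arc the distance
  increases strictly near the end point (\<open>semialgebraic_arc_radius_strict_mono\<close>): the arc lies in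
  the zero set of an irreducible polynomial \<open>p\<close>, and at a local extremum of the distance the
  derivative of \<open>p\<close> under rotation vanishes as well; but the common zeros of \<open>p\<close> and this derivative
  do not accumulate.

  Finally, points where a curve crosses itself are singular (\<open>crossing_is_singular\<close>), hence nodes, so
  that away from the vertices the curves are traced injectively and without meeting each other, and
  the parametrisations do define a graph (\<open>traced_graph\<close>).
\<close>

section \<open>Zeros of polynomials in two variables\<close>

text \<open>
  A polynomial in \<open>x\<close> and \<open>y\<close> is taken as a polynomial in \<open>y\<close> over \<open>\<real>[x]\<close>, which gives access to unique
  factorisation and to pseudo-division by \<open>y\<close>-degree.
\<close>

definition ev :: "real poly poly \<Rightarrow> real \<Rightarrow> real \<Rightarrow> real" where
  "ev p x y = poly (poly p [:y:]) x"

lemma ev_simps [simp]: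
  "ev 0 x y = 0" "ev 1 x y = 1" "ev (p + q) x y = ev p x y + ev q x y"
  "ev (p - q) x y = ev p x y - ev q x y" "ev (- p) x y = - ev p x y"
  "ev (p * q) x y = ev p x y * ev q x y"
  "ev (Polynomial.smult a p) x y = poly a x * ev p x y" "ev [:a:] x y = poly a x"
  by (simp_all add: ev_def)

lemma ev_pCons: "ev (pCons a p) x y = poly a x + y * ev p x y"
  by (simp add: ev_def)

lemma ev_eq_poly: "ev p x y = poly (map_poly (\<lambda>a. poly a x) p) y"
proof (induction p)
  case (pCons a p)
  then show ?case by (simp add: ev_pCons map_poly_pCons)
qed simp

lemma continuous_on_ev [continuous_intros]:
  assumes "continuous_on S f" "continuous_on S g"
  shows "continuous_on S (\<lambda>z. ev p (f z) (g z))"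
proof (induction p)
  case 0
  then show ?case by simp
next
  case (pCons a p)
  then show ?case unfolding ev_pCons by (intro continuous_intros assms)
qed

text \<open>
  The origin itself is exempt because the zeros will be produced on small circles around it.
\<close>

lemma ev_zero_near_origin:
  assumes "\<epsilon> > 0"
    and "\<And>x y. 0 < x\<^sup>2 + y\<^sup>2 \<Longrightarrow> x\<^sup>2 + y\<^sup>2 < \<epsilon>\<^sup>2 \<Longrightarrow> ev p x y = 0"
  shows "p = 0"
proof -
  have zero: "map_poly (\<lambda>a. poly a x) p = 0" if x: "0 < x" "x < \<epsilon>/2" for x
  proof (rule ccontr)
    assume "map_poly (\<lambda>a. poly a x) p \<noteq> 0"
    then have "finite {y. poly (map_poly (\<lambda>a. poly a x) p) y = 0}"
      by (rule poly_roots_finite)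
    moreover have "{-\<epsilon>/2<..<\<epsilon>/2} \<subseteq> {y. poly (map_poly (\<lambda>a. poly a x) p) y = 0}"
    proof
      fix y assume y: "y \<in> {-\<epsilon>/2<..<\<epsilon>/2}"
      have "x\<^sup>2 < (\<epsilon>/2)\<^sup>2" "y\<^sup>2 < (\<epsilon>/2)\<^sup>2"
        using x y by (auto simp: abs_square_less_1 intro!: abs_le_square_iff[THEN iffD1] power2_strict_mono)
      moreover have "(\<epsilon>/2)\<^sup>2 + (\<epsilon>/2)\<^sup>2 \<le> \<epsilon>\<^sup>2" by (simp add: power2_eq_square)
      ultimately have "x\<^sup>2 + y\<^sup>2 < \<epsilon>\<^sup>2" by linarith
      then show "y \<in> {y. poly (map_poly (\<lambda>a. poly a x) p) y = 0}"
        using assms(2)[of x y] x by (simp add: ev_eq_poly sum_power2_gt_zero_iff)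
    qed
    ultimately have "finite {-\<epsilon>/2<..<\<epsilon>/2}" by (rule rev_finite_subset)
    with \<open>\<epsilon> > 0\<close> show False by (auto simp: infinite_Ioo)
  qed
  have "Polynomial.coeff p i = 0" for i
  proof (rule ccontr)
    assume "Polynomial.coeff p i \<noteq> 0"
    then have "finite {x. poly (Polynomial.coeff p i) x = 0}" by (rule poly_roots_finite)
    moreover have "{0<..<\<epsilon>/2} \<subseteq> {x. poly (Polynomial.coeff p i) x = 0}"
    proof
      fix x assume "x \<in> {0<..<\<epsilon>/2}"
      then have "0 < x" "x < \<epsilon>/2" by auto
      from arg_cong[OF zero[OF this], of "\<lambda>q. Polynomial.coeff q i"] show "x \<in> {x. poly (Polynomial.coeff p i) x = 0}"
        by (simp add: coeff_map_poly)
    qed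
    ultimately have "finite {0<..<\<epsilon>/2}" by (rule rev_finite_subset)
    with \<open>\<epsilon> > 0\<close> show False by (auto simp: infinite_Ioo)
  qed
  then show ?thesis by (simp add: poly_eq_iff)
qed

text \<open>
  The polynomial \<open>q\<close> is \<open>x \<partial>p/\<partial>y - y \<partial>p/\<partial>x\<close>.
\<close>

lemma rotational_derivative:
  obtains q where
    "\<And>\<rho> \<theta>. ((\<lambda>\<theta>. ev p (\<rho> * cos \<theta>) (\<rho> * sin \<theta>)) has_real_derivative
       ev q (\<rho> * cos \<theta>) (\<rho> * sin \<theta>)) (at \<theta>)"
proof -
  have "\<exists>q. \<forall>\<rho> \<theta>. ((\<lambda>\<theta>. ev p (\<rho> * cos \<theta>) (\<rho> * sin \<theta>)) has_real_derivative
       ev q (\<rho> * cos \<theta>) (\<rho> * sin \<theta>)) (at \<theta>)"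
  proof (induction p)
    case 0
    show ?case by (rule exI[of _ 0]) simp
  next
    case (pCons a p)
    then obtain q where q: "((\<lambda>\<theta>. ev p (\<rho> * cos \<theta>) (\<rho> * sin \<theta>)) has_real_derivative
       ev q (\<rho> * cos \<theta>) (\<rho> * sin \<theta>)) (at \<theta>)" for \<rho> \<theta> by blast
    show ?case
    proof (intro exI allI)
      fix \<rho> \<theta> :: real
      have "((\<lambda>\<theta>. poly a (\<rho> * cos \<theta>) + \<rho> * sin \<theta> * ev p (\<rho> * cos \<theta>) (\<rho> * sin \<theta>)) has_real_derivative
        poly (pderiv a) (\<rho> * cos \<theta>) * (- (\<rho> * sin \<theta>)) +
          (\<rho> * sin \<theta> * ev q (\<rho> * cos \<theta>) (\<rho> * sin \<theta>) + \<rho> * cos \<theta> * ev p (\<rho> * cos \<theta>) (\<rho> * sin \<theta>))) (at \<theta>)"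
        by (rule derivative_eq_intros DERIV_chain2[OF poly_DERIV] q refl | simp)+
      moreover have "poly (pderiv a) (\<rho> * cos \<theta>) * (- (\<rho> * sin \<theta>)) +
          (\<rho> * sin \<theta> * ev q (\<rho> * cos \<theta>) (\<rho> * sin \<theta>) + \<rho> * cos \<theta> * ev p (\<rho> * cos \<theta>) (\<rho> * sin \<theta>))
        = ev ([:0, 1:] * q + [:[:0, 1:]:] * p - [:0, 1:] * [:pderiv a:]) (\<rho> * cos \<theta>) (\<rho> * sin \<theta>)"
        by (simp add: ev_pCons algebra_simps del: mult_pCons_left)
      ultimately show "((\<lambda>\<theta>. ev (pCons a p) (\<rho> * cos \<theta>) (\<rho> * sin \<theta>)) has_real_derivative
        ev ([:0, 1:] * q + [:[:0, 1:]:] * p - [:0, 1:] * [:pderiv a:]) (\<rho> * cos \<theta>) (\<rho> * sin \<theta>)) (at \<theta>)"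
        by (simp add: ev_pCons mult.commute)
    qed
  qed
  then show ?thesis using that by blast
qed

lemma prime_factor_positive_degree:
  fixes g :: "real poly poly"
  assumes "degree g > 0"
  obtains \<pi> where "prime_elem \<pi>" "\<pi> dvd g" "degree \<pi> > 0"
proof -
  have "g \<noteq> 0 \<Longrightarrow> degree g > 0 \<Longrightarrow> \<exists>\<pi>. prime_elem \<pi> \<and> \<pi> dvd g \<and> degree \<pi> > 0"
  proof (induction g rule: prime_divisors_induct)
    case zero
    then show ?case by simp
  next
    case (unit x)
    then show ?case by (auto simp: is_unit_poly_iff)
  next
    case (factor p x)
    then have "x \<noteq> 0" "p \<noteq> 0" by auto
    then have "degree (p * x) = degree p + degree x" by (simp add: degree_mult_eq)
    then show ?case
      using factor \<open>x \<noteq> 0\<close> by (metis add_gr_0 dvd_mult dvd_triv_left prime_imp_prime_elem)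
  qed
  then show ?thesis using assms that by fastforce
qed

text \<open>
  Elimination of \<open>y\<close>.  A nonzero element of least \<open>y\<close>-degree in the ideal generated by \<open>p\<close> and \<open>q\<close> divides both, up
  to factors in \<open>\<real>[x]\<close>.  If it had positive degree, a prime factor involving \<open>y\<close> would divide
  \<open>p\<close> and \<open>q\<close>.
\<close>

lemma prime_elimination:
  fixes p q :: "real poly poly"
  assumes p: "prime_elem p" and ndvd: "\<not> p dvd q"
  obtains A B R where "R \<noteq> 0" "A * p + B * q = [:R:]"
proof -
  define I where "I = {g. \<exists>A B. g = A * p + B * q}"
  have pI: "p \<in> I" unfolding I_def mem_Collect_eq by (rule exI[of _ 1], rule exI[of _ 0]) simp
  have qI: "q \<in> I" unfolding I_def mem_Collect_eq by (rule exI[of _ 0], rule exI[of _ 1]) simp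
  have "p \<noteq> 0" using p by auto
  obtain g where g: "g \<in> I" "g \<noteq> 0" and least: "\<And>h. h \<in> I \<Longrightarrow> h \<noteq> 0 \<Longrightarrow> degree g \<le> degree h"
    using ex_has_least_nat[of "\<lambda>g. g \<in> I \<and> g \<noteq> 0" p degree] pI \<open>p \<noteq> 0\<close> by blast
  have pseudo_dvd: "\<exists>c. c \<noteq> 0 \<and> g dvd Polynomial.smult c f" if f: "f \<in> I" for f
  proof -
    obtain a h where ah: "a \<noteq> 0" "Polynomial.smult a f = g * h + pseudo_mod f g"
      using pseudo_mod(1)[OF \<open>g \<noteq> 0\<close>, of f] by blast
    have "pseudo_mod f g = Polynomial.smult a f - g * h" using ah by simp
    obtain A B where AB: "f = A * p + B * q" using f unfolding I_def by auto
    obtain A' B' where AB': "g = A' * p + B' * q" using g unfolding I_def by auto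
    have "pseudo_mod f g = [:a:] * f - g * h" using ah by simp
    also have "\<dots> = ([:a:] * A - h * A') * p + ([:a:] * B - h * B') * q"
      unfolding AB by (subst AB') (simp only: algebra_simps)
    finally have "pseudo_mod f g \<in> I" unfolding I_def by blast
    then have "pseudo_mod f g = 0"
      using least[of "pseudo_mod f g"] pseudo_mod(2)[OF \<open>g \<noteq> 0\<close>, of f] by fastforce
    then have "Polynomial.smult a f = g * h" using ah by simp
    then show ?thesis using ah(1) by (metis dvd_triv_left)
  qed
  have "degree g = 0"
  proof (rule ccontr)
    assume "degree g \<noteq> 0"
    then obtain \<pi> where \<pi>: "prime_elem \<pi>" "\<pi> dvd g" "degree \<pi> > 0"
      using prime_factor_positive_degree by blast
    have "\<pi> dvd f" if f: "f \<in> I" for f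
    proof -
      obtain c where c: "c \<noteq> 0" "g dvd [:c:] * f" using pseudo_dvd[OF f] by auto
      then have "\<pi> dvd [:c:] * f" using \<pi>(2) dvd_trans by blast
      moreover have "\<not> \<pi> dvd [:c:]"
        using \<pi>(3) c(1) by (auto dest!: dvd_imp_degree_le)
      ultimately show ?thesis using prime_elem_dvd_mult_iff[OF \<pi>(1)] by blast
    qed
    then have "\<pi> dvd p" "\<pi> dvd q" using pI qI by auto
    with p \<pi>(1) have "p dvd \<pi>"
      by (meson irreducibleD' prime_elem_imp_irreducible prime_elem_not_unit)
    with \<open>\<pi> dvd q\<close> ndvd show False using dvd_trans by blast
  qed
  then obtain R where "g = [:R:]" by (meson degree_eq_zeroE)
  then show ?thesis using that g unfolding I_def by auto
qed

lemma small_roots: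
  fixes R :: "real poly"
  assumes "R \<noteq> 0"
  obtains \<epsilon> where "\<epsilon> > 0" "\<And>x. \<bar>x\<bar> < \<epsilon> \<Longrightarrow> poly R x = 0 \<Longrightarrow> x = 0"
proof -
  have "finite {x. poly R x = 0}" using assms by (rule poly_roots_finite)
  then obtain d where "d > 0" "\<forall>x\<in>{x. poly R x = 0}. x \<noteq> 0 \<longrightarrow> d \<le> dist 0 x"
    using finite_set_avoid[of "{x. poly R x = 0}" 0] by blast
  then show ?thesis by (intro that[of d]) force+
qed

lemma zero_on_axis_imp_dvd:
  fixes p :: "real poly poly"
  assumes "map_poly (\<lambda>a. poly a 0) p = 0"
  shows "[:[:0, 1:]:] dvd p"
proof -
  have "poly (Polynomial.coeff p i) 0 = 0" for i
    using arg_cong[OF assms, of "\<lambda>q. Polynomial.coeff q i"] by (simp add: coeff_map_poly)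
  then have "[:0, 1:] dvd Polynomial.coeff p i" for i
    using poly_eq_0_iff_dvd[of "Polynomial.coeff p i" 0] by simp
  then show ?thesis by (simp add: const_poly_dvd_iff)
qed

text \<open>
  Elimination leaves finitely many abscissas for the common zeros, so close to the origin only the
  \<open>y\<close>-axis is left.  On the axis \<open>p\<close> and \<open>q\<close> have finitely many common zeros unless both vanish identically there;
  then both would be divisible by \<open>x\<close>, and \<open>p\<close>, being associated to \<open>x\<close>, would divide \<open>q\<close>.
\<close>

lemma prime_common_zeros_isolated:
  assumes p: "prime_elem p" and ndvd: "\<not> p dvd q"
  obtains \<epsilon> where "\<epsilon> > 0"
    "\<And>x y. 0 < x\<^sup>2 + y\<^sup>2 \<Longrightarrow> x\<^sup>2 + y\<^sup>2 < \<epsilon>\<^sup>2 \<Longrightarrow> ev p x y = 0 \<Longrightarrow> ev q x y \<noteq> 0"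
proof -
  obtain A B R where R: "R \<noteq> 0" "A * p + B * q = [:R:]" using prime_elimination[OF p ndvd] .
  have Rzero: "poly R x = 0" if "ev p x y = 0" "ev q x y = 0" for x y
    using arg_cong[OF R(2), of "\<lambda>f. ev f x y"] that by simp
  obtain d where d: "d > 0" "\<And>x. \<bar>x\<bar> < d \<Longrightarrow> poly R x = 0 \<Longrightarrow> x = 0"
    using small_roots[OF R(1)] by blast
  let ?X = "[:[:0, 1:]:] :: real poly poly"
  have "\<exists>f\<in>{p, q}. map_poly (\<lambda>a. poly a 0) f \<noteq> 0"
  proof (rule ccontr)
    assume "\<not> (\<exists>f\<in>{p, q}. map_poly (\<lambda>a. poly a 0) f \<noteq> 0)"
    then have "?X dvd p" "?X dvd q" using zero_on_axis_imp_dvd by auto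
    moreover have "\<not> is_unit ?X" by (simp add: is_unit_const_poly_iff is_unit_pCons_iff)
    ultimately have "p dvd ?X" using p
      by (meson irreducibleD' prime_elem_imp_irreducible)
    with \<open>?X dvd q\<close> ndvd show False using dvd_trans by blast
  qed
  then obtain f where f: "f = p \<or> f = q" "map_poly (\<lambda>a. poly a 0) f \<noteq> 0" by auto
  obtain e where e: "e > 0" "\<And>y. \<bar>y\<bar> < e \<Longrightarrow> poly (map_poly (\<lambda>a. poly a 0) f) y = 0 \<Longrightarrow> y = 0"
    using small_roots[OF f(2)] by blast
  show ?thesis
  proof (rule that[of "min d e"])
    show "min d e > 0" using d e by simp
    fix x y :: real
    assume pos: "0 < x\<^sup>2 + y\<^sup>2" and less: "x\<^sup>2 + y\<^sup>2 < (min d e)\<^sup>2" and "ev p x y = 0"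
    show "ev q x y \<noteq> 0"
    proof
      assume "ev q x y = 0"
      have "x\<^sup>2 < (min d e)\<^sup>2" "y\<^sup>2 < (min d e)\<^sup>2"
        using less zero_le_power2[of x] zero_le_power2[of y] by linarith+
      then have "\<bar>x\<bar> < min d e" "\<bar>y\<bar> < min d e"
        using d(1) e(1) power2_less_imp_less[of "\<bar>x\<bar>" "min d e"] power2_less_imp_less[of "\<bar>y\<bar>" "min d e"]
        by simp_all
      have "x = 0" using d(2) Rzero \<open>ev p x y = 0\<close> \<open>ev q x y = 0\<close> \<open>\<bar>x\<bar> < min d e\<close> by simp
      moreover have "ev f x y = 0" using f(1) \<open>ev p x y = 0\<close> \<open>ev q x y = 0\<close> by auto
      ultimately have "y = 0" using e(2) \<open>\<bar>y\<bar> < min d e\<close> by (simp add: ev_eq_poly)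
      with \<open>x = 0\<close> pos show False by simp
    qed
  qed
qed

text \<open>
  Rolle's theorem on the shorter circular arc between two zeros of \<open>p\<close>.  The distance estimate serves
  to localise the zero of \<open>q\<close> when the two zeros of \<open>p\<close> are close to each other.
\<close>

lemma chord_zero_of_rotational_derivative:
  assumes q: "\<And>\<rho> \<theta>. ((\<lambda>\<theta>. ev p (\<rho> * cos \<theta>) (\<rho> * sin \<theta>)) has_real_derivative
       ev q (\<rho> * cos \<theta>) (\<rho> * sin \<theta>)) (at \<theta>)"
    and "\<rho> > 0" "x1\<^sup>2 + y1\<^sup>2 = \<rho>\<^sup>2" "x2\<^sup>2 + y2\<^sup>2 = \<rho>\<^sup>2" "(x1, y1) \<noteq> (x2, y2)"
    and "ev p x1 y1 = 0" "ev p x2 y2 = 0"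
  obtains x y where "ev q x y = 0" "(x - x1)\<^sup>2 + (y - y1)\<^sup>2 \<le> (x2 - x1)\<^sup>2 + (y2 - y1)\<^sup>2"
proof -
  have polar: "\<exists>t. 0 \<le> t \<and> t < 2*pi \<and> x = \<rho> * cos t \<and> y = \<rho> * sin t" if "x\<^sup>2 + y\<^sup>2 = \<rho>\<^sup>2" for x y
  proof -
    have "(x/\<rho>)\<^sup>2 + (y/\<rho>)\<^sup>2 = 1"
      using that \<open>\<rho> > 0\<close> by (simp add: power_divide flip: add_divide_distrib)
    then obtain t where "0 \<le> t" "t < 2*pi" "x/\<rho> = cos t" "y/\<rho> = sin t" by (rule sincos_total_2pi)
    then show ?thesis using \<open>\<rho> > 0\<close> by (intro exI[of _ t]) (simp add: field_simps)
  qed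
  obtain s where s: "0 \<le> s" "s < 2*pi" "x1 = \<rho> * cos s" "y1 = \<rho> * sin s" using polar assms by metis
  obtain t0 where t0: "0 \<le> t0" "t0 < 2*pi" "x2 = \<rho> * cos t0" "y2 = \<rho> * sin t0" using polar assms by metis
  obtain t where t: "\<bar>t - s\<bar> \<le> pi" "x2 = \<rho> * cos t" "y2 = \<rho> * sin t"
  proof -
    consider "\<bar>t0 - s\<bar> \<le> pi" | "t0 - s > pi" | "t0 - s < - pi" by linarith
    then show ?thesis
    proof cases
      case 1 then show ?thesis using that t0 by blast
    next
      case 2 then show ?thesis using that[of "t0 - 2*pi"] t0 s by (simp add: cos_diff sin_diff)
    next
      case 3 then show ?thesis using that[of "t0 + 2*pi"] t0 s by simp
    qed
  qed
  have "s \<noteq> t" using s t assms(5) by auto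
  let ?f = "\<lambda>\<theta>. ev p (\<rho> * cos \<theta>) (\<rho> * sin \<theta>)"
  have "\<exists>z. min s t < z \<and> z < max s t \<and> ev q (\<rho> * cos z) (\<rho> * sin z) = 0"
  proof -
    have "continuous_on {min s t..max s t} ?f" by (intro continuous_intros)
    then have "\<exists>z. min s t < z \<and> z < max s t \<and> (*) (ev q (\<rho> * cos z) (\<rho> * sin z)) = (\<lambda>v. 0)"
      using Rolle_deriv[of "min s t" "max s t" ?f "\<lambda>\<theta>. (*) (ev q (\<rho> * cos \<theta>) (\<rho> * sin \<theta>))"]
        q \<open>s \<noteq> t\<close> assms(6,7) s t by (auto simp: has_field_derivative_def min_def max_def)
    then obtain z where z: "min s t < z" "z < max s t" "(*) (ev q (\<rho> * cos z) (\<rho> * sin z)) = (\<lambda>v. 0)" by blast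
    from fun_cong[OF z(3), of 1] z(1,2) show ?thesis by (auto simp only: mult_1_right)
  qed
  then obtain z where z: "min s t < z" "z < max s t" "ev q (\<rho> * cos z) (\<rho> * sin z) = 0" by blast
  have dist: "(\<rho> * cos a - \<rho> * cos s)\<^sup>2 + (\<rho> * sin a - \<rho> * sin s)\<^sup>2 = \<rho>\<^sup>2 * (2 - 2 * cos \<bar>a - s\<bar>)" for a
  proof -
    have "(\<rho> * cos a - \<rho> * cos s)\<^sup>2 + (\<rho> * sin a - \<rho> * sin s)\<^sup>2
      = \<rho>\<^sup>2 * (((sin a)\<^sup>2 + (cos a)\<^sup>2) + ((sin s)\<^sup>2 + (cos s)\<^sup>2) - 2 * (cos a * cos s + sin a * sin s))"
      by (simp only: power2_eq_square algebra_simps)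
    then show ?thesis by (simp add: cos_diff)
  qed
  have "\<bar>z - s\<bar> \<le> \<bar>t - s\<bar>" using z by (auto simp: min_def max_def split: if_splits)
  then have "cos \<bar>t - s\<bar> \<le> cos \<bar>z - s\<bar>" using t(1) by (intro cos_monotone_0_pi_le) auto
  then have "\<rho>\<^sup>2 * (2 - 2 * cos \<bar>z - s\<bar>) \<le> \<rho>\<^sup>2 * (2 - 2 * cos \<bar>t - s\<bar>)"
    by (intro mult_left_mono) auto
  then show ?thesis using that[OF z(3)] unfolding s(3,4) t(2,3) dist by simp
qed

lemma equal_values_near_maximum:
  fixes \<phi> :: "real \<Rightarrow> real"
  assumes cont: "continuous_on {a..b} \<phi>" and c: "a < c" "c < b"
    and max: "\<And>x. x \<in> {a..b} \<Longrightarrow> \<phi> x \<le> \<phi> c" and "\<eta> > 0"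
  obtains s t where "s \<in> {a..b}" "t \<in> {a..b}" "s \<noteq> t" "\<bar>s - c\<bar> < \<eta>" "\<bar>t - c\<bar> < \<eta>" "\<phi> s = \<phi> t"
proof -
  define h where "h = min (\<eta>/2) (min (c - a) (b - c))"
  have h: "h > 0" "h < \<eta>" "a \<le> c - h" "c + h \<le> b" using c \<open>\<eta> > 0\<close> unfolding h_def by (auto simp: min_def)
  define m where "m = max (\<phi> (c - h)) (\<phi> (c + h))"
  have m: "\<phi> (c - h) \<le> m" "\<phi> (c + h) \<le> m" "m \<le> \<phi> c"
    using max[of "c - h"] max[of "c + h"] h c unfolding m_def by auto
  obtain s where s: "c - h \<le> s" "s \<le> c" "\<phi> s = m"
    using IVT'[of \<phi> "c - h" m c] m h continuous_on_subset[OF cont, of "{c - h..c}"] c by auto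
  obtain t where t: "c \<le> t" "t \<le> c + h" "\<phi> t = m"
    using IVT2'[of \<phi> "c + h" m c] m h continuous_on_subset[OF cont, of "{c..c + h}"] c by auto
  show ?thesis
  proof (cases "s = t")
    case False
    then show ?thesis using that[of s t] s t h c by auto
  next
    case True
    then have "\<phi> c = m" using s t by auto
    then have "\<phi> (c - h) = \<phi> c \<or> \<phi> (c + h) = \<phi> c" unfolding m_def by (auto simp: max_def split: if_splits)
    then show ?thesis
    proof
      assume "\<phi> (c - h) = \<phi> c" then show ?thesis using that[of "c - h" c] h c by auto
    next
      assume "\<phi> (c + h) = \<phi> c" then show ?thesis using that[of "c + h" c] h c by auto
    qed
  qed
qed

text \<open>
  A continuous function with equal values at both ends has an extremum inside, and on the two sides of an extremum
  it takes equal values at points as close to it as desired.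
\<close>

lemma equal_values_accumulate:
  fixes \<phi> :: "real \<Rightarrow> real"
  assumes cont: "continuous_on {a..b} \<phi>" and "a < b" and eq: "\<phi> a = \<phi> b"
  obtains c where "c \<in> {a..b}"
    "\<And>\<eta>. \<eta> > 0 \<Longrightarrow> \<exists>s\<in>{a..b}. \<exists>t\<in>{a..b}. s \<noteq> t \<and> \<bar>s - c\<bar> < \<eta> \<and> \<bar>t - c\<bar> < \<eta> \<and> \<phi> s = \<phi> t"
proof -
  note goal = that
  have *: ?thesis if c: "a < c" "c < b" "\<And>x. x \<in> {a..b} \<Longrightarrow> \<phi> x \<le> \<phi> c" for c
  proof (rule goal[of c])
    show "c \<in> {a..b}" using \<open>a < c\<close> \<open>c < b\<close> by simp
    fix \<eta> :: real assume "\<eta> > 0"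
    obtain s t where "s \<in> {a..b}" "t \<in> {a..b}" "s \<noteq> t" "\<bar>s - c\<bar> < \<eta>" "\<bar>t - c\<bar> < \<eta>" "\<phi> s = \<phi> t"
      using equal_values_near_maximum[OF cont c \<open>\<eta> > 0\<close>] by blast
    then show "\<exists>s\<in>{a..b}. \<exists>t\<in>{a..b}. s \<noteq> t \<and> \<bar>s - c\<bar> < \<eta> \<and> \<bar>t - c\<bar> < \<eta> \<and> \<phi> s = \<phi> t" by blast
  qed
  have **: ?thesis if c: "a < c" "c < b" "\<And>x. x \<in> {a..b} \<Longrightarrow> \<phi> c \<le> \<phi> x" for c
  proof (rule goal[of c])
    show "c \<in> {a..b}" using \<open>a < c\<close> \<open>c < b\<close> by simp
    fix \<eta> :: real assume "\<eta> > 0"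
    have "continuous_on {a..b} (\<lambda>x. - \<phi> x)" by (intro continuous_intros cont)
    then obtain s t where "s \<in> {a..b}" "t \<in> {a..b}" "s \<noteq> t" "\<bar>s - c\<bar> < \<eta>" "\<bar>t - c\<bar> < \<eta>" "- \<phi> s = - \<phi> t"
      using equal_values_near_maximum[of a b "\<lambda>x. - \<phi> x" c \<eta>] c \<open>\<eta> > 0\<close> by auto
    then show "\<exists>s\<in>{a..b}. \<exists>t\<in>{a..b}. s \<noteq> t \<and> \<bar>s - c\<bar> < \<eta> \<and> \<bar>t - c\<bar> < \<eta> \<and> \<phi> s = \<phi> t"
      by (intro bexI[of _ s] bexI[of _ t]) auto
  qed
  obtain M where M: "M \<in> {a..b}" "\<forall>x\<in>{a..b}. \<phi> x \<le> \<phi> M"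
    using continuous_attains_sup[OF compact_Icc _ cont] \<open>a < b\<close> by auto
  obtain m where m: "m \<in> {a..b}" "\<forall>x\<in>{a..b}. \<phi> m \<le> \<phi> x"
    using continuous_attains_inf[OF compact_Icc _ cont] \<open>a < b\<close> by auto
  show ?thesis
  proof (cases "M = a \<or> M = b")
    case False
    then show ?thesis using *[of M] M by auto
  next
    case True
    then have up: "\<phi> x \<le> \<phi> a" if "x \<in> {a..b}" for x using M eq that by auto
    show ?thesis
    proof (cases "m = a \<or> m = b")
      case False
      then show ?thesis using **[of m] m by auto
    next
      case True
      then have const: "\<phi> x = \<phi> a" if "x \<in> {a..b}" for x using m eq that up by (metis antisym)
      show ?thesis
      proof (rule *)
        show mid: "a < (a + b)/2" "(a + b)/2 < b" using \<open>a < b\<close> by auto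
        show "\<phi> x \<le> \<phi> ((a + b)/2)" if "x \<in> {a..b}" for x
          using const[OF that] const[of "(a + b)/2"] mid by auto
      qed
    qed
  qed
qed

section \<open>The distance from its end point along a semialgebraic arc\<close>

lemma norm_real2: "(norm (z::real^2))\<^sup>2 = (z $ 1)\<^sup>2 + (z $ 2)\<^sup>2"
  unfolding power2_norm_eq_inner by (simp add: inner_vec_def sum_2 power2_eq_square)

text \<open>
  Near the origin the zero sets of non-associated primes are disjoint except for the origin, so a connected piece of the arc
  cannot pass from one prime factor of \<open>p\<close> to another.
\<close>

lemma prime_vanishing_on_germ:
  fixes \<beta> :: "real \<Rightarrow> real^2"
  assumes cont: "continuous_on {0..\<delta>} \<beta>" and \<beta>0: "\<beta> 0 = 0"
    and nz: "\<And>u. u \<in> {0<..\<delta>} \<Longrightarrow> \<beta> u \<noteq> 0"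
    and "p \<noteq> 0" "0 < \<delta>'" "\<delta>' \<le> \<delta>" "\<And>u. u \<in> {0<..\<delta>'} \<Longrightarrow> ev p (\<beta> u $ 1) (\<beta> u $ 2) = 0"
  obtains \<pi> \<delta>'' where "prime_elem \<pi>" "0 < \<delta>''" "\<delta>'' \<le> \<delta>"
    "\<And>u. u \<in> {0<..\<delta>''} \<Longrightarrow> ev \<pi> (\<beta> u $ 1) (\<beta> u $ 2) = 0"
proof -
  let ?Z = "\<lambda>p \<delta>'. 0 < \<delta>' \<and> \<delta>' \<le> \<delta> \<and> (\<forall>u\<in>{0<..\<delta>'}. ev p (\<beta> u $ 1) (\<beta> u $ 2) = 0)"
  have "p \<noteq> 0 \<Longrightarrow> \<exists>\<delta>'. ?Z p \<delta>' \<Longrightarrow> \<exists>\<pi> \<delta>''. prime_elem \<pi> \<and> ?Z \<pi> \<delta>''"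
  proof (induction p rule: prime_divisors_induct)
    case zero
    then show ?case by simp
  next
    case (unit x)
    then obtain c where c: "x = [:[:c:]:]" "c \<noteq> 0"
      by (auto simp: is_unit_poly_iff)
    from unit obtain \<delta>' where "0 < \<delta>'" "\<forall>u\<in>{0<..\<delta>'}. ev x (\<beta> u $ 1) (\<beta> u $ 2) = 0" by blast
    then have "ev x (\<beta> \<delta>' $ 1) (\<beta> \<delta>' $ 2) = 0" by simp
    then show ?case using c by simp
  next
    case (factor p x)
    have p: "prime_elem p" using factor.hyps by (rule prime_imp_prime_elem)
    have "x \<noteq> 0" using factor.prems by auto
    obtain \<delta>' where \<delta>': "?Z (p * x) \<delta>'" using factor.prems by blast
    show ?case
    proof (cases "p dvd x")
      case True
      have "\<forall>u\<in>{0<..\<delta>'}. ev x (\<beta> u $ 1) (\<beta> u $ 2) = 0" using True \<delta>' by (auto elim!: dvdE)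
      then show ?thesis using factor.IH[OF \<open>x \<noteq> 0\<close>] \<delta>' by blast
    next
      case False
      then obtain \<epsilon> where \<epsilon>: "\<epsilon> > 0" "\<And>a b. 0 < a\<^sup>2 + b\<^sup>2 \<Longrightarrow> a\<^sup>2 + b\<^sup>2 < \<epsilon>\<^sup>2 \<Longrightarrow> ev p a b = 0 \<Longrightarrow> ev x a b \<noteq> 0"
        using prime_common_zeros_isolated[OF p] by blast
      obtain d where d: "d > 0" "\<forall>u\<in>{0..\<delta>}. dist u 0 < d \<longrightarrow> dist (\<beta> u) (\<beta> 0) < \<epsilon>"
        using cont[unfolded continuous_on_iff, rule_format, of 0 \<epsilon>] \<epsilon>(1) \<delta>' by auto
      define e where "e = min \<delta>' (d/2)"
      have e: "0 < e" "e \<le> \<delta>'" "e < d" using d \<delta>' unfolding e_def by auto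
      have disj: "ev p (\<beta> u $ 1) (\<beta> u $ 2) \<noteq> 0 \<or> ev x (\<beta> u $ 1) (\<beta> u $ 2) \<noteq> 0" if u: "u \<in> {0<..e}" for u
      proof -
        have "norm (\<beta> u) < \<epsilon>" using d(2) u e \<delta>' \<beta>0 by (auto simp: dist_real_def)
        then have "(norm (\<beta> u))\<^sup>2 < \<epsilon>\<^sup>2" by (intro power_strict_mono) auto
        moreover have "(norm (\<beta> u))\<^sup>2 > 0" using nz[of u] u e \<delta>' by auto
        moreover have "(norm (\<beta> u))\<^sup>2 = (\<beta> u $ 1)\<^sup>2 + (\<beta> u $ 2)\<^sup>2" by (rule norm_real2)
        ultimately show ?thesis using \<epsilon>(2) by metis
      qed
      have cont_e: "continuous_on {0<..e} \<beta>" by (rule continuous_on_subset[OF cont]) (use e \<delta>' in auto)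
      have closedin: "closedin (top_of_set {0<..e}) {u\<in>{0<..e}. ev f (\<beta> u $ 1) (\<beta> u $ 2) = 0}" for f
        by (intro continuous_closedin_preimage_constant continuous_intros cont_e)
      have cover: "{u\<in>{0<..e}. ev p (\<beta> u $ 1) (\<beta> u $ 2) = 0} \<union> {u\<in>{0<..e}. ev x (\<beta> u $ 1) (\<beta> u $ 2) = 0} = {0<..e}"
        using \<delta>' e by auto
      have "connected {0<..e}" by simp
      then have "{u\<in>{0<..e}. ev p (\<beta> u $ 1) (\<beta> u $ 2) = 0} = {} \<or> {u\<in>{0<..e}. ev x (\<beta> u $ 1) (\<beta> u $ 2) = 0} = {}"
        unfolding connected_closedin_eq using closedin[of p] closedin[of x] cover disj by blast
      then have "?Z p e \<or> ?Z x e" using cover e \<delta>' by auto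
      then show ?thesis using p factor.IH[OF \<open>x \<noteq> 0\<close>] by blast
    qed
  qed
  then show ?thesis using assms that by blast
qed

text \<open>
  Along a circle \<open>p\<close> solves the linear differential equation \<open>u' = c u\<close>, whose solutions vanish everywhere
  or nowhere.
\<close>

lemma zero_spreads_along_circle:
  assumes q: "\<And>\<rho> \<theta>. ((\<lambda>\<theta>. ev p (\<rho> * cos \<theta>) (\<rho> * sin \<theta>)) has_real_derivative
       ev (p * c) (\<rho> * cos \<theta>) (\<rho> * sin \<theta>)) (at \<theta>)"
    and zero: "ev p (\<rho> * cos \<theta>0) (\<rho> * sin \<theta>0) = 0"
  shows "ev p (\<rho> * cos \<theta>) (\<rho> * sin \<theta>) = 0"
proof -
  let ?c = "\<lambda>\<theta>. ev c (\<rho> * cos \<theta>) (\<rho> * sin \<theta>)"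
  let ?f = "\<lambda>\<theta>. ev p (\<rho> * cos \<theta>) (\<rho> * sin \<theta>)"
  define a b where "a = min \<theta>0 \<theta> - 1" and "b = max \<theta>0 \<theta> + 1"
  have "continuous_on {a..b} ?c" by (intro continuous_intros)
  then obtain G where G: "\<And>t. t \<in> {a..b} \<Longrightarrow> (G has_vector_derivative ?c t) (at t within {a..b})"
    using antiderivative_continuous by blast
  have "((\<lambda>t. ?f t * exp (- G t)) has_real_derivative 0) (at t within {a..b})" if t: "t \<in> {a..b}" for t
  proof -
    have "(?f has_real_derivative ev p (\<rho> * cos t) (\<rho> * sin t) * ?c t) (at t within {a..b})"
      using DERIV_subset[OF q[of \<rho> t]] by simp
    moreover have "((\<lambda>t. exp (- G t)) has_real_derivative exp (- G t) * (- ?c t)) (at t within {a..b})"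
      using G[OF t, folded has_real_derivative_iff_has_vector_derivative]
      by (auto intro!: derivative_eq_intros)
    ultimately have "((\<lambda>t. ?f t * exp (- G t)) has_real_derivative
      ev p (\<rho> * cos t) (\<rho> * sin t) * ?c t * exp (- G t) + exp (- G t) * (- ?c t) * ?f t) (at t within {a..b})"
      by (rule DERIV_mult)
    then show ?thesis by (simp add: mult_ac)
  qed
  then have "\<exists>k. \<forall>t\<in>{a..b}. ?f t * exp (- G t) = k"
    by (intro has_field_derivative_zero_constant) auto
  moreover have "\<theta> \<in> {a..b}" "\<theta>0 \<in> {a..b}" unfolding a_def b_def by auto
  ultimately have "?f \<theta> * exp (- G \<theta>) = ?f \<theta>0 * exp (- G \<theta>0)" by metis
  then show ?thesis using zero by simp
qed

text \<open>
  Pass to a prime \<open>p\<close> that vanishes on the arc near the origin, and let \<open>q\<close> be its rotational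
  derivative.  If \<open>p\<close> divided \<open>q\<close>, the zeros of \<open>p\<close> on the arc would spread along whole circles and fill a disk.
  So \<open>q\<close> has no zeros on the arc near the origin.  But if the norm took the same value twice, it would
  do so at arbitrarily close points of the arc, and \<open>q\<close> would vanish at a limit of such pairs.
\<close>

lemma algebraic_arc_radius_strict_mono:
  fixes \<beta> :: "real \<Rightarrow> real^2"
  assumes "\<delta> > 0" and cont: "continuous_on {0..\<delta>} \<beta>" and inj: "inj_on \<beta> {0..\<delta>}" and \<beta>0: "\<beta> 0 = 0"
    and "p \<noteq> 0" and "\<And>u. u \<in> {0..\<delta>} \<Longrightarrow> ev p (\<beta> u $ 1) (\<beta> u $ 2) = 0"
  obtains \<delta>' where "0 < \<delta>'" "\<delta>' \<le> \<delta>" "strict_mono_on {0..\<delta>'} (\<lambda>u. norm (\<beta> u))"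
proof -
  have nz: "\<beta> u \<noteq> 0" if "u \<in> {0<..\<delta>}" for u
    using inj_onD[OF inj, of u 0] that \<beta>0 by auto
  note norm2 = norm_real2
  obtain \<pi> d where \<pi>: "prime_elem \<pi>" and d: "0 < d" "d \<le> \<delta>"
    and \<pi>0: "\<And>u. u \<in> {0<..d} \<Longrightarrow> ev \<pi> (\<beta> u $ 1) (\<beta> u $ 2) = 0"
    using prime_vanishing_on_germ[OF cont \<beta>0 nz \<open>p \<noteq> 0\<close> \<open>\<delta> > 0\<close> order_refl] assms by auto
  obtain q where q: "\<And>\<rho> \<theta>. ((\<lambda>\<theta>. ev \<pi> (\<rho> * cos \<theta>) (\<rho> * sin \<theta>)) has_real_derivative
       ev q (\<rho> * cos \<theta>) (\<rho> * sin \<theta>)) (at \<theta>)"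
    using rotational_derivative[of \<pi>] by blast
  have "\<not> \<pi> dvd q"
  proof
    assume "\<pi> dvd q"
    then obtain c where c: "q = \<pi> * c" by (elim dvdE)
    have "\<pi> = 0"
    proof (rule ev_zero_near_origin[of "norm (\<beta> d)"])
      show "norm (\<beta> d) > 0" using nz[of d] d by simp
      fix x y :: real assume xy: "0 < x\<^sup>2 + y\<^sup>2" "x\<^sup>2 + y\<^sup>2 < (norm (\<beta> d))\<^sup>2"
      define \<rho> where "\<rho> = sqrt (x\<^sup>2 + y\<^sup>2)"
      have \<rho>: "0 < \<rho>" "\<rho>\<^sup>2 = x\<^sup>2 + y\<^sup>2" using xy by (auto simp: \<rho>_def)
      have "\<rho> < norm (\<beta> d)" using xy \<rho> by (metis norm_ge_zero power2_less_imp_less)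
      have "continuous_on {0..d} (\<lambda>u. norm (\<beta> u))"
        by (intro continuous_intros continuous_on_subset[OF cont]) (use d in auto)
      then obtain u where u: "0 \<le> u" "u \<le> d" "norm (\<beta> u) = \<rho>"
        using IVT'[of "\<lambda>u. norm (\<beta> u)" 0 \<rho> d] \<rho> \<beta>0 \<open>\<rho> < norm (\<beta> d)\<close> d by auto
      have "u \<noteq> 0" using u \<rho> \<beta>0 by auto
      have polar: "\<exists>t. a = \<rho> * cos t \<and> b = \<rho> * sin t" if "a\<^sup>2 + b\<^sup>2 = \<rho>\<^sup>2" for a b
      proof -
        have "(a/\<rho>)\<^sup>2 + (b/\<rho>)\<^sup>2 = 1"
          using that \<open>\<rho> > 0\<close> by (simp add: power_divide flip: add_divide_distrib)
        then obtain t where "a/\<rho> = cos t" "b/\<rho> = sin t" by (rule sincos_total_2pi)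
        then show ?thesis using \<open>\<rho> > 0\<close> by (intro exI[of _ t]) (simp add: field_simps)
      qed
      obtain s where "\<beta> u $ 1 = \<rho> * cos s" "\<beta> u $ 2 = \<rho> * sin s" using polar[of "\<beta> u $ 1" "\<beta> u $ 2"] norm2[of "\<beta> u"] u by auto
      then have "ev \<pi> (\<rho> * cos s) (\<rho> * sin s) = 0" using \<pi>0[of u] u \<open>u \<noteq> 0\<close> by simp
      moreover obtain t where "x = \<rho> * cos t" "y = \<rho> * sin t" using polar[of x y] \<rho> by auto
      ultimately show "ev \<pi> x y = 0"
        using zero_spreads_along_circle[OF q[unfolded c]] by simp
    qed
    then show False using \<pi> by simp
  qed
  then obtain \<epsilon> where \<epsilon>: "\<epsilon> > 0" "\<And>x y. 0 < x\<^sup>2 + y\<^sup>2 \<Longrightarrow> x\<^sup>2 + y\<^sup>2 < \<epsilon>\<^sup>2 \<Longrightarrow> ev \<pi> x y = 0 \<Longrightarrow> ev q x y \<noteq> 0"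
    using prime_common_zeros_isolated[OF \<pi>] by blast
  obtain d' where d': "d' > 0" "\<forall>u\<in>{0..\<delta>}. dist u 0 < d' \<longrightarrow> dist (\<beta> u) (\<beta> 0) < \<epsilon>"
    using cont[unfolded continuous_on_iff, rule_format, of 0 \<epsilon>] \<epsilon>(1) \<open>\<delta> > 0\<close> by auto
  define e where "e = min d (d'/2)"
  have e: "0 < e" "e \<le> d" "e < d'" "e \<le> \<delta>" using d d' unfolding e_def by auto
  have q_nz: "ev q (\<beta> u $ 1) (\<beta> u $ 2) \<noteq> 0" if u: "u \<in> {0<..e}" for u
  proof -
    have "norm (\<beta> u) < \<epsilon>" using d'(2) u e \<beta>0 by (auto simp: dist_real_def)
    then have "(norm (\<beta> u))\<^sup>2 < \<epsilon>\<^sup>2" by (intro power_strict_mono) auto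
    moreover have "(norm (\<beta> u))\<^sup>2 > 0" using nz[of u] u e by auto
    moreover have "ev \<pi> (\<beta> u $ 1) (\<beta> u $ 2) = 0" using \<pi>0[of u] u e by auto
    ultimately show ?thesis using \<epsilon>(2) unfolding norm2 by blast
  qed
  have cont_e: "continuous_on {0..e} \<beta>" using continuous_on_subset[OF cont] e by auto
  have inj_norm: "norm (\<beta> a) \<noteq> norm (\<beta> b)" if ab: "0 \<le> a" "a < b" "b \<le> e" for a b
  proof
    assume eq: "norm (\<beta> a) = norm (\<beta> b)"
    have "a \<noteq> 0" using eq \<beta>0 nz[of b] ab e by auto
    have "continuous_on {a..b} (\<lambda>u. norm (\<beta> u))"
      by (intro continuous_intros continuous_on_subset[OF cont_e]) (use ab in auto)
    then obtain c where c: "c \<in> {a..b}" and near: "\<And>\<eta>. \<eta> > 0 \<Longrightarrow>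
        \<exists>s\<in>{a..b}. \<exists>t\<in>{a..b}. s \<noteq> t \<and> \<bar>s - c\<bar> < \<eta> \<and> \<bar>t - c\<bar> < \<eta> \<and> norm (\<beta> s) = norm (\<beta> t)"
      using equal_values_accumulate[OF _ ab(2) eq] by blast
    have "isCont (\<lambda>z::real^2. ev q (z $ 1) (z $ 2)) (\<beta> c)"
    proof -
      have "continuous_on UNIV (\<lambda>z::real^2. ev q (z $ 1) (z $ 2))" by (intro continuous_intros)
      then show ?thesis by (simp add: continuous_on_eq_continuous_at)
    qed
    moreover have "ev q (\<beta> c $ 1) (\<beta> c $ 2) \<noteq> 0" using q_nz[of c] c ab \<open>a \<noteq> 0\<close> by auto
    ultimately obtain r where r: "r > 0" "\<And>z. dist (\<beta> c) z < r \<Longrightarrow> ev q (z $ 1) (z $ 2) \<noteq> 0"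
      using continuous_at_avoid[of "\<beta> c" "\<lambda>z::real^2. ev q (z $ 1) (z $ 2)" 0] by blast
    have "c \<in> {0..e}" using c ab by auto
    then obtain \<eta> where \<eta>: "\<eta> > 0" "\<And>u. u \<in> {0..e} \<Longrightarrow> dist u c < \<eta> \<Longrightarrow> dist (\<beta> u) (\<beta> c) < r/3"
      using cont_e[unfolded continuous_on_iff, rule_format, of c "r/3"] r(1) by auto
    obtain s t where st: "s \<in> {a..b}" "t \<in> {a..b}" "s \<noteq> t" "\<bar>s - c\<bar> < \<eta>" "\<bar>t - c\<bar> < \<eta>" "norm (\<beta> s) = norm (\<beta> t)"
      using near[OF \<eta>(1)] by blast
    have close: "dist (\<beta> s) (\<beta> c) < r/3" "dist (\<beta> t) (\<beta> c) < r/3"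
      using \<eta>(2)[of s] \<eta>(2)[of t] st ab by (auto simp: dist_real_def)
    have "\<beta> s \<noteq> \<beta> t" using inj_onD[OF inj, of s t] st ab e by auto
    have "s \<in> {0<..d}" "t \<in> {0<..d}" using st ab e \<open>a \<noteq> 0\<close> by auto
    have "(\<beta> s $ 1, \<beta> s $ 2) \<noteq> (\<beta> t $ 1, \<beta> t $ 2)"
      using \<open>\<beta> s \<noteq> \<beta> t\<close> by (auto simp: vec_eq_iff forall_2)
    moreover have "norm (\<beta> s) > 0" using nz[of s] \<open>s \<in> {0<..d}\<close> d by auto
    moreover have "(\<beta> s $ 1)\<^sup>2 + (\<beta> s $ 2)\<^sup>2 = (norm (\<beta> s))\<^sup>2"
      "(\<beta> t $ 1)\<^sup>2 + (\<beta> t $ 2)\<^sup>2 = (norm (\<beta> s))\<^sup>2"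
      using norm2[of "\<beta> s"] norm2[of "\<beta> t"] st(6) by auto
    ultimately obtain x y where xy: "ev q x y = 0"
      "(x - \<beta> s $ 1)\<^sup>2 + (y - \<beta> s $ 2)\<^sup>2 \<le> (\<beta> t $ 1 - \<beta> s $ 1)\<^sup>2 + (\<beta> t $ 2 - \<beta> s $ 2)\<^sup>2"
      using chord_zero_of_rotational_derivative[OF q, of "norm (\<beta> s)" "\<beta> s $ 1" "\<beta> s $ 2" "\<beta> t $ 1" "\<beta> t $ 2"]
        \<pi>0[OF \<open>s \<in> {0<..d}\<close>] \<pi>0[OF \<open>t \<in> {0<..d}\<close>] by blast
    define z :: "real^2" where "z = vector [x, y]"
    have z: "z $ 1 = x" "z $ 2 = y" by (simp_all add: z_def)
    have "(norm (z - \<beta> s))\<^sup>2 \<le> (norm (\<beta> t - \<beta> s))\<^sup>2" using xy(2) by (simp add: norm2 z)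
    then have "dist z (\<beta> s) \<le> dist (\<beta> t) (\<beta> s)" unfolding dist_norm by (rule power2_le_imp_le) simp
    moreover have "dist (\<beta> t) (\<beta> s) \<le> dist (\<beta> t) (\<beta> c) + dist (\<beta> s) (\<beta> c)"
      by (rule dist_triangle2)
    moreover have "dist (\<beta> c) z \<le> dist (\<beta> s) (\<beta> c) + dist z (\<beta> s)"
      by (metis add.commute dist_commute dist_triangle)
    ultimately have "dist (\<beta> c) z < r" using close by linarith
    then show False using r(2) z xy(1) by auto
  qed
  have "strict_mono_on {0..e} (\<lambda>u. norm (\<beta> u))"
  proof (rule strict_mono_onI)
    fix a b assume ab: "a \<in> {0..e}" "b \<in> {0..e}" "a < b"
    show "norm (\<beta> a) < norm (\<beta> b)"
    proof (rule ccontr)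
      assume "\<not> norm (\<beta> a) < norm (\<beta> b)"
      then have "norm (\<beta> b) \<le> norm (\<beta> a)" by simp
      moreover have "continuous_on {0..a} (\<lambda>u. norm (\<beta> u))"
        by (intro continuous_intros continuous_on_subset[OF cont_e]) (use ab in auto)
      ultimately obtain u where "0 \<le> u" "u \<le> a" "norm (\<beta> u) = norm (\<beta> b)"
        using IVT'[of "\<lambda>u. norm (\<beta> u)" 0 "norm (\<beta> b)" a] \<beta>0 ab by auto
      then show False using inj_norm[of u b] ab by auto
    qed
  qed
  then show ?thesis using that[of e] e by blast
qed

lemma real_polynomial_function_ev:
  assumes "real_polynomial_function (p :: real^2 \<Rightarrow> real)"
  obtains P where "\<And>z. p z = ev P (z $ 1) (z $ 2)"
proof -
  have "\<exists>P. \<forall>z. p z = ev P (z $ 1) (z $ 2)"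
    using assms
  proof induction
    case (linear f)
    then interpret bounded_linear f .
    have "f z = ev [:[:0, f (axis 1 1):], [:f (axis 2 1):]:] (z $ 1) (z $ 2)" for z
    proof -
      have "z = (z $ 1) *\<^sub>R axis 1 1 + (z $ 2) *\<^sub>R axis 2 1"
        by (simp add: vec_eq_iff forall_2 axis_def)
      then have "f z = (z $ 1) *\<^sub>R f (axis 1 1) + (z $ 2) *\<^sub>R f (axis 2 1)"
        by (metis add scaleR)
      then show ?thesis by (simp add: ev_pCons)
    qed
    then show ?case by blast
  next
    case (const c)
    have "c = ev [:[:c:]:] (z $ 1) (z $ 2)" for z :: "real^2" by simp
    then show ?case by blast
  next
    case (add f g)
    then show ?case by (metis ev_simps(3))
  next
    case (mult f g)
    then show ?case by (metis ev_simps(6))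
  qed
  then show ?thesis using that by blast
qed

text \<open>
  Membership in \<open>S\<close> is decided by signs of finitely many polynomials; \<open>P\<close> is the product of the
  nonzero ones among them.
\<close>

lemma semialgebraic_open_off_algebraic_set:
  assumes "semialgebraic S"
  obtains P where "P \<noteq> 0" "open {z \<in> S. ev P (z $ 1) (z $ 2) \<noteq> 0}" "open {z \<in> - S. ev P (z $ 1) (z $ 2) \<noteq> 0}"
proof -
  have cont: "continuous_on UNIV (\<lambda>z::real^2. ev P (z $ 1) (z $ 2))" for P
    by (intro continuous_intros)
  have op: "open {z::real^2. ev P (z $ 1) (z $ 2) \<noteq> 0}" for P
    using open_Collect_neq[OF cont[of P] continuous_on_const] .
  have "\<exists>P. P \<noteq> 0 \<and> open {z \<in> S. ev P (z $ 1) (z $ 2) \<noteq> 0} \<and> open {z \<in> - S. ev P (z $ 1) (z $ 2) \<noteq> 0}"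
    using assms
  proof induction
    case (positive p)
    then obtain P where P: "\<And>z. p z = ev P (z $ 1) (z $ 2)" using real_polynomial_function_ev by blast
    show ?case
    proof (cases "P = 0")
      case True
      then show ?thesis by (intro exI[of _ 1]) (simp add: P)
    next
      case False
      have "{z \<in> {x. p x > 0}. ev P (z $ 1) (z $ 2) \<noteq> 0} = {z. 0 < ev P (z $ 1) (z $ 2)}"
        "{z \<in> - {x. p x > 0}. ev P (z $ 1) (z $ 2) \<noteq> 0} = {z. ev P (z $ 1) (z $ 2) < 0}"
        by (auto simp: P)
      then show ?thesis using False open_Collect_less[OF continuous_on_const cont[of P]]
        open_Collect_less[OF cont[of P] continuous_on_const] by (intro exI[of _ P]) auto
    qed
  next
    case (compl S)
    then show ?case by auto
  next
    case (union S T)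
    then obtain P Q where P: "P \<noteq> 0" "open {z \<in> S. ev P (z $ 1) (z $ 2) \<noteq> 0}" "open {z \<in> - S. ev P (z $ 1) (z $ 2) \<noteq> 0}"
      and Q: "Q \<noteq> 0" "open {z \<in> T. ev Q (z $ 1) (z $ 2) \<noteq> 0}" "open {z \<in> - T. ev Q (z $ 1) (z $ 2) \<noteq> 0}" by blast
    have "{z \<in> S \<union> T. ev (P * Q) (z $ 1) (z $ 2) \<noteq> 0} =
      ({z \<in> S. ev P (z $ 1) (z $ 2) \<noteq> 0} \<inter> {z. ev Q (z $ 1) (z $ 2) \<noteq> 0}) \<union>
      ({z \<in> T. ev Q (z $ 1) (z $ 2) \<noteq> 0} \<inter> {z. ev P (z $ 1) (z $ 2) \<noteq> 0})" by auto
    moreover have "{z \<in> - (S \<union> T). ev (P * Q) (z $ 1) (z $ 2) \<noteq> 0} =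
      {z \<in> - S. ev P (z $ 1) (z $ 2) \<noteq> 0} \<inter> {z \<in> - T. ev Q (z $ 1) (z $ 2) \<noteq> 0}" by auto
    ultimately show ?case using P Q op
      by (intro exI[of _ "P * Q"]) (auto intro!: open_Un open_Int simp del: Collect_conj_eq)
  qed
  then show ?thesis using that by blast
qed

text \<open>
  A semialgebraic set without interior lies in the zero set of a nonzero polynomial.
\<close>

lemma semialgebraic_arc_radius_strict_mono:
  fixes \<beta> :: "real \<Rightarrow> real^2"
  assumes "semialgebraic S" "interior S = {}"
    and "\<delta> > 0" "continuous_on {0..\<delta>} \<beta>" "inj_on \<beta> {0..\<delta>}" "\<beta> ` {0..\<delta>} \<subseteq> S"
  obtains \<delta>' where "0 < \<delta>'" "\<delta>' \<le> \<delta>" "strict_mono_on {0..\<delta>'} (\<lambda>u. dist (\<beta> 0) (\<beta> u))"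
proof -
  obtain P where P: "P \<noteq> 0" "open {z \<in> S. ev P (z $ 1) (z $ 2) \<noteq> 0}"
    using semialgebraic_open_off_algebraic_set[OF assms(1)] .
  then have "{z \<in> S. ev P (z $ 1) (z $ 2) \<noteq> 0} \<subseteq> interior S" by (intro interior_maximal) auto
  then have zero: "ev P (z $ 1) (z $ 2) = 0" if "z \<in> S" for z using that assms(2) by auto
  have "real_polynomial_function (\<lambda>z::real^2. ev P (z $ 1) (z $ 2))"
  proof (induction P)
    case (pCons a P)
    have "real_polynomial_function (\<lambda>z::real^2. poly a (z $ 1))"
    proof (induction a)
      case (pCons c a)
      then show ?case unfolding poly_pCons
        by (intro real_polynomial_function.intros(3)[OF real_polynomial_function.intros(2)]
            real_polynomial_function.intros(4)[OF real_polynomial_function.intros(1)] bounded_linear_vec_nth)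
    qed (simp add: real_polynomial_function.intros)
    then show ?case unfolding ev_pCons using pCons
      by (intro real_polynomial_function.intros(3) real_polynomial_function.intros(4)
          real_polynomial_function.intros(1)[OF bounded_linear_vec_nth])
  qed (auto intro: real_polynomial_function.intros)
  moreover have "polynomial_function (\<lambda>z. z + \<beta> 0)"
    by (intro polynomial_function_add polynomial_function_id polynomial_function_const)
  ultimately have "real_polynomial_function ((\<lambda>z::real^2. ev P (z $ 1) (z $ 2)) \<circ> (\<lambda>z. z + \<beta> 0))"
    by (intro real_polynomial_function_compose)
  then obtain Q where "\<And>z. ((\<lambda>z::real^2. ev P (z $ 1) (z $ 2)) \<circ> (\<lambda>z. z + \<beta> 0)) z = ev Q (z $ 1) (z $ 2)"
    by (rule real_polynomial_function_ev) blast
  then have Q: "ev P ((z + \<beta> 0) $ 1) ((z + \<beta> 0) $ 2) = ev Q (z $ 1) (z $ 2)" for z :: "real^2"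
    unfolding comp_def by blast
  have "Q \<noteq> 0"
  proof
    assume "Q = 0"
    then have "ev P x y = 0" for x y
      using Q[of "vector [x, y] - \<beta> 0"] by simp
    with ev_zero_near_origin[of 1 P] P(1) show False by auto
  qed
  have cont: "continuous_on {0..\<delta>} (\<lambda>u. \<beta> u - \<beta> 0)" by (intro continuous_intros assms)
  have inj: "inj_on (\<lambda>u. \<beta> u - \<beta> 0) {0..\<delta>}"
    using inj_onD[OF assms(5)] by (intro inj_onI) (simp only: diff_left_imp_eq right_minus_eq diff_right_commute add_right_cancel diff_conv_add_uminus)
  have zero': "ev Q ((\<beta> u - \<beta> 0) $ 1) ((\<beta> u - \<beta> 0) $ 2) = 0" if "u \<in> {0..\<delta>}" for u
  proof -
    have "\<beta> u \<in> S" using that assms(6) by blast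
    have "ev P ((\<beta> u - \<beta> 0 + \<beta> 0) $ 1) ((\<beta> u - \<beta> 0 + \<beta> 0) $ 2) = 0"
      unfolding diff_add_cancel by (rule zero[OF \<open>\<beta> u \<in> S\<close>])
    then show ?thesis unfolding Q .
  qed
  obtain \<delta>' where \<delta>': "0 < \<delta>'" "\<delta>' \<le> \<delta>" "strict_mono_on {0..\<delta>'} (\<lambda>u. norm (\<beta> u - \<beta> 0))"
    using algebraic_arc_radius_strict_mono[OF \<open>\<delta> > 0\<close> cont inj _ \<open>Q \<noteq> 0\<close> zero'] by simp blast
  show ?thesis
    by (rule that[OF \<delta>'(1,2)]) (use \<delta>'(3) in \<open>simp only: dist_norm norm_minus_commute[of "\<beta> 0"]\<close>)
qed

section \<open>Filling a puncture in an arc\<close>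

abbreviation interval :: "real topology" where "interval \<equiv> top_of_set {-1<..<1}"
abbreviation punctured :: "real set" where "punctured \<equiv> {-1<..<1} - {0}"

text \<open>
  The section sends \<open>n\<close> to the \<open>n\<close>-th power of a preimage of a generator.
\<close>

lemma extension_by_integers_splits:
  assumes A: "group A" and B: "comm_group B" and Q: "Q \<cong> integer_group" "group Q"
    and f: "f \<in> hom A B" "inj_on f (carrier A)" and g: "g \<in> hom B Q" "g ` carrier B = carrier Q"
    and exact: "f ` carrier A = kernel B Q g"
  shows "B \<cong> A \<times>\<times> integer_group"
proof -
  interpret A: group A by fact
  interpret B: comm_group B by fact
  obtain \<theta> where \<theta>: "\<theta> \<in> iso Q integer_group" using Q unfolding is_iso_def by blast
  define g' where "g' = \<theta> \<circ> g"
  have g'hom: "g' \<in> hom B integer_group"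
    unfolding g'_def using g(1) \<theta> by (intro hom_compose) (auto simp: iso_def)
  then interpret g': group_hom B integer_group g'
    by (simp add: group_hom_def group_hom_axioms_def B.is_group)
  have g'1: "g' b = 0 \<longleftrightarrow> b \<in> f ` carrier A" if "b \<in> carrier B" for b
  proof -
    have "g b \<in> carrier Q" using g(1) that by (auto simp: hom_def)
    have "g' b = 0 \<longleftrightarrow> g b = \<one>\<^bsub>Q\<^esub>"
    proof -
      interpret \<theta>: group_hom Q integer_group \<theta> using \<theta> Q(2) by (simp add: group_hom_def group_hom_axioms_def iso_def)
      have "inj_on \<theta> (carrier Q)" using \<theta> by (simp add: iso_def bij_betw_def)
      have "g b = \<one>\<^bsub>Q\<^esub>" if "\<theta> (g b) = \<theta> \<one>\<^bsub>Q\<^esub>"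
        using inj_onD[OF \<open>inj_on \<theta> (carrier Q)\<close> that \<open>g b \<in> carrier Q\<close> \<theta>.G.one_closed] .
      moreover have "\<theta> \<one>\<^bsub>Q\<^esub> = 0" using \<theta>.hom_one by simp
      ultimately show ?thesis unfolding g'_def comp_def by metis
    qed
    then show ?thesis using that by (simp add: exact kernel_def)
  qed
  interpret f: group_hom A B f using f by (simp add: group_hom_def group_hom_axioms_def A.is_group B.is_group)
  have "g' ` carrier B = UNIV" 
    using \<theta> unfolding g'_def image_comp[symmetric] g(2) by (simp add: iso_def bij_betw_def)
  then obtain t where t: "t \<in> carrier B" "g' t = 1" by (metis UNIV_I imageE)
  have g't: "g' (t [^]\<^bsub>B\<^esub> (n::int)) = n" for n
    using g'.hom_int_pow[OF t(1), of n] t by simp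
  let ?\<phi> = "\<lambda>(a, n::int). f a \<otimes>\<^bsub>B\<^esub> t [^]\<^bsub>B\<^esub> n"
  have g'\<phi>: "g' (?\<phi> (a, n)) = n" if "a \<in> carrier A" for a n
    using g'1[of "f a"] g't[of n] that t by simp
  have "?\<phi> \<in> iso (A \<times>\<times> integer_group) B"
  proof (rule isoI)
    show "?\<phi> \<in> hom (A \<times>\<times> integer_group) B"
    proof (rule homI)
      fix x y assume "x \<in> carrier (A \<times>\<times> integer_group)" "y \<in> carrier (A \<times>\<times> integer_group)"
      then show "?\<phi> (x \<otimes>\<^bsub>A \<times>\<times> integer_group\<^esub> y) = ?\<phi> x \<otimes>\<^bsub>B\<^esub> ?\<phi> y"
        using t by (cases x; cases y) (simp add: B.int_pow_mult B.m_ac)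
    qed (use t in auto)
    have inj: "inj_on ?\<phi> (carrier (A \<times>\<times> integer_group))"
    proof (rule inj_onI)
      fix x y assume xy: "x \<in> carrier (A \<times>\<times> integer_group)" "y \<in> carrier (A \<times>\<times> integer_group)" "?\<phi> x = ?\<phi> y"
      obtain a n b m where [simp]: "x = (a, n)" "y = (b, m)" by (cases x; cases y)
      have "n = m" using g'\<phi>[of a n] g'\<phi>[of b m] xy by simp
      then have "f a = f b" using xy t by simp
      then show "x = y" using xy f(2) \<open>n = m\<close> by (auto dest: inj_onD)
    qed
    moreover have "?\<phi> ` carrier (A \<times>\<times> integer_group) = carrier B"
    proof
      show "?\<phi> ` carrier (A \<times>\<times> integer_group) \<subseteq> carrier B" using t by auto
      show "carrier B \<subseteq> ?\<phi> ` carrier (A \<times>\<times> integer_group)"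
      proof
        fix b assume b: "b \<in> carrier B"
        let ?c = "b \<otimes>\<^bsub>B\<^esub> t [^]\<^bsub>B\<^esub> (- g' b)"
        have "g' ?c = 0" using b t g't by simp
        then obtain a where a: "a \<in> carrier A" "f a = ?c" using g'1[of ?c] b t by auto
        have "?\<phi> (a, g' b) = b"
          using a b t by (simp add: B.m_assoc B.int_pow_neg)
        then show "b \<in> ?\<phi> ` carrier (A \<times>\<times> integer_group)"
          using a by (intro image_eqI[where x = "(a, g' b)"]) auto
      qed
    qed
    ultimately show "bij_betw ?\<phi> (carrier (A \<times>\<times> integer_group)) (carrier B)" by (simp add: bij_betw_def)
  qed
  then have "A \<times>\<times> integer_group \<cong> B" by (rule is_isoI)
  moreover have "group (A \<times>\<times> integer_group)" by (intro DirProd_group A group_integer_group)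
  ultimately show ?thesis by (rule group.iso_sym[rotated])
qed

lemma free_abelian_rank_Suc:
  "product_group {..<m::nat} (\<lambda>_. integer_group) \<times>\<times> integer_group
    \<cong> product_group {..<Suc m} (\<lambda>_. integer_group)"
proof -
  let ?P = "\<lambda>m::nat. product_group {..<m} (\<lambda>_. integer_group)"
  let ?f = "\<lambda>x::nat \<Rightarrow> int. (restrict x {..<m}, x m)"
  have "?f \<in> iso (?P (Suc m)) (?P m \<times>\<times> integer_group)"
  proof (rule isoI)
    show "?f \<in> hom (?P (Suc m)) (?P m \<times>\<times> integer_group)"
    proof (rule homI)
      fix x y assume "x \<in> carrier (?P (Suc m))" "y \<in> carrier (?P (Suc m))"
      show "?f (x \<otimes>\<^bsub>?P (Suc m)\<^esub> y) = ?f x \<otimes>\<^bsub>?P m \<times>\<times> integer_group\<^esub> ?f y"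
        by (simp add: fun_eq_iff)
    qed (simp add: PiE_iff)
    show "bij_betw ?f (carrier (?P (Suc m))) (carrier (?P m \<times>\<times> integer_group))"
    proof (rule bij_betwI[where g = "\<lambda>(y, n). \<lambda>i. if i = m then n else y i"])
      show "?f \<in> carrier (?P (Suc m)) \<rightarrow> carrier (?P m \<times>\<times> integer_group)"
        by (simp add: PiE_iff)
      show "(\<lambda>(y, n) i. if i = m then n else y i) \<in> carrier (?P m \<times>\<times> integer_group) \<rightarrow> carrier (?P (Suc m))"
      proof
        fix z assume "z \<in> carrier (?P m \<times>\<times> integer_group)"
        then obtain y n where z: "z = (y, n)" and y: "y \<in> extensional {..<m}" by (cases z) (auto simp: PiE_def)
        have "(\<lambda>i. if i = m then n else y i) \<in> extensional {..<Suc m}"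
          using y by (simp add: extensional_def)
        then show "(\<lambda>(y, n) i. if i = m then n else y i) z \<in> carrier (?P (Suc m))"
          unfolding z by (simp add: PiE_iff)
      qed
      show "(\<lambda>(y, n) i. if i = m then n else y i) (?f x) = x" if "x \<in> carrier (?P (Suc m))" for x
      proof
        fix i
        have "x \<in> extensional {..<Suc m}" using that by (simp add: PiE_def)
        then have "x i = undefined" if "\<not> i < Suc m" using that by (simp add: extensional_def)
        then show "(\<lambda>(y, n) i. if i = m then n else y i) (?f x) i = x i"
          by (cases "i < m"; cases "i = m") simp_all
      qed
      show "?f ((\<lambda>(y, n) i. if i = m then n else y i) z) = z" if "z \<in> carrier (?P m \<times>\<times> integer_group)" for z
      proof -
        from that obtain y n where z: "z = (y, n)" and y: "y \<in> extensional {..<m}" by (cases z) (auto simp: PiE_def)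
        have "restrict (\<lambda>i. if i = m then n else y i) {..<m} = y"
          by (rule ext) (use extensional_arb[OF y] in \<open>simp add: restrict_def\<close>)
        then show ?thesis by (simp add: z)
      qed
    qed
  qed
  then have "?P (Suc m) \<cong> ?P m \<times>\<times> integer_group" by (rule is_isoI)
  then show ?thesis by (rule group.iso_sym[rotated]) (rule product_group, rule group_integer_group)
qed

lemma half_sgn_homotopic_id:
  "homotopic_with (\<lambda>_. True) (top_of_set punctured) (top_of_set punctured) (\<lambda>s. sgn s / 2) id"
proof (rule homotopic_with_linear)
  show "continuous_on punctured (\<lambda>s. sgn s / 2)" by (intro continuous_intros) auto
  show "continuous_on punctured id" by (simp add: id_def)
  fix s assume s: "s \<in> punctured"
  show "closed_segment (sgn s / 2) (id s) \<subseteq> punctured"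
  proof (cases "s > 0")
    case True
    have "convex {0<..<1::real}" by simp
    moreover have "sgn s / 2 \<in> {0<..<1}" "id s \<in> {0<..<1}" using s True by simp_all
    ultimately have "closed_segment (sgn s / 2) (id s) \<subseteq> {0<..<1}" by (intro closed_segment_subset)
    then show ?thesis by auto
  next
    case False
    have "convex {-1<..<0::real}" by simp
    moreover have "sgn s / 2 \<in> {-1<..<0}" "id s \<in> {-1<..<0}" using s False by simp_all
    ultimately have "closed_segment (sgn s / 2) (id s) \<subseteq> {-1<..<0}" by (intro closed_segment_subset)
    then show ?thesis by auto
  qed
qed

text \<open>
  The punctured interval is homotopy equivalent to a pair of points.
\<close>

lemma reduced_homology_punctured_interval:
  "reduced_homology_group p (top_of_set punctured) \<cong> homology_group p (top_of_set {1/2::real})"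
proof -
  let ?D = "top_of_set {-1/2, 1/2::real}"
  have "top_of_set punctured homotopy_equivalent_space ?D"
    unfolding homotopy_equivalent_space_def
  proof (intro exI conjI)
    show "continuous_map (top_of_set punctured) ?D (\<lambda>s. sgn s / 2)"
    proof -
      have "continuous_on punctured (\<lambda>s. sgn s / 2)" by (intro continuous_intros) auto
      moreover have "(\<lambda>s. sgn s / 2) \<in> punctured \<rightarrow> {-1/2, 1/2}" by (auto simp: sgn_if)
      ultimately show ?thesis by (simp add: continuous_map_in_subtopology)
    qed
    show "continuous_map ?D (top_of_set punctured) id"
      by (auto simp: continuous_map_in_subtopology continuous_on_id id_def)
    show "homotopic_with (\<lambda>_. True) (top_of_set punctured) (top_of_set punctured) (id \<circ> (\<lambda>s. sgn s / 2)) id"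
      using half_sgn_homotopic_id by simp
    show "homotopic_with (\<lambda>_. True) ?D ?D ((\<lambda>s. sgn s / 2) \<circ> id) id"
      by (rule homotopic_with_equal) (auto simp: continuous_map_in_subtopology intro!: continuous_on_finite)
  qed
  then have "reduced_homology_group p (top_of_set punctured) \<cong> reduced_homology_group p ?D"
    by (rule homotopy_equivalent_space_imp_isomorphic_reduced_homology_groups)
  also have "reduced_homology_group p ?D \<cong> homology_group p (top_of_set {1/2::real})"
  proof -
    have "reduced_homology_group p (subtopology euclidean {1/2, -1/2::real})
        \<cong> homology_group p (subtopology euclidean {1/2::real})"
      by (rule reduced_homology_group_pair) (auto intro: metrizable_imp_t1_space metrizable_space_euclidean)
    then show ?thesis by (simp add: insert_commute)
  qed
  finally show ?thesis .
qed

lemma interval_boundary_iso: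
  "hom_boundary p interval punctured
     \<in> iso (relative_homology_group p interval punctured) (reduced_homology_group (p - 1) (top_of_set punctured))"
proof -
  have "contractible_space interval"
    by (simp add: contractible_space_top_of_set convex_imp_contractible)
  moreover have "topspace interval \<inter> punctured \<noteq> {}"
  proof -
    have "(1/2::real) \<in> topspace interval \<inter> punctured" by simp
    then show ?thesis by blast
  qed
  moreover have "subtopology interval punctured = top_of_set punctured"
    by (simp add: subtopology_subtopology Int_absorb1)
  ultimately show ?thesis using iso_relative_homology_of_contractible by metis
qed

lemma relative_homology_interval:
  shows "relative_homology_group 1 interval punctured \<cong> integer_group"
    and "p \<noteq> 1 \<Longrightarrow> trivial_group (relative_homology_group p interval punctured)"
proof -
  have iso: "relative_homology_group p interval punctured \<cong> homology_group (p - 1) (top_of_set {1/2::real})" for p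
    using is_isoI[OF interval_boundary_iso] reduced_homology_punctured_interval by (rule iso_trans)
  show "relative_homology_group 1 interval punctured \<cong> integer_group"
    using iso[of 1] homology_coefficients[of "top_of_set {1/2::real}" "1/2"] by (auto intro: iso_trans)
  show "trivial_group (relative_homology_group p interval punctured)" if "p \<noteq> 1"
    using isomorphic_group_triviality[OF iso[of p]] homology_dimension_axiom[of "top_of_set {1/2::real}" "1/2" "p - 1"] that
    by simp
qed

lemma subtopology_interval [simp]: "subtopology interval punctured = top_of_set punctured"
  by (simp add: subtopology_subtopology Int_absorb1)

text \<open>
  The local homology at a point inside an open arc of \<open>Y\<close>: everything outside the arc is excised.
\<close>

lemma puncture_excision_iso:
  fixes h :: "real \<Rightarrow> 'a::t1_space"
  assumes h: "homeomorphism {-1<..<1} e h h'" and e: "openin (top_of_set Y) e"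
  shows "hom_induced p interval punctured (top_of_set Y) (Y - {h 0}) h
    \<in> iso (relative_homology_group p interval punctured) (relative_homology_group p (top_of_set Y) (Y - {h 0}))"
proof -
  have eY: "e \<subseteq> Y" using openin_imp_subset[OF e] by simp
  have hom: "homeomorphic_map interval (top_of_set e) h"
  proof -
    have "homeomorphic_maps interval (top_of_set e) h h'"
      using h unfolding homeomorphism_def homeomorphic_maps_def by (auto simp: continuous_map_in_subtopology)
    then show ?thesis unfolding homeomorphic_map_maps by blast
  qed
  have inj: "inj_on h {-1<..<1}" using h by (metis homeomorphism_apply1 inj_on_inverseI)
  have img: "h ` punctured = e - {h 0}"
    using h inj_on_image_set_diff[OF inj, of "{-1<..<1}" "{0}"] by (simp add: homeomorphism_def)
  have 1: "hom_induced p interval punctured (top_of_set e) (e - {h 0}) h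
    \<in> iso (relative_homology_group p interval punctured) (relative_homology_group p (top_of_set e) (e - {h 0}))"
    by (rule homeomorphic_map_relative_homology_iso[OF hom]) (auto simp: img)
  have "h 0 \<in> e" using h by (auto simp: homeomorphism_def)
  have "closedin (top_of_set Y) (Y - e)" using e by (metis closedin_diff closedin_topspace topspace_euclidean_subtopology)
  then have "top_of_set Y closure_of (Y - e) = Y - e" by (rule closure_of_closedin)
  moreover have "openin (top_of_set Y) (Y - {h 0})"
    unfolding Diff_eq by (intro openin_open_Int) (simp add: open_Compl)
  then have "top_of_set Y interior_of (Y - {h 0}) = Y - {h 0}" by (rule interior_of_openin)
  ultimately have "top_of_set Y closure_of (Y - e) \<subseteq> top_of_set Y interior_of (Y - {h 0})"
    using \<open>h 0 \<in> e\<close> by auto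
  from homology_excision_axiom[OF this, of Y p]
  have 2: "hom_induced p (top_of_set e) (e - {h 0}) (top_of_set Y) (Y - {h 0}) id
    \<in> iso (relative_homology_group p (top_of_set e) (e - {h 0})) (relative_homology_group p (top_of_set Y) (Y - {h 0}))"
  proof -
    have "Y - (Y - e) = e" "Y - {h 0} - (Y - e) = e - {h 0}" using eY by auto
    moreover have "subtopology (top_of_set Y) e = top_of_set e" "subtopology (top_of_set Y) Y = top_of_set Y"
      using eY by (simp_all add: subtopology_subtopology Int_absorb1)
    ultimately show ?thesis
      using homology_excision_axiom[OF \<open>top_of_set Y closure_of (Y - e) \<subseteq> top_of_set Y interior_of (Y - {h 0})\<close>, of Y p]
      by simp
  qed
  have "hom_induced p interval punctured (top_of_set Y) (Y - {h 0}) (id \<circ> h) =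
    hom_induced p (top_of_set e) (e - {h 0}) (top_of_set Y) (Y - {h 0}) id \<circ>
    hom_induced p interval punctured (top_of_set e) (e - {h 0}) h"
    by (rule hom_induced_compose)
      (use homeomorphic_imp_continuous_map[OF hom] img eY in \<open>auto simp: continuous_map_in_subtopology\<close>)
  then show ?thesis using iso_set_trans[OF 1 2] by simp
qed

lemma boundary_at_puncture:
  fixes h :: "real \<Rightarrow> 'a::t1_space"
  assumes h: "homeomorphism {-1<..<1} e h h'" and e: "openin (top_of_set Y) e"
  shows "hom_boundary 1 (top_of_set Y) (Y - {h 0}) (hom_induced 1 interval punctured (top_of_set Y) (Y - {h 0}) h z)
    = hom_induced 0 (top_of_set punctured) {} (top_of_set (Y - {h 0})) {} h (hom_boundary 1 interval punctured z)"
proof -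
  have eY: "e \<subseteq> Y" using openin_imp_subset[OF e] by simp
  have inj: "inj_on h {-1<..<1}" using h by (metis homeomorphism_apply1 inj_on_inverseI)
  have img: "h ` punctured \<subseteq> Y - {h 0}" "h ` {-1<..<1} \<subseteq> Y"
    using h inj_on_image_set_diff[OF inj, of "{-1<..<1}" "{0}"] eY by (auto simp: homeomorphism_def)
  have "continuous_map interval (top_of_set Y) h"
    using h img by (auto simp: homeomorphism_def continuous_map_in_subtopology)
  then have "hom_boundary 1 (top_of_set Y) (Y - {h 0}) \<circ> hom_induced 1 interval punctured (top_of_set Y) (Y - {h 0}) h
       = hom_induced (1 - 1) (subtopology interval punctured) {} (subtopology (top_of_set Y) (Y - {h 0})) {} h \<circ> hom_boundary 1 interval punctured"
    by (rule naturality_hom_induced) (use img in auto)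
  then show ?thesis
    by (simp add: fun_eq_iff subtopology_subtopology Int_absorb1)
qed

text \<open>
  A locally constant map sending the two sides of the puncture to different halves of the punctured interval
  recovers the boundary of a class of the interval, which is determined by its boundary.
\<close>

lemma boundary_injective_if_separated:
  fixes h :: "real \<Rightarrow> 'a::t1_space"
  assumes h: "homeomorphism {-1<..<1} e h h'" and e: "openin (top_of_set Y) e"
    and A: "openin (top_of_set (Y - {h 0})) A" and B: "openin (top_of_set (Y - {h 0})) (Y - {h 0} - A)"
    and sides: "h ` {-1<..<0} \<subseteq> A" "h ` {0<..<1} \<inter> A = {}"
  shows "inj_on (hom_boundary 1 (top_of_set Y) (Y - {h 0})) (carrier (relative_homology_group 1 (top_of_set Y) (Y - {h 0})))"
proof -
  let ?W = "Y - {h 0}"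
  let ?R = "relative_homology_group 1 (top_of_set Y) ?W"
  have eY: "e \<subseteq> Y" using openin_imp_subset[OF e] by simp
  have inj: "inj_on h {-1<..<1}" using h by (metis homeomorphism_apply1 inj_on_inverseI)
  have img: "h ` punctured \<subseteq> ?W"
    using h inj_on_image_set_diff[OF inj, of "{-1<..<1}" "{0}"] eY by (auto simp: homeomorphism_def)
  have AW: "A \<subseteq> ?W" using openin_imp_subset[OF A] .
  define k where "k = (\<lambda>y. if y \<in> A then -1/2 else 1/2 :: real)"
  have "continuous_on (A \<union> (?W - A)) k"
    unfolding k_def
    by (rule continuous_on_cases_local_open) (use A B AW in \<open>auto simp: Un_absorb1\<close>)
  then have k: "continuous_map (top_of_set ?W) (top_of_set punctured) k"
    using AW by (auto simp: continuous_map_in_subtopology k_def Un_absorb1)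
  have hc: "continuous_map (top_of_set punctured) (top_of_set ?W) h"
    using h img by (auto simp: homeomorphism_def continuous_map_in_subtopology intro: continuous_on_subset)
  have kh: "(k \<circ> h) s = sgn s / 2" if "s \<in> topspace (top_of_set punctured)" for s
  proof (cases "s > 0")
    case True
    then have "h s \<notin> A" using that sides(2) by (simp add: disjoint_iff)
    then show ?thesis using True by (simp add: k_def)
  next
    case False
    then have "h s \<in> A" "s < 0" using that sides(1) by auto
    then show ?thesis by (simp add: k_def)
  qed
  have id: "hom_induced 0 (top_of_set ?W) {} (top_of_set punctured) {} k
      (hom_induced 0 (top_of_set punctured) {} (top_of_set ?W) {} h c) = c"
    if c: "c \<in> carrier (homology_group 0 (top_of_set punctured))" for c
  proof -
    have "hom_induced 0 (top_of_set ?W) {} (top_of_set punctured) {} k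
      (hom_induced 0 (top_of_set punctured) {} (top_of_set ?W) {} h c)
      = hom_induced 0 (top_of_set punctured) {} (top_of_set punctured) {} (k \<circ> h) c"
      by (rule hom_induced_compose') (use hc k in auto)
    also have "\<dots> = hom_induced 0 (top_of_set punctured) {} (top_of_set punctured) {} (\<lambda>s. sgn s / 2) c"
      by (subst hom_induced_eq[OF kh]) auto
    also have "\<dots> = hom_induced 0 (top_of_set punctured) {} (top_of_set punctured) {} id c"
      using homology_homotopy_empty[OF half_sgn_homotopic_id] by metis
    also have "\<dots> = c" using c by (rule hom_induced_id)
    finally show ?thesis .
  qed
  have inj_boundary: "inj_on (hom_boundary 1 interval punctured) (carrier (relative_homology_group 1 interval punctured))"
    using interval_boundary_iso[of 1] by (simp add: iso_def bij_betw_def)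
  have iso: "hom_induced 1 interval punctured (top_of_set Y) ?W h ` carrier (relative_homology_group 1 interval punctured) = carrier ?R"
    using puncture_excision_iso[OF h e, of 1] by (simp add: iso_def bij_betw_def)
  show ?thesis
  proof (rule inj_onI)
    fix x y assume x: "x \<in> carrier ?R" and y: "y \<in> carrier ?R"
      and eq: "hom_boundary 1 (top_of_set Y) ?W x = hom_boundary 1 (top_of_set Y) ?W y"
    obtain u v where u: "u \<in> carrier (relative_homology_group 1 interval punctured)" "x = hom_induced 1 interval punctured (top_of_set Y) ?W h u"
      and v: "v \<in> carrier (relative_homology_group 1 interval punctured)" "y = hom_induced 1 interval punctured (top_of_set Y) ?W h v"
      using x y unfolding iso[symmetric] by blast
    have car: "hom_boundary 1 interval punctured w \<in> carrier (homology_group 0 (top_of_set punctured))" for w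
      using hom_boundary_carrier[of 1 interval punctured w] by simp
    have "hom_boundary 1 interval punctured u = hom_boundary 1 interval punctured v"
      using eq unfolding u(2) v(2) boundary_at_puncture[OF h e] using id[OF car] by metis
    then show "x = y" using inj_onD[OF inj_boundary] u v by metis
  qed
qed

text \<open>
  If the two sides of the puncture are joined by a path, the inclusion of the punctured interval is homotopic to a
  constant map.  It therefore kills reduced homology, to which boundaries belong.
\<close>

lemma boundary_trivial_if_joined:
  fixes h :: "real \<Rightarrow> 'a::t1_space"
  assumes h: "homeomorphism {-1<..<1} e h h'" and e: "openin (top_of_set Y) e"
    and path: "path_component (Y - {h 0}) (h (-1/2)) (h (1/2))"
    and x: "x \<in> carrier (relative_homology_group 1 (top_of_set Y) (Y - {h 0}))"
  shows "hom_boundary 1 (top_of_set Y) (Y - {h 0}) x = \<one>\<^bsub>homology_group 0 (top_of_set (Y - {h 0}))\<^esub>"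
proof -
  let ?W = "Y - {h 0}"
  let ?R = "relative_homology_group 1 (top_of_set Y) ?W"
  let ?K = "top_of_set punctured"
  have eY: "e \<subseteq> Y" using openin_imp_subset[OF e] by simp
  have inj: "inj_on h {-1<..<1}" using h by (metis homeomorphism_apply1 inj_on_inverseI)
  have img: "h ` punctured \<subseteq> ?W"
    using h inj_on_image_set_diff[OF inj, of "{-1<..<1}" "{0}"] eY by (auto simp: homeomorphism_def)
  have hc: "continuous_map ?K (top_of_set ?W) h"
    using h img by (auto simp: homeomorphism_def continuous_map_in_subtopology intro: continuous_on_subset)
  obtain g where g: "path g" "path_image g \<subseteq> ?W" "pathstart g = h (-1/2)" "pathfinish g = h (1/2)"
    using path unfolding path_component_def by blast
  have "homotopic_with (\<lambda>_. True) ?K (top_of_set ?W) (h \<circ> id) (h \<circ> (\<lambda>s. sgn s / 2))"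
    by (rule homotopic_with_compose_continuous_map_left[OF homotopic_with_sym[THEN iffD1, OF half_sgn_homotopic_id] hc]) auto
  moreover have "homotopic_with (\<lambda>_. True) ?K (top_of_set ?W) (h \<circ> (\<lambda>s. sgn s / 2)) (\<lambda>_. h (1/2))"
  proof -
    define F where "F = (\<lambda>z::real \<times> real. if snd z \<in> {..0} then g (fst z) else h (1/2))"
    have dom: "{0..1} \<times> punctured = ({0..1} \<times> {-1<..<0}) \<union> ({0..1} \<times> {0<..<1})" by auto
    have "continuous_on (({0..1} \<times> {-1<..<0}) \<union> ({0..1} \<times> {0<..<1})) F"
      unfolding F_def
    proof (rule continuous_on_cases_local_open)
      show "openin (top_of_set (({0..1} \<times> {-1<..<0}) \<union> ({0..1} \<times> {0<..<1}))) ({0..1::real} \<times> {-1<..<0::real})"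
        unfolding openin_open by (rule exI[of _ "UNIV \<times> {..<0}"]) (auto intro: open_Times)
      show "openin (top_of_set (({0..1} \<times> {-1<..<0}) \<union> ({0..1} \<times> {0<..<1}))) ({0..1::real} \<times> {0<..<1::real})"
        unfolding openin_open by (rule exI[of _ "UNIV \<times> {0<..}"]) (auto intro: open_Times)
      show "continuous_on ({0..1} \<times> {-1<..<0::real}) (\<lambda>z. g (fst z))"
        by (rule continuous_on_compose2[OF g(1)[unfolded path_def]]) (auto intro: continuous_intros)
    qed (auto intro: continuous_intros)
    then have F: "continuous_on ({0..1} \<times> punctured) F" unfolding dom .
    have "F ` ({0..1} \<times> punctured) \<subseteq> ?W"
    proof -
      have "g t \<in> ?W" if "t \<in> {0..1}" for t using g(2) that unfolding path_image_def by blast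
      moreover have "h (1/2) \<in> h ` punctured" by (intro imageI) simp
      then have "h (1/2) \<in> ?W" using img by blast
      ultimately show ?thesis by (auto simp: F_def)
    qed
    with F have "homotopic_with (\<lambda>_. True) ?K (top_of_set ?W) (\<lambda>s. F (0, s)) (\<lambda>s. F (1, s))"
      unfolding homotopic_with_def
      by (intro exI[of _ F]) (auto simp: continuous_map_in_subtopology simp flip: subtopology_Times)
    moreover have "F (0, s) = (h \<circ> (\<lambda>s. sgn s / 2)) s" "F (1, s) = h (1/2)" if "s \<in> punctured" for s
      using g(3,4) that by (auto simp: F_def pathstart_def pathfinish_def sgn_if)
    ultimately show ?thesis by (elim homotopic_with_eq) auto
  qed
  ultimately have "homotopic_with (\<lambda>_. True) ?K (top_of_set ?W) h (\<lambda>_. h (1/2))"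
    using homotopic_with_trans by fastforce
  then have const: "hom_induced 0 ?K {} (top_of_set ?W) {} h = hom_induced 0 ?K {} (top_of_set ?W) {} (\<lambda>_. h (1/2))"
    by (rule homology_homotopy_empty)
  have "carrier ?R = hom_induced 1 interval punctured (top_of_set Y) ?W h ` carrier (relative_homology_group 1 interval punctured)"
    using puncture_excision_iso[OF h e, of 1] by (simp add: iso_def bij_betw_def)
  then obtain u where u: "u \<in> carrier (relative_homology_group 1 interval punctured)" "x = hom_induced 1 interval punctured (top_of_set Y) ?W h u"
    using x by blast
  let ?pt = "discrete_topology {()}"
  define c where "c = hom_boundary 1 interval punctured u"
  have "c \<in> carrier (reduced_homology_group 0 ?K)"
    using hom_boundary_reduced_hom[of 1 interval punctured] u(1) unfolding c_def by (auto simp: hom_def)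
  then have c: "hom_induced 0 ?K {} ?pt {} (\<lambda>_. ()) c = \<one>\<^bsub>homology_group 0 ?pt\<^esub>"
    unfolding carrier_reduced_homology_group kernel_def by simp
  have "hom_induced 0 ?K {} (top_of_set ?W) {} ((\<lambda>_. h (1/2)) \<circ> (\<lambda>_. ())) c
    = hom_induced 0 ?pt {} (top_of_set ?W) {} (\<lambda>_. h (1/2)) (hom_induced 0 ?K {} ?pt {} (\<lambda>_. ()) c)"
  proof (rule hom_induced_compose'[symmetric])
    have "h (1/2) \<in> h ` punctured" by (intro imageI) simp
    then have "h (1/2) \<in> ?W" using img by blast
    then show "continuous_map ?pt (top_of_set ?W) (\<lambda>_. h (1/2))" by simp
  qed auto
  also have "\<dots> = \<one>\<^bsub>homology_group 0 (top_of_set ?W)\<^esub>"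
    unfolding c by (rule hom_one[OF hom_induced_hom]) auto
  finally have "hom_induced 0 ?K {} (top_of_set ?W) {} h c = \<one>\<^bsub>homology_group 0 (top_of_set ?W)\<^esub>"
    unfolding const by (simp add: comp_def)
  then show ?thesis unfolding u(2) boundary_at_puncture[OF h e] c_def .
qed

text \<open>
  The long exact sequence of the pair \<open>(Y, Y - point)\<close>.  Its relative groups vanish except for a copy
  of the integers in degree 1, and the boundary map on that copy is zero or injective according to
  whether the sides of the puncture are joined.
\<close>

lemma homology_fill_puncture:
  fixes h :: "real \<Rightarrow> 'a::t1_space"
  assumes h: "homeomorphism {-1<..<1} e h h'" and e: "openin (top_of_set Y) e"
  defines "W \<equiv> Y - {h 0}"
  shows "p \<ge> 2 \<Longrightarrow> trivial_group (homology_group p (top_of_set W)) \<Longrightarrow> trivial_group (homology_group p (top_of_set Y))"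
    and "path_component W (h (-1/2)) (h (1/2)) \<Longrightarrow>
      homology_group 1 (top_of_set Y) \<cong> homology_group 1 (top_of_set W) \<times>\<times> integer_group"
    and "\<lbrakk>openin (top_of_set W) A; openin (top_of_set W) (W - A); h ` {-1<..<0} \<subseteq> A; h ` {0<..<1} \<inter> A = {}\<rbrakk> \<Longrightarrow>
      homology_group 1 (top_of_set Y) \<cong> homology_group 1 (top_of_set W)"
proof -
  let ?R = "\<lambda>p. relative_homology_group p (top_of_set Y) W"
  let ?i = "\<lambda>p. hom_induced p (top_of_set W) {} (top_of_set Y) {} id"
  let ?j = "\<lambda>p. hom_induced p (top_of_set Y) {} (top_of_set Y) W id"
  let ?d = "hom_boundary 1 (top_of_set Y) W"
  have sub: "subtopology (top_of_set Y) W = top_of_set W"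
    by (simp add: subtopology_subtopology Int_absorb1 W_def)
  have iso: "relative_homology_group p interval punctured \<cong> ?R p" for p
    unfolding W_def by (rule is_isoI[OF puncture_excision_iso[OF h e]])
  have R_triv: "trivial_group (?R p)" if "p \<noteq> 1" for p
    using relative_homology_interval(2)[OF that] isomorphic_group_triviality[OF iso] by simp
  have R1: "?R 1 \<cong> integer_group"
    using group.iso_sym[OF group_relative_homology_group iso[of 1]] relative_homology_interval(1) by (rule iso_trans)
  have ex1: "?j p ` carrier (homology_group p (top_of_set Y)) = kernel (?R p) (homology_group (p - 1) (top_of_set W)) (hom_boundary p (top_of_set Y) W)" for p
    using homology_exactness_axiom_1[of p "top_of_set Y" W] by (simp add: sub)
  have ex2: "hom_boundary p (top_of_set Y) W ` carrier (?R p) = kernel (homology_group (p - 1) (top_of_set W)) (homology_group (p - 1) (top_of_set Y)) (?i (p - 1))" for p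
    using homology_exactness_axiom_2[of p "top_of_set Y" W] by (simp add: sub)
  have ex3: "?i p ` carrier (homology_group p (top_of_set W)) = kernel (homology_group p (top_of_set Y)) (?R p) (?j p)" for p
    using homology_exactness_axiom_3[of p "top_of_set Y" W] by (simp add: sub)
  have gi: "group_hom (homology_group p (top_of_set W)) (homology_group p (top_of_set Y)) (?i p)" for p
    by (simp add: group_hom_def group_hom_axioms_def hom_induced_empty_hom)
  have gj: "group_hom (homology_group p (top_of_set Y)) (?R p) (?j p)" for p
    by (simp add: group_hom_def group_hom_axioms_def hom_induced_hom)
  have gd: "group_hom (?R p) (homology_group (p - 1) (top_of_set W)) (hom_boundary p (top_of_set Y) W)" for p
    using hom_boundary_hom[of p "top_of_set Y" W] by (simp add: group_hom_def group_hom_axioms_def sub)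
  show "trivial_group (homology_group p (top_of_set Y))" if "p \<ge> 2" "trivial_group (homology_group p (top_of_set W))" for p
  proof -
    have "kernel (homology_group p (top_of_set Y)) (?R p) (?j p) = carrier (homology_group p (top_of_set Y))"
      by (rule group_hom.kernel_to_trivial_group[OF gj R_triv]) (use that in auto)
    then show ?thesis using ex3[of p] group_hom.image_from_trivial_group[OF gi that(2)]
      by (simp add: trivial_group_def)
  qed
  have inj: "inj_on (?i 1) (carrier (homology_group 1 (top_of_set W)))"
  proof -
    have "hom_boundary 2 (top_of_set Y) W ` carrier (?R 2) = {\<one>\<^bsub>homology_group 1 (top_of_set W)\<^esub>}"
      using group_hom.image_from_trivial_group[OF gd[of 2] R_triv[of 2]] by simp
    then show ?thesis using ex2[of 2] group_hom.inj_iff_trivial_ker[OF gi[of 1]] by simp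
  qed
  show "homology_group 1 (top_of_set Y) \<cong> homology_group 1 (top_of_set W) \<times>\<times> integer_group"
    if path: "path_component W (h (-1/2)) (h (1/2))"
  proof (rule extension_by_integers_splits[OF _ _ R1 _ _ inj])
    show "?j 1 ` carrier (homology_group 1 (top_of_set Y)) = carrier (?R 1)"
      unfolding ex1 using boundary_trivial_if_joined[OF h e path[unfolded W_def]]
      by (auto simp: kernel_def W_def)
    show "?i 1 ` carrier (homology_group 1 (top_of_set W)) = kernel (homology_group 1 (top_of_set Y)) (?R 1) (?j 1)"
      by (rule ex3)
  qed (auto simp: hom_induced_empty_hom hom_induced_hom abelian_homology_group)
  show "homology_group 1 (top_of_set Y) \<cong> homology_group 1 (top_of_set W)"
    if "openin (top_of_set W) A" "openin (top_of_set W) (W - A)" "h ` {-1<..<0} \<subseteq> A" "h ` {0<..<1} \<inter> A = {}"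
  proof -
    have "inj_on ?d (carrier (?R 1))"
      using boundary_injective_if_separated[OF h e] that unfolding W_def by blast
    then have "kernel (?R 1) (homology_group 0 (top_of_set W)) ?d = {\<one>\<^bsub>?R 1\<^esub>}"
      using group_hom.inj_iff_trivial_ker[OF gd[of 1]] by simp
    then have "kernel (homology_group 1 (top_of_set Y)) (?R 1) (?j 1) = carrier (homology_group 1 (top_of_set Y))"
      using ex1[of 1] by (auto simp: kernel_def)
    then have "?i 1 ` carrier (homology_group 1 (top_of_set W)) = carrier (homology_group 1 (top_of_set Y))"
      using ex3[of 1] by simp
    then have "?i 1 \<in> iso (homology_group 1 (top_of_set W)) (homology_group 1 (top_of_set Y))"
      using inj by (simp add: iso_def bij_betw_def hom_induced_empty_hom)
    then have "homology_group 1 (top_of_set W) \<cong> homology_group 1 (top_of_set Y)" by (rule is_isoI)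
    then show ?thesis by (rule group.iso_sym[OF group_relative_homology_group])
  qed
qed

section \<open>Rank of the homology and number of components\<close>

lemma components_eq_open_partition:
  assumes "\<Union>P = Y" "\<And>C. C \<in> P \<Longrightarrow> connected C \<and> C \<noteq> {} \<and> openin (top_of_set Y) C"
    and disj: "\<And>C C'. C \<in> P \<Longrightarrow> C' \<in> P \<Longrightarrow> C \<noteq> C' \<Longrightarrow> C \<inter> C' = {}"
  shows "components Y = P"
proof -
  have PC: "C \<in> components Y" if C: "C \<in> P" for C
    unfolding in_components_maximal
  proof (intro conjI allI impI)
    show "C \<noteq> {}" "C \<subseteq> Y" "connected C" using assms C by auto
    fix D assume D: "D \<noteq> {} \<and> C \<subseteq> D \<and> D \<subseteq> Y \<and> connected D"
    have restrict: "openin (top_of_set D) (D \<inter> X)" if X: "openin (top_of_set Y) X" for X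
    proof -
      obtain T where "open T" "X = Y \<inter> T" using X unfolding openin_open by blast
      then have "D \<inter> X = D \<inter> T" using D by blast
      then show ?thesis using \<open>open T\<close> by (simp add: openin_open_Int)
    qed
    have "Y - C = \<Union>(P - {C})" using assms(1) disj[OF C] C by blast
    moreover have "openin (top_of_set Y) (\<Union>(P - {C}))" using assms(2) by (intro openin_Union) blast
    ultimately have "openin (top_of_set D) (D \<inter> (Y - C))" "openin (top_of_set D) (D \<inter> C)"
      using D assms(2)[OF C] restrict by simp_all
    moreover have "D \<inter> C \<union> D \<inter> (Y - C) = D" using D by blast
    moreover have "D \<inter> C \<noteq> {}" using D \<open>C \<noteq> {}\<close> by blast
    ultimately have "D \<inter> (Y - C) = {}"
      using D unfolding connected_openin_eq by blast
    then show "D = C" using D by blast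
  qed
  moreover have "C \<in> P" if C: "C \<in> components Y" for C
  proof -
    obtain x where "x \<in> C" "x \<in> Y" using C in_components_nonempty in_components_subset by blast
    then obtain D where "D \<in> P" "x \<in> D" using assms(1) by blast
    then have "C = D" using PC[of D] components_nonoverlap[OF C] \<open>x \<in> C\<close> by blast
    then show ?thesis using \<open>D \<in> P\<close> by simp
  qed
  ultimately show ?thesis by blast
qed

lemma openin_component_if_finite:
  assumes "finite (components Y)" "C \<in> components Y"
  shows "openin (top_of_set Y) C"
proof -
  have "closedin (top_of_set Y) (\<Union>(components Y - {C}))"
    using assms closedin_component by (intro closedin_Union) auto
  moreover have "Y - \<Union>(components Y - {C}) = C"
  proof -
    have "\<Union>(components Y) = Y" by (rule Union_components)
    moreover have "C \<inter> D = {}" if "D \<in> components Y - {C}" for D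
      using components_nonoverlap[OF assms(2)] that by auto
    ultimately show ?thesis using assms(2) by blast
  qed
  ultimately show ?thesis by (metis openin_diff openin_topspace topspace_euclidean_subtopology)
qed

text \<open>
  The two parameters are the rank of \<open>H\<^sub>1\<close> and the number of components.  Path connectedness of the
  components is carried along because the alternative in the next lemma is between joining the two
  sides of a puncture by a path and separating them by open sets.
\<close>

definition free_homology :: "'a::topological_space set \<Rightarrow> nat \<Rightarrow> nat \<Rightarrow> bool" where
  "free_homology Y m b \<longleftrightarrow>
     finite (components Y) \<and> card (components Y) = b \<and> (\<forall>C \<in> components Y. path_connected C) \<and>
     homology_group 1 (top_of_set Y) \<cong> product_group {..<m} (\<lambda>_. integer_group) \<and>
     (\<forall>p\<ge>2. trivial_group (homology_group p (top_of_set Y)))"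

text \<open>
  In both cases the rank minus the number of components grows by one.
\<close>

lemma free_homology_fill_puncture:
  fixes h :: "real \<Rightarrow> 'a::t1_space"
  assumes h: "homeomorphism {-1<..<1} e h h'" and e: "openin (top_of_set Y) e"
    and fh: "free_homology (Y - {h 0}) m b"
  shows "free_homology Y (Suc m) b \<or> (\<exists>b'. b = Suc b' \<and> free_homology Y m b')"
proof -
  define W where "W = Y - {h 0}"
  have eY: "e \<subseteq> Y" using openin_imp_subset[OF e] by simp
  have inj: "inj_on h {-1<..<1}" using h by (metis homeomorphism_apply1 inj_on_inverseI)
  have cont: "continuous_on {-1<..<1} h" using h by (simp add: homeomorphism_def)
  have e_img: "h ` {-1<..<1} = e" using h by (simp add: homeomorphism_def)
  have h0: "h 0 \<in> Y" using e_img eY by auto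
  have hW: "h s \<in> W" if "s \<in> {-1<..<1}" "s \<noteq> 0" for s
    using inj_onD[OF inj, of s 0] that e_img eY unfolding W_def by auto
  have WY: "openin (top_of_set Y) W"
    unfolding W_def Diff_eq by (intro openin_open_Int) (simp add: open_Compl)
  define L where "L = h ` {-1<..<0}"
  define R where "R = h ` {0<..<1}"
  have L: "connected L" "L \<subseteq> W" "L \<noteq> {}" and R: "connected R" "R \<subseteq> W" "R \<noteq> {}"
    unfolding L_def R_def using hW
    by (auto intro!: connected_continuous_image continuous_on_subset[OF cont])
  have fin: "finite (components W)" and card: "card (components W) = b"
    and pc: "\<And>C. C \<in> components W \<Longrightarrow> path_connected C"
    and H1: "homology_group 1 (top_of_set W) \<cong> product_group {..<m} (\<lambda>_. integer_group)"
    and Hp: "\<And>p. p \<ge> 2 \<Longrightarrow> trivial_group (homology_group p (top_of_set W))"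
    using fh unfolding free_homology_def W_def by auto
  have "W \<noteq> {}" using L by blast
  then obtain A where A: "A \<in> components W" "L \<subseteq> A" using exists_component_superset[OF L(2) _ L(1)] by blast
  obtain B where B: "B \<in> components W" "R \<subseteq> B" using exists_component_superset[OF R(2) \<open>W \<noteq> {}\<close> R(1)] by blast
  have openW: "openin (top_of_set W) C" if "C \<in> components W" for C
    using openin_component_if_finite[OF fin that] .
  have openY: "openin (top_of_set Y) C" if "C \<in> components W" for C
    using openin_trans[OF openW[OF that] WY] .
  define D where "D = A \<union> e \<union> B"
  have "e = L \<union> {h 0} \<union> R"
  proof -
    have "{-1<..<1::real} = {-1<..<0} \<union> {0} \<union> {0<..<1}" by auto
    then show ?thesis using e_img unfolding L_def R_def by (metis image_Un image_empty image_insert)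
  qed
  then have D: "D = insert (h 0) (A \<union> B)" unfolding D_def using A(2) B(2) by blast
  have AW: "A \<subseteq> W" "B \<subseteq> W"
    using in_components_subset[OF A(1)] in_components_subset[OF B(1)] by auto
  have pcD: "path_connected D"
  proof -
    have "path_connected e"
      using path_connected_continuous_image[OF cont] e_img by (simp add: convex_imp_path_connected)
    then have "path_connected (A \<union> e)" using pc[OF A(1)] A(2) L(3) \<open>e = _\<close> by (intro path_connected_Un) auto
    moreover have "(A \<union> e) \<inter> B \<noteq> {}" using B(2) R(3) \<open>e = _\<close> by blast
    ultimately show ?thesis unfolding D_def using path_connected_Un[OF _ pc[OF B(1)]] by blast
  qed
  have comps: "components Y = insert D (components W - {A, B})"
  proof (rule components_eq_open_partition)
    have "components W = insert A (insert B (components W - {A, B}))" using A(1) B(1) by blast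
    then have "\<Union>(components W) = A \<union> (B \<union> \<Union>(components W - {A, B}))" by (metis Union_insert)
    moreover have "\<Union>(components W) = W" by (rule Union_components)
    moreover have "insert (h 0) W = Y" using h0 unfolding W_def by blast
    ultimately show "\<Union>(insert D (components W - {A, B})) = Y" unfolding D by auto
    show "connected C \<and> C \<noteq> {} \<and> openin (top_of_set Y) C" if "C \<in> insert D (components W - {A, B})" for C
    proof (cases "C = D")
      case True
      have "openin (top_of_set Y) D" unfolding D_def using openY[OF A(1)] openY[OF B(1)] e by (intro openin_Un)
      then show ?thesis using True pcD D by (auto intro: path_connected_imp_connected)
    next
      case False
      then have "C \<in> components W" using that by auto
      then show ?thesis using openY in_components_connected in_components_nonempty by blast
    qed
    show "C \<inter> C' = {}" if "C \<in> insert D (components W - {A, B})" "C' \<in> insert D (components W - {A, B})" "C \<noteq> C'" for C C'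
    proof -
      have *: "D \<inter> C = {}" if "C \<in> components W - {A, B}" for C
      proof -
        have "C \<subseteq> W" using that in_components_subset by auto
        moreover have "A \<inter> C = {}" "B \<inter> C = {}"
          using that components_nonoverlap[OF A(1)] components_nonoverlap[OF B(1)] by auto
        ultimately show ?thesis unfolding D W_def by blast
      qed
      show ?thesis using that * components_nonoverlap[of C W C'] by blast
    qed
  qed
  have D_new: "D \<notin> components W - {A, B}" using in_components_subset D unfolding W_def by blast
  have finY: "finite (components Y)" unfolding comps using fin by simp
  have pcY: "\<forall>C \<in> components Y. path_connected C" unfolding comps using pc pcD by auto
  have HpY: "\<forall>p\<ge>2. trivial_group (homology_group p (top_of_set Y))"
    using homology_fill_puncture(1)[OF h e] Hp unfolding W_def by blast
  have half: "h (-1/2) \<in> L" "h (1/2) \<in> R" unfolding L_def R_def by auto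
  show ?thesis
  proof (cases "A = B")
    case True
    have "path_component A (h (-1/2)) (h (1/2))"
      using pc[OF A(1)] half A(2) B(2) True unfolding path_connected_component by blast
    then have "path_component W (h (-1/2)) (h (1/2))" using AW path_component_of_subset by blast
    then have "homology_group 1 (top_of_set Y) \<cong> homology_group 1 (top_of_set W) \<times>\<times> integer_group"
      unfolding W_def by (rule homology_fill_puncture(2)[OF h e])
    also have "homology_group 1 (top_of_set W) \<times>\<times> integer_group
      \<cong> product_group {..<m} (\<lambda>_. integer_group) \<times>\<times> integer_group"
      by (rule group.DirProd_iso_trans[OF _ H1 iso_refl]) simp
    also have "\<dots> \<cong> product_group {..<Suc m} (\<lambda>_. integer_group)" by (rule free_abelian_rank_Suc)
    finally have "homology_group 1 (top_of_set Y) \<cong> product_group {..<Suc m} (\<lambda>_. integer_group)" .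
    moreover have "card (components Y) = b"
    proof -
      have "card (components Y) = Suc (card (components W - {A, B}))"
        unfolding comps using D_new fin by simp
      then show ?thesis using True A(1) fin card card_Suc_Diff1[OF fin A(1)] by simp
    qed
    ultimately show ?thesis unfolding free_homology_def using finY pcY HpY by simp
  next
    case False
    have AB: "A \<inter> B = {}" using components_nonoverlap[OF A(1) B(1)] False by simp
    have "openin (top_of_set W) (W - A)"
      using closedin_component[OF A(1)] by (metis openin_diff openin_topspace topspace_euclidean_subtopology)
    then have "homology_group 1 (top_of_set Y) \<cong> homology_group 1 (top_of_set W)"
      using homology_fill_puncture(3)[OF h e, of A] openW[OF A(1)] A(2) B(2) AB unfolding L_def R_def W_def by blast
    then have "homology_group 1 (top_of_set Y) \<cong> product_group {..<m} (\<lambda>_. integer_group)"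
      using H1 by (rule iso_trans)
    moreover have "Suc (card (components Y)) = b"
    proof -
      have "card (components Y) = Suc (card (components W - {A, B}))"
        unfolding comps using D_new fin by simp
      moreover have "card (components W - {A, B}) = b - 2"
        using A(1) B(1) False fin card by (simp add: card_Diff_subset)
      moreover have "card {A, B} \<le> b" unfolding card[symmetric] by (rule card_mono[OF fin]) (use A B in auto)
      ultimately show ?thesis using False by simp
    qed
    ultimately show ?thesis unfolding free_homology_def using finY pcY HpY by blast
  qed
qed

lemma trivial_groups_isomorphic:
  assumes "trivial_group G" "trivial_group H"
  shows "G \<cong> H"
proof -
  have G: "carrier G = {\<one>\<^bsub>G\<^esub>}" "group G" and H: "carrier H = {\<one>\<^bsub>H\<^esub>}" "group H"
    using assms by (simp_all add: trivial_group_def)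
  have "\<one>\<^bsub>H\<^esub> \<otimes>\<^bsub>H\<^esub> \<one>\<^bsub>H\<^esub> = \<one>\<^bsub>H\<^esub>"
    using H(2) by (simp add: group.is_monoid monoid.l_one monoid.one_closed)
  then have "(\<lambda>_. \<one>\<^bsub>H\<^esub>) \<in> iso G H" unfolding iso_def hom_def bij_betw_def G(1) H(1) by simp
  then show ?thesis by (rule is_isoI)
qed

lemma trivial_homology_finite_set:
  fixes V :: "'a::t1_space set"
  assumes "finite V" "p \<noteq> 0"
  shows "trivial_group (homology_group p (top_of_set V))"
proof -
  let ?U = "(\<lambda>v. {v}) ` V"
  have sub: "subtopology (top_of_set V) {v} = top_of_set {v}" if "v \<in> V" for v
    using that by (simp add: subtopology_subtopology Int_absorb1)
  have open1: "openin (top_of_set V) {v}" if "v \<in> V" for v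
  proof -
    have "{v} = V \<inter> - (V - {v})" using that by auto
    moreover have "open (- (V - {v}))" using \<open>finite V\<close> by (intro open_Compl finite_imp_closed) auto
    ultimately show ?thesis by (metis openin_open_Int)
  qed
  have "(\<lambda>x. gfinprod (homology_group p (top_of_set V))
      (\<lambda>v. hom_induced p (subtopology (top_of_set V) v) {} (top_of_set V) {} id (x v)) ?U)
     \<in> iso (sum_group ?U (\<lambda>S. homology_group p (subtopology (top_of_set V) S))) (homology_group p (top_of_set V))"
    by (rule homology_additivity_axiom) (use open1 in \<open>auto simp: pairwise_def\<close>)
  then have iso: "sum_group ?U (\<lambda>S. homology_group p (subtopology (top_of_set V) S)) \<cong> homology_group p (top_of_set V)"
    by (rule is_isoI)
  have triv: "trivial_group (homology_group p (subtopology (top_of_set V) S))" if "S \<in> ?U" for S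
  proof -
    from that obtain v where v: "v \<in> V" "S = {v}" by blast
    show ?thesis unfolding v(2) sub[OF v(1)] by (rule homology_dimension_axiom) (use \<open>p \<noteq> 0\<close> in auto)
  qed
  have "carrier (product_group ?U (\<lambda>S. homology_group p (subtopology (top_of_set V) S)))
      = {\<one>\<^bsub>product_group ?U (\<lambda>S. homology_group p (subtopology (top_of_set V) S))\<^esub>}"
    using trivial_product_group[of ?U "\<lambda>S. homology_group p (subtopology (top_of_set V) S)"] triv
    unfolding trivial_group_def by blast
  then have "carrier (sum_group ?U (\<lambda>S. homology_group p (subtopology (top_of_set V) S)))
      \<subseteq> {\<one>\<^bsub>product_group ?U (\<lambda>S. homology_group p (subtopology (top_of_set V) S))\<^esub>}"
    by (auto simp: carrier_sum_group)
  then have "trivial_group (sum_group ?U (\<lambda>S. homology_group p (subtopology (top_of_set V) S)))"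
    by (subst group.trivial_group_alt) auto
  then show ?thesis using isomorphic_group_triviality[OF iso] by simp
qed

text \<open>
  The components are the fibres of the retraction, each contracted by \<open>F\<close> along paths.
\<close>

lemma free_homology_deformation_to_finite_set:
  fixes Y :: "'a::metric_space set"
  assumes "finite V" "V \<subseteq> Y" and F: "continuous_on ({0..1} \<times> Y) F" "F ` ({0..1} \<times> Y) \<subseteq> Y"
    and F0: "\<And>y. y \<in> Y \<Longrightarrow> F (0::real, y) = y" and F1: "\<And>y. y \<in> Y \<Longrightarrow> F (1, y) \<in> V"
    and FV: "\<And>v. v \<in> V \<Longrightarrow> F (1, v) = v"
  shows "free_homology Y 0 (card V)"
proof -
  define r where "r = (\<lambda>y. F (1, y))"
  have contr: "continuous_on Y r"
    unfolding r_def by (rule continuous_on_compose2[OF F(1)]) (auto intro!: continuous_intros)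
  have rV: "r \<in> Y \<rightarrow> V" using F1 by (auto simp: r_def)
  have "homotopic_with (\<lambda>_. True) (top_of_set Y) (top_of_set Y) (\<lambda>y. F (0, y)) (\<lambda>y. F (1, y))"
    unfolding homotopic_with_def using F
    by (intro exI[of _ F]) (auto simp: continuous_map_in_subtopology simp flip: subtopology_Times)
  then have "homotopic_with (\<lambda>_. True) (top_of_set Y) (top_of_set Y) id r"
    by (rule homotopic_with_eq) (auto simp: r_def F0)
  then have hom: "homotopic_with (\<lambda>_. True) (top_of_set Y) (top_of_set Y) r id"
    by (rule homotopic_with_symD)
  have "retraction_maps (top_of_set Y) (top_of_set V) r id"
    unfolding retraction_maps_def using contr rV FV \<open>V \<subseteq> Y\<close>
    by (auto simp: continuous_map_in_subtopology r_def id_def)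
  then have iso: "homology_group p (top_of_set Y) \<cong> homology_group p (top_of_set V)" for p
    using hom by (rule deformation_retract_imp_isomorphic_homology_groups)
  then have triv: "trivial_group (homology_group p (top_of_set Y))" if "p \<noteq> 0" for p
    using trivial_homology_finite_set[OF \<open>finite V\<close> that] isomorphic_group_triviality[OF iso] by simp
  let ?S = "\<lambda>v. {y \<in> Y. r y = v}"
  have openS: "openin (top_of_set Y) (?S v)" if "v \<in> V" for v
  proof -
    have "?S v = Y \<inter> r -` (- (V - {v}))" using rV that by auto
    moreover have "open (- (V - {v}))" using \<open>finite V\<close> by (intro open_Compl finite_imp_closed) auto
    ultimately show ?thesis using continuous_openin_preimage_gen[OF contr] by metis
  qed
  have pcS: "path_connected (?S v)" if v: "v \<in> V" for v
  proof -
    have joined: "path_component (?S v) y v" if y: "y \<in> ?S v" for y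
    proof -
      define g where "g = (\<lambda>t. F (t, y))"
      have g: "path g" unfolding path_def g_def using y
        by (intro continuous_on_compose2[OF F(1)]) (auto intro!: continuous_intros)
      have gY: "g t \<in> Y" if "t \<in> {0..1}" for t
        using F(2) y that unfolding g_def by (auto simp: image_subset_iff)
      have "continuous_on {0..1} (r \<circ> g)"
        using g gY contr unfolding path_def by (intro continuous_on_compose) (auto intro: continuous_on_subset)
      then have "connected ((r \<circ> g) ` {0..1})" by (rule connected_continuous_image) simp
      moreover have sub: "(r \<circ> g) ` {0..1} \<subseteq> V" using gY rV by auto
      then have "finite ((r \<circ> g) ` {0..1})" using \<open>finite V\<close> finite_subset by blast
      ultimately obtain w where "(r \<circ> g) ` {0..1} \<subseteq> {w}"
        using connected_finite_iff_sing[of "(r \<circ> g) ` {0..1}"] by auto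
      then have w: "\<And>t. t \<in> {0..1} \<Longrightarrow> r (g t) = w" by (simp add: image_subset_iff)
      have "w = v" using w[of 0] F0 y by (auto simp: g_def)
      then have "path_image g \<subseteq> ?S v" using w gY by (auto simp: path_image_def)
      moreover have "pathstart g = y" "pathfinish g = v"
        using F0 y by (auto simp: pathstart_def pathfinish_def g_def r_def)
      ultimately show ?thesis using g unfolding path_component_def by blast
    qed
    then show ?thesis unfolding path_connected_component
      by (meson path_component_sym path_component_trans)
  qed
  have comps: "components Y = ?S ` V"
  proof (rule components_eq_open_partition)
    show "\<Union>(?S ` V) = Y" using rV by auto
    show "connected C \<and> C \<noteq> {} \<and> openin (top_of_set Y) C" if C: "C \<in> ?S ` V" for C
    proof -
      obtain v where v: "v \<in> V" "C = ?S v" using C by blast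
      have "v \<in> ?S v" using v \<open>V \<subseteq> Y\<close> FV by (auto simp: r_def)
      then show ?thesis using v openS pcS path_connected_imp_connected by blast
    qed
  qed auto
  have "inj_on ?S V"
  proof (rule inj_onI)
    fix v w assume "v \<in> V" "w \<in> V" "?S v = ?S w"
    moreover have "v \<in> ?S v" using \<open>v \<in> V\<close> \<open>V \<subseteq> Y\<close> FV by (auto simp: r_def)
    ultimately have "r v = w" by blast
    then show "v = w" using FV[OF \<open>v \<in> V\<close>] by (simp add: r_def)
  qed
  then have "card (components Y) = card V" unfolding comps by (rule card_image)
  moreover have "homology_group 1 (top_of_set Y) \<cong> product_group {..<0::nat} (\<lambda>_. integer_group)"
    by (rule trivial_groups_isomorphic[OF triv]) (simp_all add: trivial_product_group)
  moreover have "finite (components Y)" unfolding comps using \<open>finite V\<close> by simp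
  moreover have "\<forall>C\<in>components Y. path_connected C" unfolding comps using pcS by blast
  moreover have "trivial_group (homology_group p (top_of_set Y))" if "p \<ge> 2" for p
    using triv that by simp
  ultimately show ?thesis unfolding free_homology_def by blast
qed

section \<open>Homology of a finite graph\<close>

locale finite_graph =
  fixes V :: "'a::metric_space set" and I :: "'i set" and c :: "'i \<Rightarrow> real \<Rightarrow> 'a"
  assumes finite_V: "finite V" and finite_I: "finite I"
    and cont: "\<And>i. i \<in> I \<Longrightarrow> continuous_on {0..1} (c i)"
    and ends: "\<And>i. i \<in> I \<Longrightarrow> c i 0 \<in> V \<and> c i 1 \<in> V"
    and interior_off_V: "\<And>i t. i \<in> I \<Longrightarrow> t \<in> {0<..<1} \<Longrightarrow> c i t \<notin> V"
    and inj: "\<And>i j s t. i \<in> I \<Longrightarrow> j \<in> I \<Longrightarrow> s \<in> {0<..<1} \<Longrightarrow> t \<in> {0<..<1} \<Longrightarrow> c i s = c j t \<Longrightarrow> i = j \<and> s = t"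
begin

definition realization :: "'a set" where "realization = V \<union> (\<Union>i\<in>I. c i ` {0..1})"

lemma inj':
  assumes "i \<in> I" "j \<in> I" "s \<in> {0<..<1}" "t \<in> {0..1}" "c i s = c j t"
  shows "i = j \<and> s = t"
proof -
  have "c i s \<notin> V" using assms interior_off_V by blast
  then have "t \<noteq> 0" "t \<noteq> 1" using assms ends[of j] by auto
  then show ?thesis using assms by (intro inj) auto
qed

lemma compact_edge: "i \<in> I \<Longrightarrow> compact (c i ` {0..1})"
  by (intro compact_continuous_image cont) auto

text \<open>
  The Boolean tells at which end of the edge the parametrisation starts; \<open>True\<close> reverses the edge.
\<close>

definition half_edge :: "'i \<times> bool \<Rightarrow> real \<Rightarrow> 'a" where
  "half_edge p t = (if snd p then c (fst p) (1 - t) else c (fst p) t)"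

lemma half_edge_cont: "p \<in> I \<times> UNIV \<Longrightarrow> continuous_on {0..1} (half_edge p)"
  unfolding half_edge_def
  by (cases "snd p") (auto intro!: continuous_on_compose2[OF cont] continuous_intros)

lemma half_edge_0: "p \<in> I \<times> UNIV \<Longrightarrow> half_edge p 0 \<in> V"
  unfolding half_edge_def using ends by auto

lemma half_edge_off_V: "p \<in> I \<times> UNIV \<Longrightarrow> t \<in> {0<..<1} \<Longrightarrow> half_edge p t \<notin> V"
  unfolding half_edge_def using interior_off_V by auto

lemma half_edge_inj:
  assumes "p \<in> I \<times> UNIV" "q \<in> I \<times> UNIV" "s \<in> {0<..<1/2}" "t \<in> {0..1/2}" "half_edge p s = half_edge q t"
  shows "p = q \<and> s = t"
proof -
  define s' t' where "s' = (if snd p then 1 - s else s)" and "t' = (if snd q then 1 - t else t)"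
  have "c (fst p) s' = c (fst q) t'" using assms(5) by (simp add: half_edge_def s'_def t'_def split: if_splits)
  moreover have "s' \<in> {0<..<1}" "t' \<in> {0..1}" using assms(3,4) by (auto simp: s'_def t'_def)
  ultimately have "fst p = fst q" "s' = t'" using inj'[of "fst p" "fst q" s' t'] assms(1,2) by auto
  then have "snd p = snd q \<and> s = t" using assms(3,4) by (auto simp: s'_def t'_def split: if_splits)
  with \<open>fst p = fst q\<close> show ?thesis by (simp add: prod_eq_iff)
qed

lemma half_edge_inj_on: "p \<in> I \<times> UNIV \<Longrightarrow> inj_on (half_edge p) {0..1/2}"
proof (rule inj_onI)
  fix s t assume p: "p \<in> I \<times> UNIV" and s: "s \<in> {0..1/2}" and t: "t \<in> {0..1/2}" and eq: "half_edge p s = half_edge p t"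
  consider "s = 0" "t = 0" | "s \<in> {0<..<1/2}" | "t \<in> {0<..<1/2}" | "s = 1/2" "t = 1/2" | "s = 0" "t = 1/2" | "s = 1/2" "t = 0"
    using s t by force
  then show "s = t"
  proof cases
    case 2 then show ?thesis using half_edge_inj[OF p p _ t eq] by simp
  next
    case 3 then show ?thesis using half_edge_inj[OF p p _ s eq[symmetric]] by simp
  next
    case 5 then show ?thesis using half_edge_0[OF p] half_edge_off_V[OF p, of t] eq by simp
  next
    case 6 then show ?thesis using half_edge_0[OF p] half_edge_off_V[OF p, of s] eq by simp
  qed auto
qed

definition punctured_space :: "'i set \<Rightarrow> 'a set" where
  "punctured_space J = realization - (\<lambda>i. c i (1/2)) ` (I - J)"

lemma edge_subset_punctured_space:
  assumes "i \<in> J" "J \<subseteq> I"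
  shows "c i ` {0<..<1} \<subseteq> punctured_space J"
proof
  fix y assume "y \<in> c i ` {0<..<1}"
  then obtain t where t: "t \<in> {0<..<1}" "y = c i t" by blast
  have "i \<in> I" using assms by blast
  have "y \<noteq> c j (1/2)" if "j \<in> I - J" for j
    using inj[of i j t "1/2"] t that assms by auto
  moreover have "c i t \<in> c i ` {0..1}" using t by (intro imageI) auto
  then have "y \<in> realization" unfolding realization_def using t \<open>i \<in> I\<close> by blast
  ultimately show "y \<in> punctured_space J" unfolding punctured_space_def by blast
qed

text \<open>
  Its complement in the graph consists of the vertices and the other closed edges, hence is compact.
\<close>

lemma openin_edge:
  assumes "i \<in> I" "c i ` {0<..<1} \<subseteq> Y" "Y \<subseteq> realization"
  shows "openin (top_of_set Y) (c i ` {0<..<1})"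
proof -
  define K where "K = V \<union> (\<Union>j\<in>I - {i}. c j ` {0..1})"
  have "compact K" unfolding K_def using finite_I compact_edge
    by (intro compact_Un compact_UN finite_imp_compact[OF finite_V]) auto
  then have "open (- K)" by (simp add: compact_imp_closed open_Compl)
  moreover have "Y \<inter> - K = c i ` {0<..<1}"
  proof
    have "c i ` {0..1} \<subseteq> c i ` {0<..<1} \<union> V"
    proof
      fix y assume "y \<in> c i ` {0..1}"
      then obtain t where "t \<in> {0..1}" "y = c i t" by blast
      then show "y \<in> c i ` {0<..<1} \<union> V"
        using ends[OF assms(1)] by (cases "t = 0 \<or> t = 1") auto
    qed
    then have "realization \<subseteq> c i ` {0<..<1} \<union> K" unfolding realization_def K_def by blast
    then show "Y \<inter> - K \<subseteq> c i ` {0<..<1}" using assms(3) by blast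
    have "c i t \<notin> K" if "t \<in> {0<..<1}" for t
      using interior_off_V[OF assms(1) that] inj'[OF assms(1) _ that] unfolding K_def by auto
    then show "c i ` {0<..<1} \<subseteq> Y \<inter> - K" using assms(2) by blast
  qed
  ultimately show ?thesis by (metis openin_open_Int)
qed

lemma edge_homeomorphism:
  assumes "i \<in> I"
  obtains h' where "homeomorphism {-1<..<1} (c i ` {0<..<1}) (\<lambda>s. c i ((1 + s)/2)) h'"
proof -
  let ?h = "\<lambda>s. c i ((1 + s)/2)"
  have img: "(\<lambda>s::real. (1 + s)/2) ` {-1<..<1} = {0<..<1}"
  proof
    show "{0<..<1} \<subseteq> (\<lambda>s::real. (1 + s)/2) ` {-1<..<1}"
    proof
      fix t :: real assume "t \<in> {0<..<1}"
      then show "t \<in> (\<lambda>s::real. (1 + s)/2) ` {-1<..<1}" by (intro image_eqI[of _ _ "2 * t - 1"]) auto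
    qed
  qed auto
  have conth: "continuous_on {-1..1} ?h"
    by (rule continuous_on_compose2[OF cont[OF assms]]) (auto intro!: continuous_intros)
  have himg: "?h ` {-1<..<1} = c i ` {0<..<1}"
    using arg_cong[OF img, of "image (c i)"] by (simp add: image_image)
  have hinj: "inj_on ?h {-1<..<1}"
  proof (rule inj_onI)
    fix s t :: real assume "s \<in> {-1<..<1}" "t \<in> {-1<..<1}" "?h s = ?h t"
    then show "s = t" using inj[OF assms assms, of "(1 + s)/2" "(1 + t)/2"] by auto
  qed
  show ?thesis
  proof (rule homeomorphism_injective_closed_map[OF _ himg hinj])
    show "continuous_on {-1<..<1} ?h" by (rule continuous_on_subset[OF conth]) auto
    fix U :: "real set" assume "closedin (top_of_set {-1<..<1}) U"
    then obtain T where T: "closed T" "U = {-1<..<1} \<inter> T" unfolding closedin_closed by blast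
    have "compact (?h ` ({-1..1} \<inter> T))"
      using T(1) by (intro compact_continuous_image continuous_on_subset[OF conth] compact_Int_closed) auto
    then have "closed (?h ` ({-1..1} \<inter> T))" by (rule compact_imp_closed)
    moreover have "?h ` U = c i ` {0<..<1} \<inter> ?h ` ({-1..1} \<inter> T)"
    proof
      show "?h ` U \<subseteq> c i ` {0<..<1} \<inter> ?h ` ({-1..1} \<inter> T)" unfolding T(2) using himg by auto
      show "c i ` {0<..<1} \<inter> ?h ` ({-1..1} \<inter> T) \<subseteq> ?h ` U"
      proof
        fix y assume y: "y \<in> c i ` {0<..<1} \<inter> ?h ` ({-1..1} \<inter> T)"
        then obtain s where s: "s \<in> {-1..1}" "s \<in> T" "y = ?h s" by blast
        obtain t where t: "t \<in> {0<..<1}" "y = c i t" using y by blast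
        have "t = (1 + s)/2" using inj'[OF assms assms t(1), of "(1 + s)/2"] s t by auto
        then have "s \<in> {-1<..<1}" using t(1) by auto
        then show "y \<in> ?h ` U" unfolding T(2) using s by blast
      qed
    qed
    ultimately show "closedin (top_of_set (c i ` {0<..<1})) (?h ` U)"
      by (metis closedin_closed_Int)
  qed (use that in blast)
qed

lemma V_subset_punctured_space: "V \<subseteq> punctured_space J"
proof
  fix v assume "v \<in> V"
  moreover have "v \<noteq> c i (1/2)" if "i \<in> I" for i
    using interior_off_V[OF that, of "1/2"] \<open>v \<in> V\<close> by auto
  ultimately show "v \<in> punctured_space J" unfolding punctured_space_def realization_def by blast
qed

text \<open>
  Without the midpoints each half-edge can be contracted to its vertex; the contractions agree
  on overlaps, as half-edges only share vertices.
\<close>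

lemma free_homology_punctured_everywhere: "free_homology (punctured_space {}) 0 (card V)"
proof -
  let ?Y = "punctured_space {}"
  let ?P = "I \<times> (UNIV :: bool set)"
  have inY: "half_edge p t \<in> ?Y" if "p \<in> ?P" "t \<in> {0..<1/2}" for p t
  proof -
    have "half_edge p t \<in> realization"
    proof -
      have "half_edge p t = c (fst p) (if snd p then 1 - t else t)" by (simp add: half_edge_def)
      moreover have "(if snd p then 1 - t else t) \<in> {0..1}" using that by auto
      ultimately have "half_edge p t \<in> c (fst p) ` {0..1}" by blast
      then show ?thesis unfolding realization_def using that(1) by auto
    qed
    moreover have "half_edge p t \<noteq> c j (1/2)" if "j \<in> I" for j
    proof (cases "t = 0")
      case True
      then show ?thesis using half_edge_0[OF \<open>p \<in> ?P\<close>] interior_off_V[OF that, of "1/2"] by auto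
    next
      case False
      then show ?thesis
        using half_edge_inj[of p "(j, False)" t "1/2"] \<open>p \<in> ?P\<close> \<open>t \<in> {0..<1/2}\<close> that
        by (auto simp: half_edge_def)
    qed
    ultimately show ?thesis unfolding punctured_space_def by auto
  qed
  have Y_cover: "\<exists>p\<in>?P. \<exists>t\<in>{0..<1/2}. y = half_edge p t" if "y \<in> ?Y" "y \<notin> V" for y
  proof -
    have "y \<in> (\<Union>i\<in>I. c i ` {0..1})" using that unfolding punctured_space_def realization_def by blast
    then obtain i t where it: "i \<in> I" "t \<in> {0..1}" "y = c i t" by blast
    have "t \<noteq> 1/2"
    proof
      assume "t = 1/2"
      then have "y \<in> (\<lambda>i. c i (1/2)) ` (I - {})" using it by blast
      then show False using that unfolding punctured_space_def by blast
    qed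
    then consider "t < 1/2" | "t > 1/2" by linarith
    then show ?thesis
    proof cases
      case 1
      then show ?thesis using it by (intro bexI[of _ "(i, False)"] bexI[of _ t]) (auto simp: half_edge_def)
    next
      case 2
      then show ?thesis using it by (intro bexI[of _ "(i, True)"] bexI[of _ "1 - t"]) (auto simp: half_edge_def)
    qed
  qed
  have "\<exists>g. homeomorphism {0..1/2} (half_edge p ` {0..1/2}) (half_edge p) g" if "p \<in> ?P" for p
  proof (rule homeomorphism_compact[OF compact_Icc _ refl half_edge_inj_on[OF that]])
    show "continuous_on {0..1/2} (half_edge p)" by (rule continuous_on_subset[OF half_edge_cont[OF that]]) auto
  qed
  then obtain g where g: "\<And>p. p \<in> ?P \<Longrightarrow> homeomorphism {0..1/2} (half_edge p ` {0..1/2}) (half_edge p) (g p)"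
    by metis
  have g_inv: "g p (half_edge p t) = t" if "p \<in> ?P" "t \<in> {0..1/2}" for p t
    using homeomorphism_apply1[OF g[OF that(1)] that(2)] .
  define T where "T = (\<lambda>p. case p of None \<Rightarrow> {0..1::real} \<times> V | Some p \<Rightarrow> {0..1} \<times> (half_edge p ` {0..1/2} \<inter> ?Y))"
  define f where "f = (\<lambda>p. case p of None \<Rightarrow> snd | Some p \<Rightarrow> (\<lambda>z::real \<times> 'a. half_edge p ((1 - fst z) * g p (snd z))))"
  have half: "\<exists>t\<in>{0..<1/2}. y = half_edge p t" if "p \<in> ?P" "y \<in> half_edge p ` {0..1/2} \<inter> ?Y" for p y
  proof -
    from that(2) obtain t where t: "t \<in> {0..1/2}" "y = half_edge p t" by blast
    have "t \<noteq> 1/2"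
    proof
      assume "t = 1/2"
      have "y = c (fst p) (1/2)" using t(2) unfolding \<open>t = 1/2\<close> half_edge_def by simp
      then have "y \<in> (\<lambda>i. c i (1/2)) ` (I - {})" using that(1) by auto
      then show False using that(2) unfolding punctured_space_def by blast
    qed
    then show ?thesis using t by (intro bexI[of _ t]) auto
  qed
  have X: "prod_topology (top_of_set {0..1::real}) (top_of_set ?Y) = top_of_set ({0..1} \<times> ?Y)"
    by (simp flip: subtopology_Times)
  obtain F where F: "continuous_map (top_of_set ({0..1} \<times> ?Y)) (top_of_set ?Y) F"
    and Ff: "\<And>z p. p \<in> insert None (Some ` ?P) \<Longrightarrow> z \<in> topspace (top_of_set ({0..1} \<times> ?Y)) \<inter> T p \<Longrightarrow> F z = f p z"
  proof (rule pasting_lemma_exists_closed[of "insert None (Some ` ?P)" "top_of_set ({0..1} \<times> ?Y)" T "top_of_set ?Y" f])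
    show "finite (insert None (Some ` ?P))" using finite_I by simp
    show "topspace (top_of_set ({0..1} \<times> ?Y)) \<subseteq> \<Union> (T ` insert None (Some ` ?P))"
    proof
      fix z assume "z \<in> topspace (top_of_set ({0..1::real} \<times> ?Y))"
      then obtain \<tau> y where z: "z = (\<tau>, y)" "\<tau> \<in> {0..1}" "y \<in> ?Y" by auto
      show "z \<in> \<Union> (T ` insert None (Some ` ?P))"
      proof (cases "y \<in> V")
        case True
        then show ?thesis using z by (auto simp: T_def)
      next
        case False
        then obtain p t where "p \<in> ?P" "t \<in> {0..<1/2}" "y = half_edge p t" using Y_cover z by blast
        then have "z \<in> T (Some p)" using z by (auto simp: T_def)
        then show ?thesis using \<open>p \<in> ?P\<close> by blast
      qed
    qed
    fix p assume p: "p \<in> insert None (Some ` ?P)"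
    show "closedin (top_of_set ({0..1} \<times> ?Y)) (T p)"
    proof (cases p)
      case None
      have "T p = ({0..1} \<times> ?Y) \<inter> (UNIV \<times> V)" using V_subset_punctured_space None by (auto simp: T_def)
      moreover have "closed ((UNIV::real set) \<times> V)" using finite_V by (intro closed_Times) (auto intro: finite_imp_closed)
      ultimately show ?thesis by (metis closedin_closed_Int)
    next
      case (Some q)
      then have q: "q \<in> ?P" using p by auto
      have "closed (half_edge q ` {0..1/2})"
        by (intro compact_imp_closed compact_continuous_image continuous_on_subset[OF half_edge_cont[OF q]]) auto
      then have "closed ((UNIV::real set) \<times> half_edge q ` {0..1/2})" by (intro closed_Times) auto
      moreover have "T p = ({0..1} \<times> ?Y) \<inter> (UNIV \<times> half_edge q ` {0..1/2})" using Some by (auto simp: T_def)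
      ultimately show ?thesis by (metis closedin_closed_Int)
    qed
    show "continuous_map (subtopology (top_of_set ({0..1} \<times> ?Y)) (T p)) (top_of_set ?Y) (f p)"
    proof (cases p)
      case None
      then show ?thesis using V_subset_punctured_space
        by (auto simp: f_def T_def subtopology_subtopology continuous_map_in_subtopology intro: continuous_on_snd continuous_on_id)
    next
      case (Some q)
      then have q: "q \<in> ?P" using p by auto
      have contg: "continuous_on (half_edge q ` {0..1/2}) (g q)" using g[OF q] by (simp add: homeomorphism_def)
      have sub: "({0..1} \<times> ?Y) \<inter> T p = T p" using Some by (auto simp: T_def)
      have range: "g q y \<in> {0..<1/2}" if "y \<in> half_edge q ` {0..1/2} \<inter> ?Y" for y
        using half[OF q that] g_inv[OF q] by auto
      have scale: "(1 - \<tau>) * t \<in> {0..<1/2}" if "\<tau> \<in> {0..1}" "t \<in> {0..<1/2}" for \<tau> t :: real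
        using that mult_left_le_one_le[of t "1 - \<tau>"] by auto
      have param: "(1 - fst z) * g q (snd z) \<in> {0..<1/2}" if "z \<in> T p" for z
        using that Some range scale by (auto simp: T_def simp del: atLeastLessThan_iff)
      have "continuous_on (T p) (\<lambda>z. g q (snd z))"
        by (rule continuous_on_compose2[OF contg]) (use Some in \<open>auto simp: T_def intro!: continuous_intros\<close>)
      then have "continuous_on (T p) (\<lambda>z. (1 - fst z) * g q (snd z))" by (intro continuous_intros)
      moreover have "(\<lambda>z. (1 - fst z) * g q (snd z)) ` T p \<subseteq> {0..1}"
      proof
        fix s assume "s \<in> (\<lambda>z. (1 - fst z) * g q (snd z)) ` T p"
        then have "s \<in> {0..<1/2}" using param by blast
        then show "s \<in> {0..1}" by simp
      qed
      ultimately have "continuous_on (T p) (\<lambda>z. half_edge q ((1 - fst z) * g q (snd z)))"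
        by (rule continuous_on_compose2[OF half_edge_cont[OF q]])
      then have "continuous_on (T p) (f p)" unfolding f_def using Some by simp
      moreover have "f p z \<in> ?Y" if "z \<in> T p" for z
        using inY[OF q param[OF that]] Some by (simp add: f_def)
      ultimately show ?thesis by (auto simp: subtopology_subtopology sub continuous_map_in_subtopology)
    qed
    have agree: "f p z = snd z" if "p \<in> insert None (Some ` ?P)" "z \<in> T p" "snd z \<in> V" for p z
    proof (cases p)
      case None
      then show ?thesis by (simp add: f_def)
    next
      case (Some q)
      then have q: "q \<in> ?P" using that by auto
      have "snd z \<in> half_edge q ` {0..1/2} \<inter> ?Y" using that Some by (auto simp: T_def)
      then obtain t where t: "t \<in> {0..<1/2}" "snd z = half_edge q t" using half[OF q] by blast
      then have "t = 0" using half_edge_off_V[OF q, of t] that(3) by force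
      then show ?thesis using g_inv[OF q, of 0] t Some by (simp add: f_def)
    qed
    fix q z assume q: "q \<in> insert None (Some ` ?P)" and z: "z \<in> topspace (top_of_set ({0..1} \<times> ?Y)) \<inter> T p \<inter> T q"
    show "f p z = f q z"
    proof (cases "snd z \<in> V")
      case True
      then show ?thesis using agree[OF p _ True] agree[OF q _ True] z by auto
    next
      case False
      then obtain p' where p': "p = Some p'" using z by (cases p) (auto simp: T_def)
      obtain q' where q': "q = Some q'" using z False by (cases q) (auto simp: T_def)
      have P: "p' \<in> ?P" "q' \<in> ?P" using p q p' q' by auto
      obtain s where s: "s \<in> {0..<1/2}" "snd z = half_edge p' s" using half[OF P(1), of "snd z"] z p' by (auto simp: T_def)
      obtain t where t: "t \<in> {0..<1/2}" "snd z = half_edge q' t" using half[OF P(2), of "snd z"] z q' by (auto simp: T_def)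
      have "s \<noteq> 0" using s half_edge_0[OF P(1)] False by auto
      then have "p' = q'" using half_edge_inj[OF P, of s t] s t by auto
      then show ?thesis using p' q' by simp
    qed
  qed blast
  have FV: "F (\<tau>, v) = v" if "v \<in> V" "\<tau> \<in> {0..1}" for v \<tau>
    using Ff[of None "(\<tau>, v)"] V_subset_punctured_space that by (auto simp: T_def f_def)
  have Fp: "F (\<tau>, half_edge p t) = half_edge p ((1 - \<tau>) * t)" if "p \<in> ?P" "t \<in> {0..<1/2}" "\<tau> \<in> {0..1}" for p t \<tau>
    using Ff[of "Some p" "(\<tau>, half_edge p t)"] inY[OF that(1,2)] that g_inv[of p t] by (auto simp: T_def f_def)
  show ?thesis
  proof (rule free_homology_deformation_to_finite_set[OF finite_V V_subset_punctured_space])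
    show "continuous_on ({0..1} \<times> ?Y) F" "F ` ({0..1} \<times> ?Y) \<subseteq> ?Y"
      using F by (auto simp: continuous_map_in_subtopology)
    fix y assume y: "y \<in> ?Y"
    show "F (0, y) = y"
      using FV[of y 0] Fp[of _ _ 0] Y_cover[OF y] by (cases "y \<in> V") auto
    show "F (1, y) \<in> V"
      using FV[of y 1] Fp[of _ _ 1] Y_cover[OF y] half_edge_0 by (cases "y \<in> V") auto
  next
    show "F (1, v) = v" if "v \<in> V" for v using FV that by simp
  qed
qed

lemma free_homology_punctured_space:
  assumes "J \<subseteq> I"
  shows "\<exists>m b. free_homology (punctured_space J) m b \<and> m + card V = b + card J"
proof -
  have "finite J" using assms finite_I finite_subset by blast
  then show ?thesis using assms
  proof (induction J)
    case empty
    then show ?case using free_homology_punctured_everywhere by (intro exI[of _ 0] exI[of _ "card V"]) simp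
  next
    case (insert i J)
    then obtain m b where mb: "free_homology (punctured_space J) m b" "m + card V = b + card J" by blast
    have i: "i \<in> I" using insert by blast
    have sub: "c i ` {0<..<1} \<subseteq> punctured_space (insert i J)"
      by (rule edge_subset_punctured_space) (use insert in auto)
    have eq: "punctured_space (insert i J) - {c i ((1 + 0)/2)} = punctured_space J"
      unfolding punctured_space_def using insert i by auto
    obtain h' where "homeomorphism {-1<..<1} (c i ` {0<..<1}) (\<lambda>s. c i ((1 + s)/2)) h'"
      using edge_homeomorphism[OF i] .
    moreover have "openin (top_of_set (punctured_space (insert i J))) (c i ` {0<..<1})"
      by (rule openin_edge[OF i sub]) (auto simp: punctured_space_def)
    ultimately have "free_homology (punctured_space (insert i J)) (Suc m) b
      \<or> (\<exists>b'. b = Suc b' \<and> free_homology (punctured_space (insert i J)) m b')"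
      by (rule free_homology_fill_puncture) (use mb(1) eq in simp)
    then show ?case
    proof
      assume "free_homology (punctured_space (insert i J)) (Suc m) b"
      then show ?thesis using mb(2) insert by (intro exI[of _ "Suc m"] exI[of _ b]) simp
    next
      assume "\<exists>b'. b = Suc b' \<and> free_homology (punctured_space (insert i J)) m b'"
      then obtain b' where "b = Suc b'" "free_homology (punctured_space (insert i J)) m b'" by blast
      then show ?thesis using mb(2) insert by (intro exI[of _ m] exI[of _ b']) simp
    qed
  qed
qed

text \<open>
  The rank minus the number of components is \<open>- card V\<close> for the graph without midpoints and grows by
  one with each of them; connectedness then determines the rank.
\<close>

theorem homology:
  assumes "connected realization" "realization \<noteq> {}"
  obtains m where "m + card V = card I + 1"
    "homology_group 0 (top_of_set realization) \<cong> integer_group"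
    "homology_group 1 (top_of_set realization) \<cong> product_group {..<m} (\<lambda>_. integer_group)"
    "\<And>p. p \<ge> 2 \<Longrightarrow> trivial_group (homology_group p (top_of_set realization))"
proof -
  obtain m b where mb: "free_homology (punctured_space I) m b" "m + card V = b + card I"
    using free_homology_punctured_space[of I] by blast
  have eq: "punctured_space I = realization" by (simp add: punctured_space_def)
  have comps: "components realization = {realization}" using assms unfolding components_eq_sing_iff by (rule conjI)
  note fh = mb(1)[unfolded free_homology_def eq comps]
  have "card {realization} = b" using fh by (elim conjE)
  moreover have "\<forall>C\<in>{realization}. path_connected C" using fh by (elim conjE)
  ultimately have "b = 1" "path_connected realization" by simp_all
  have "homology_group 0 (top_of_set realization) \<cong> integer_group"
  proof (rule isomorphic_integer_zeroth_homology_group)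
    have "path_connectedin euclidean realization"
      using \<open>path_connected realization\<close> by (simp only: path_connectedin_euclidean)
    then show "path_connected_space (top_of_set realization)" by (simp add: path_connectedin_def)
  qed (use assms in simp)
  moreover have "m + card V = card I + 1" using mb(2) \<open>b = 1\<close> by simp
  moreover have "homology_group 1 (top_of_set realization) \<cong> product_group {..<m} (\<lambda>_. integer_group)"
    using fh by (elim conjE)
  moreover have "trivial_group (homology_group p (top_of_set realization))" if "p \<ge> 2" for p
  proof -
    have "\<forall>p\<ge>2. trivial_group (homology_group p (top_of_set realization))" using fh by (elim conjE)
    then show ?thesis using that by blast
  qed
  ultimately show ?thesis using that[of m] by blast
qed

end

section \<open>Edge ends at a vertex\<close>

context finite_graph
begin

definition half_edges_at :: "'a \<Rightarrow> ('i \<times> bool) set" where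
  "half_edges_at v = {p \<in> I \<times> UNIV. half_edge p 0 = v}"

lemma finite_half_edges_at: "finite (half_edges_at v)"
  unfolding half_edges_at_def using finite_I by simp

lemma realization_half_edges: "realization = V \<union> (\<Union>p\<in>I \<times> UNIV. half_edge p ` {0..1/2})"
proof -
  have "c i ` {0..1} = half_edge (i, False) ` {0..1/2} \<union> half_edge (i, True) ` {0..1/2}" for i
  proof -
    have "{0..1::real} = {0..1/2} \<union> (\<lambda>t. 1 - t) ` {0..1/2}"
      by (auto simp: image_iff intro!: bexI[of _ "1 - _"])
    then have "c i ` {0..1} = c i ` {0..1/2} \<union> c i ` (\<lambda>t. 1 - t) ` {0..1/2}" by (metis image_Un)
    moreover have "half_edge (i, False) ` X = c i ` X" "half_edge (i, True) ` X = c i ` (\<lambda>t. 1 - t) ` X" for X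
      by (simp_all add: half_edge_def image_image)
    ultimately show ?thesis by metis
  qed
  then have "(\<Union>i\<in>I. c i ` {0..1}) = (\<Union>p\<in>I \<times> UNIV. half_edge p ` {0..1/2})"
    by (auto simp: UNIV_bool)
  then show ?thesis unfolding realization_def by simp
qed

text \<open>
  Where the distance from \<open>v\<close> is strictly increasing, a ball cuts an initial interval out of each
  half-edge at \<open>v\<close>.  The rest of the graph is compact and stays outside small balls.
\<close>

lemma card_components_near_vertex:
  assumes v: "v \<in> V"
    and mono: "\<And>p. p \<in> half_edges_at v \<Longrightarrow> \<exists>\<delta>>0. strict_mono_on {0..\<delta>} (\<lambda>u. dist v (half_edge p u))"
    and X: "0 < \<epsilon>0" "X \<inter> ball v \<epsilon>0 = realization \<inter> ball v \<epsilon>0"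
  shows "\<forall>\<^sub>F \<epsilon> in at_right (0::real). finite (components ((X - {v}) \<inter> ball v \<epsilon>)) \<and>
    card (components ((X - {v}) \<inter> ball v \<epsilon>)) = card (half_edges_at v)"
proof -
  let ?H = "half_edges_at v"
  obtain \<delta>f where \<delta>f: "\<And>p. p \<in> ?H \<Longrightarrow> \<delta>f p > 0 \<and> strict_mono_on {0..\<delta>f p} (\<lambda>u. dist v (half_edge p u))"
    using mono by metis
  \<comment> \<open>The bound \<open>1/4\<close> keeps the two halves of an edge apart and makes \<open>Min\<close> meaningful if no edge ends at \<open>v\<close>.\<close>
  define \<delta> where "\<delta> = Min (insert (1/4) (\<delta>f ` ?H))"
  have \<delta>: "0 < \<delta>" "\<delta> \<le> 1/4" "\<And>p. p \<in> ?H \<Longrightarrow> \<delta> \<le> \<delta>f p"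
  proof -
    have fin: "finite (insert (1/4) (\<delta>f ` ?H))" using finite_half_edges_at by simp
    show "\<delta> \<le> 1/4" "\<And>p. p \<in> ?H \<Longrightarrow> \<delta> \<le> \<delta>f p"
      unfolding \<delta>_def by (rule Min_le[OF fin], blast)+
    show "0 < \<delta>" unfolding \<delta>_def using fin \<delta>f by (subst Min_gr_iff) auto
  qed
  have mono\<delta>: "dist v (half_edge p s) < dist v (half_edge p t)"
    if "p \<in> ?H" "0 \<le> s" "s < t" "t \<le> \<delta>" for p s t
    using \<delta>f[OF that(1)] \<delta>(3)[OF that(1)] that by (auto simp: strict_mono_on_def)
  have H: "p \<in> I \<times> UNIV" "half_edge p 0 = v" if "p \<in> ?H" for p
    using that by (auto simp: half_edges_at_def)
  define K where "K = (V - {v}) \<union> ((\<Union>p\<in>?H. half_edge p ` {\<delta>..1/2}) \<union> (\<Union>p\<in>I \<times> UNIV - ?H. half_edge p ` {0..1/2}))"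
  have compact_piece: "compact (half_edge p ` {a..b})" if "p \<in> I \<times> UNIV" "0 \<le> a" "b \<le> 1" for p a b
    by (intro compact_continuous_image continuous_on_subset[OF half_edge_cont[OF that(1)]]) (use that in auto)
  have "compact K"
    unfolding K_def using H \<delta> finite_half_edges_at finite_I finite_V
    by (intro compact_Un compact_UN compact_piece finite_imp_compact[of "V - {v}"]) auto
  then have "open (- K)" by (simp add: compact_imp_closed open_Compl)
  moreover have "v \<notin> K"
  proof -
    have off: "half_edge p t \<noteq> v" if "p \<in> I \<times> UNIV" "t \<in> {0<..1/2}" for p t
      using half_edge_off_V[OF that(1), of t] v that(2) by auto
    have "v \<notin> half_edge p ` {0..1/2}" if p: "p \<in> I \<times> UNIV - ?H" for p
    proof
      assume "v \<in> half_edge p ` {0..1/2}"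
      then obtain t where t: "t \<in> {0..1/2}" "half_edge p t = v" by blast
      then have "t \<noteq> 0" using p by (auto simp: half_edges_at_def)
      then show False using off[of p t] p t by simp
    qed
    moreover have "v \<notin> half_edge p ` {\<delta>..1/2}" if p: "p \<in> ?H" for p
    proof
      assume "v \<in> half_edge p ` {\<delta>..1/2}"
      then obtain t where t: "t \<in> {\<delta>..1/2}" "half_edge p t = v" by blast
      then show False using off[of p t] H(1)[OF p] \<delta>(1) by simp
    qed
    ultimately show ?thesis unfolding K_def by blast
  qed
  ultimately obtain \<epsilon>1 where \<epsilon>1: "\<epsilon>1 > 0" "ball v \<epsilon>1 \<subseteq> - K"
    by (meson ComplI open_contains_ball)
  have cover: "realization \<subseteq> insert v K \<union> (\<Union>p\<in>?H. half_edge p ` {0<..<\<delta>})"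
  proof
    fix y assume y: "y \<in> realization"
    show "y \<in> insert v K \<union> (\<Union>p\<in>?H. half_edge p ` {0<..<\<delta>})"
    proof (cases "y \<in> V")
      case True
      then show ?thesis unfolding K_def by blast
    next
      case False
      then obtain p t where pt: "p \<in> I \<times> UNIV" "t \<in> {0..1/2}" "y = half_edge p t"
        using y unfolding realization_half_edges by blast
      show ?thesis
      proof (cases "p \<in> ?H")
        case True
        have "t \<noteq> 0" using False half_edge_0[OF pt(1)] pt(3) by auto
        then have "t \<in> {0<..<\<delta>} \<or> t \<in> {\<delta>..1/2}" using pt(2) by auto
        then show ?thesis
        proof
          assume "t \<in> {0<..<\<delta>}"
          then show ?thesis using True pt(3) by blast
        next
          assume "t \<in> {\<delta>..1/2}"
          then have "y \<in> K" unfolding K_def using True pt(3) by blast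
          then show ?thesis by blast
        qed
      next
        case False
        then show ?thesis using pt unfolding K_def by blast
      qed
    qed
  qed
  have sub: "half_edge p ` {0<..<\<delta>} \<subseteq> realization" if "p \<in> ?H" for p
  proof -
    have "half_edge p ` {0<..<\<delta>} \<subseteq> half_edge p ` {0..1/2}" using \<delta> by (intro image_mono) auto
    then show ?thesis using H(1)[OF that] unfolding realization_half_edges by blast
  qed
  have key: "finite (components ((X - {v}) \<inter> ball v \<epsilon>)) \<and>
    card (components ((X - {v}) \<inter> ball v \<epsilon>)) = card ?H" if \<epsilon>: "0 < \<epsilon>" "\<epsilon> < min \<epsilon>0 \<epsilon>1" for \<epsilon>
  proof -
    let ?Z = "(X - {v}) \<inter> ball v \<epsilon>"
    define U where "U = (\<lambda>p. {u \<in> {0<..<\<delta>}. dist v (half_edge p u) < \<epsilon>})"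
    define S where "S = (\<lambda>p. half_edge p ` U p)"
    have "ball v \<epsilon> \<subseteq> ball v \<epsilon>0" "ball v \<epsilon> \<subseteq> - K"
      using \<epsilon> subset_trans[OF subset_ball \<epsilon>1(2)] by auto
    then have Z: "?Z = (realization - {v}) \<inter> ball v \<epsilon>" using X(2) by blast
    have off_v: "half_edge p u \<noteq> v" if "p \<in> ?H" "u \<in> {0<..<\<delta>}" for p u
      using half_edge_off_V[OF H(1)[OF that(1)], of u] v that(2) \<delta>(2) by auto
    have union: "\<Union>(S ` ?H) = ?Z"
    proof
      show "\<Union>(S ` ?H) \<subseteq> ?Z"
      proof
        fix y assume "y \<in> \<Union>(S ` ?H)"
        then obtain p u where p: "p \<in> ?H" and u: "u \<in> U p" "y = half_edge p u" unfolding S_def by blast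
        then have "u \<in> {0<..<\<delta>}" "dist v y < \<epsilon>" by (simp_all add: U_def)
        then show "y \<in> ?Z" using sub[OF p] off_v[OF p] u(2) unfolding Z by auto
      qed
      show "?Z \<subseteq> \<Union>(S ` ?H)"
      proof
        fix y assume y: "y \<in> ?Z"
        then have "y \<in> realization" "y \<noteq> v" "y \<notin> K" "dist v y < \<epsilon>"
          using \<open>ball v \<epsilon> \<subseteq> - K\<close> unfolding Z by auto
        then obtain p u where "p \<in> ?H" "u \<in> {0<..<\<delta>}" "y = half_edge p u" using cover by blast
        then show "y \<in> \<Union>(S ` ?H)" using \<open>dist v y < \<epsilon>\<close> unfolding S_def U_def by blast
      qed
    qed
    have disj: "S p \<inter> half_edge q ` {0..\<delta>} = {}" if "p \<in> ?H" "q \<in> ?H" "p \<noteq> q" for p q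
    proof -
      have "half_edge p u \<noteq> half_edge q w" if "u \<in> {0<..<\<delta>}" "w \<in> {0..\<delta>}" for u w
        using half_edge_inj[OF H(1)[OF \<open>p \<in> ?H\<close>] H(1)[OF \<open>q \<in> ?H\<close>], of u w] that \<delta>(2) \<open>p \<noteq> q\<close> by auto
      then show ?thesis unfolding S_def U_def by blast
    qed
    have S_sub: "S p \<subseteq> half_edge p ` {0..\<delta>}" for p unfolding S_def U_def by (intro image_mono) auto
    have nonempty: "S p \<noteq> {}" if "p \<in> ?H" for p
    proof -
      have "continuous_on {0..1} (\<lambda>u. dist v (half_edge p u))"
        by (intro continuous_intros half_edge_cont H(1) that)
      then obtain d where d: "d > 0" "\<And>u. u \<in> {0..1} \<Longrightarrow> dist u 0 < d \<Longrightarrow> dist (dist v (half_edge p u)) (dist v (half_edge p 0)) < \<epsilon>"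
        using \<epsilon>(1) unfolding continuous_on_iff by (metis atLeastAtMost_iff order_refl zero_le_one)
      define u where "u = min (\<delta>/2) (d/2)"
      have u: "u \<in> {0<..<\<delta>}" "u \<in> {0..1}" "dist u 0 < d" using \<delta> d(1) by (auto simp: u_def min_def)
      have "dist v (half_edge p u) < \<epsilon>" using d(2)[OF u(2,3)] H(2)[OF that] by simp
      then show ?thesis using u(1) unfolding S_def U_def by blast
    qed
    have conn: "connected (S p)" if p: "p \<in> ?H" for p
    proof -
      have "is_interval (U p)"
        unfolding is_interval_1
      proof (intro ballI allI impI)
        fix x y z assume xy: "x \<in> U p" "y \<in> U p" "x \<le> z \<and> z \<le> y"
        have "dist v (half_edge p z) \<le> dist v (half_edge p y)"
          using mono\<delta>[OF p, of z y] xy by (cases "z = y") (auto simp: U_def)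
        then show "z \<in> U p" using xy by (auto simp: U_def)
      qed
      then have "connected (U p)" by (simp add: is_interval_connected_1)
      moreover have "continuous_on (U p) (half_edge p)"
        by (rule continuous_on_subset[OF half_edge_cont[OF H(1)[OF p]]]) (use \<delta> in \<open>auto simp: U_def\<close>)
      ultimately show ?thesis unfolding S_def by (intro connected_continuous_image)
    qed
    have "components ?Z = S ` ?H"
    proof (rule components_eq_open_partition[OF union])
      show "connected D \<and> D \<noteq> {} \<and> openin (top_of_set ?Z) D" if D: "D \<in> S ` ?H" for D
      proof -
        obtain p where p: "p \<in> ?H" "D = S p" using D by blast
        have "compact (\<Union>q\<in>?H - {p}. half_edge q ` {0..\<delta>})"
          using finite_half_edges_at H \<delta> by (intro compact_UN compact_piece) auto
        then have "open (- (\<Union>q\<in>?H - {p}. half_edge q ` {0..\<delta>}))" by (intro open_Compl compact_imp_closed)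
        moreover have "S p = ?Z \<inter> - (\<Union>q\<in>?H - {p}. half_edge q ` {0..\<delta>})"
        proof
          show "S p \<subseteq> ?Z \<inter> - (\<Union>q\<in>?H - {p}. half_edge q ` {0..\<delta>})"
          proof (intro Int_greatest)
            have "S p \<subseteq> \<Union>(S ` ?H)" using p(1) by (rule UN_upper)
            then show "S p \<subseteq> (X - {v})" "S p \<subseteq> ball v \<epsilon>" unfolding union by simp_all
            have "S p \<inter> half_edge q ` {0..\<delta>} = {}" if "q \<in> ?H - {p}" for q
              using that p(1) by (intro disj) auto
            then show "S p \<subseteq> - (\<Union>q\<in>?H - {p}. half_edge q ` {0..\<delta>})" by (simp only: disjoint_eq_subset_Compl[symmetric] Int_UN_distrib UN_I) blast
          qed
          show "?Z \<inter> - (\<Union>q\<in>?H - {p}. half_edge q ` {0..\<delta>}) \<subseteq> S p"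
          proof
            fix y assume y: "y \<in> ?Z \<inter> - (\<Union>q\<in>?H - {p}. half_edge q ` {0..\<delta>})"
            then obtain q where q: "q \<in> ?H" "y \<in> S q" unfolding union[symmetric] by blast
            then have "q = p" using y S_sub[of q] by blast
            then show "y \<in> S p" using q by simp
          qed
        qed
        ultimately have "openin (top_of_set ?Z) (S p)" by (metis openin_open_Int)
        then show ?thesis using p conn nonempty by blast
      qed
      show "D \<inter> D' = {}" if "D \<in> S ` ?H" "D' \<in> S ` ?H" "D \<noteq> D'" for D D'
      proof -
        from that(1,2) obtain p q where pq: "p \<in> ?H" "D = S p" "q \<in> ?H" "D' = S q" by blast
        then have "S p \<inter> half_edge q ` {0..\<delta>} = {}" using that(3) by (intro disj) auto
        moreover have "S p \<inter> S q \<subseteq> S p \<inter> half_edge q ` {0..\<delta>}" by (rule Int_mono[OF order_refl S_sub])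
        ultimately show ?thesis unfolding pq(2,4) by simp
      qed
    qed
    moreover have "inj_on S ?H"
    proof (rule inj_onI)
      fix p q assume "p \<in> ?H" "q \<in> ?H" "S p = S q"
      then show "p = q" using disj[of p q] S_sub[of q] nonempty[of p] by blast
    qed
    ultimately show ?thesis using finite_half_edges_at by (simp add: card_image)
  qed
  have "0 < min \<epsilon>0 \<epsilon>1" using X(1) \<epsilon>1(1) by simp
  then have "\<forall>\<^sub>F \<epsilon> in at_right 0. \<epsilon> \<in> {0<..<min \<epsilon>0 \<epsilon>1}" by (rule eventually_at_right_real)
  then show ?thesis by (rule eventually_mono) (use key in simp)
qed

end

section \<open>Graphs traced by paths\<close>

text \<open>
  A graph given by paths that may run through many vertices.  The edges are the pieces between
  consecutive visits, so no enumeration of the break points of a path is needed, only the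
  successor of each of them.
\<close>

locale traced_graph =
  fixes V :: "'a::metric_space set" and K :: "'k set" and g :: "'k \<Rightarrow> real \<Rightarrow> 'a"
  assumes finite_V: "finite V" and finite_K: "finite K"
    and cont: "\<And>k. k \<in> K \<Longrightarrow> continuous_on {0..1} (g k)"
    and ends: "\<And>k. k \<in> K \<Longrightarrow> g k 0 \<in> V \<and> g k 1 \<in> V"
    and finite_fibres: "\<And>k v. k \<in> K \<Longrightarrow> v \<in> V \<Longrightarrow> finite {t \<in> {0..1}. g k t = v}"
    and inj: "\<And>k l s t. k \<in> K \<Longrightarrow> l \<in> K \<Longrightarrow> s \<in> {0..1} \<Longrightarrow> t \<in> {0..1} \<Longrightarrow> g k s = g l t \<Longrightarrow> g k s \<notin> V
      \<Longrightarrow> k = l \<and> s = t"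
begin

definition breaks :: "'k \<Rightarrow> real set" where
  "breaks k = {t \<in> {0..1}. g k t \<in> V}"

definition succ_break :: "'k \<Rightarrow> real \<Rightarrow> real" where
  "succ_break k s = Min {u \<in> breaks k. s < u}"

definition edges :: "('k \<times> real) set" where
  "edges = (SIGMA k:K. breaks k - {1})"

definition edge :: "'k \<times> real \<Rightarrow> real \<Rightarrow> 'a" where
  "edge = (\<lambda>(k, s) u. g k (s + u * (succ_break k s - s)))"

lemma finite_breaks: "k \<in> K \<Longrightarrow> finite (breaks k)"
proof -
  assume k: "k \<in> K"
  have "breaks k = (\<Union>v\<in>V. {t \<in> {0..1}. g k t = v})" by (auto simp: breaks_def)
  then show ?thesis using finite_V finite_fibres[OF k] by simp
qed

lemma breaks_01: "k \<in> K \<Longrightarrow> 0 \<in> breaks k \<and> 1 \<in> breaks k"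
  using ends by (auto simp: breaks_def)

lemma succ_break:
  assumes "k \<in> K" "s \<in> breaks k - {1}"
  shows "succ_break k s \<in> breaks k" "s < succ_break k s"
    "\<And>u. u \<in> breaks k \<Longrightarrow> s < u \<Longrightarrow> succ_break k s \<le> u"
proof -
  let ?U = "{u \<in> breaks k. s < u}"
  have fin: "finite ?U" using finite_breaks[OF assms(1)] by simp
  have "s \<le> 1" using assms(2) by (simp add: breaks_def)
  then have "1 \<in> ?U" using breaks_01[OF assms(1)] assms(2) by auto
  then have "succ_break k s \<in> ?U" unfolding succ_break_def using Min_in[OF fin] by blast
  then show "succ_break k s \<in> breaks k" "s < succ_break k s" by auto
  show "succ_break k s \<le> u" if "u \<in> breaks k" "s < u" for u
    unfolding succ_break_def using fin that by (intro Min_le) auto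
qed

lemma bij_betw_succ_break: "k \<in> K \<Longrightarrow> bij_betw (succ_break k) (breaks k - {1}) (breaks k - {0})"
proof (rule bij_betw_imageI)
  assume k: "k \<in> K"
  show "inj_on (succ_break k) (breaks k - {1})"
  proof (rule linorder_inj_onI)
    fix s t assume "s < t" "s \<in> breaks k - {1}" "t \<in> breaks k - {1}"
    then have "succ_break k s \<le> t" "t < succ_break k t" using succ_break[OF k] by auto
    then show "succ_break k s \<noteq> succ_break k t" by simp
  qed auto
  show "succ_break k ` (breaks k - {1}) = breaks k - {0}"
  proof
    show "succ_break k ` (breaks k - {1}) \<subseteq> breaks k - {0}"
    proof
      fix u assume "u \<in> succ_break k ` (breaks k - {1})"
      then obtain s where s: "s \<in> breaks k - {1}" "u = succ_break k s" by blast
      have "0 \<le> s" using s(1) by (simp add: breaks_def)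
      then show "u \<in> breaks k - {0}" using succ_break(1,2)[OF k s(1)] s(2) by auto
    qed
    show "breaks k - {0} \<subseteq> succ_break k ` (breaks k - {1})"
    proof
      fix u assume u: "u \<in> breaks k - {0}"
      let ?L = "{s \<in> breaks k. s < u}"
      have fin: "finite ?L" using finite_breaks[OF k] by simp
      have "0 \<in> ?L" using breaks_01[OF k] u by (auto simp: breaks_def)
      then have max: "Max ?L \<in> ?L" using Max_in[OF fin] by blast
      have "u \<le> 1" using u by (simp add: breaks_def)
      then have M: "Max ?L \<in> breaks k - {1}" using max by auto
      have "succ_break k (Max ?L) \<le> u" using succ_break(3)[OF k M] u max by auto
      moreover have "\<not> succ_break k (Max ?L) < u"
      proof
        assume "succ_break k (Max ?L) < u"
        then have "succ_break k (Max ?L) \<in> ?L" using succ_break(1)[OF k M] by simp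
        then have "succ_break k (Max ?L) \<le> Max ?L" using fin by (intro Max_ge)
        then show False using succ_break(2)[OF k M] by simp
      qed
      ultimately have "succ_break k (Max ?L) = u" by simp
      then show "u \<in> succ_break k ` (breaks k - {1})" by (rule image_eqI[OF sym M])
    qed
  qed
qed

lemma edge_param:
  assumes "k \<in> K" "s \<in> breaks k - {1}" "u \<in> {0<..<1}"
  shows "s < s + u * (succ_break k s - s)" "s + u * (succ_break k s - s) < succ_break k s"
    "s + u * (succ_break k s - s) \<in> {0..1}" "s + u * (succ_break k s - s) \<notin> breaks k"
proof -
  have pos: "succ_break k s - s > 0" using succ_break(2)[OF assms(1,2)] by simp
  show 1: "s < s + u * (succ_break k s - s)" using pos assms(3) by simp
  have "u * (succ_break k s - s) < 1 * (succ_break k s - s)"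
    using pos assms(3) by (intro mult_strict_right_mono) auto
  then show 2: "s + u * (succ_break k s - s) < succ_break k s" by simp
  show "s + u * (succ_break k s - s) \<in> {0..1}"
    using 1 2 succ_break(1)[OF assms(1,2)] assms(2) by (auto simp: breaks_def)
  show "s + u * (succ_break k s - s) \<notin> breaks k"
    using 1 2 succ_break(3)[OF assms(1,2)] by force
qed

lemma edge_param_closed:
  assumes "k \<in> K" "s \<in> breaks k - {1}" "u \<in> {0..1}"
  shows "s + u * (succ_break k s - s) \<in> {0..1}"
proof -
  have "s \<in> {0..1}" "succ_break k s \<in> {0..1}"
    using assms(2) succ_break(1)[OF assms(1,2)] by (auto simp: breaks_def)
  moreover have "s + u * (succ_break k s - s) = (1 - u) * s + u * succ_break k s" by (simp add: algebra_simps)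
  ultimately show ?thesis using assms(3) convex_bound_le[of s 1 "succ_break k s" "1 - u" u] by auto
qed

sublocale finite_graph V edges edge
proof
  show "finite V" by (rule finite_V)
  show "finite edges" unfolding edges_def using finite_K finite_breaks by (intro finite_SigmaI) auto
  fix i assume "i \<in> edges"
  then obtain k s where i: "i = (k, s)" and k: "k \<in> K" and s: "s \<in> breaks k - {1}" by (auto simp: edges_def)
  show "continuous_on {0..1} (edge i)"
    unfolding edge_def i prod.case
    by (rule continuous_on_compose2[OF cont[OF k]]) (use edge_param_closed[OF k s] in \<open>auto intro!: continuous_intros\<close>)
  show "edge i 0 \<in> V \<and> edge i 1 \<in> V"
    using s succ_break(1)[OF k s] by (auto simp: edge_def i breaks_def)
  show "edge i t \<notin> V" if "t \<in> {0<..<1}" for t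
    using edge_param(3,4)[OF k s that] by (auto simp: edge_def i breaks_def)
  fix j a b assume "j \<in> edges" and a: "a \<in> {0<..<1::real}" and b: "b \<in> {0<..<1::real}" and eq: "edge i a = edge j b"
  then obtain l t where j: "j = (l, t)" and l: "l \<in> K" and t: "t \<in> breaks l - {1}" by (auto simp: edges_def)
  let ?x = "s + a * (succ_break k s - s)" and ?y = "t + b * (succ_break l t - t)"
  have "g k ?x = g l ?y" using eq by (simp add: edge_def i j)
  moreover have "g k ?x \<notin> V" using edge_param(3,4)[OF k s a] by (auto simp: breaks_def)
  ultimately have kl: "k = l" "?x = ?y"
    using inj[OF k l edge_param(3)[OF k s a] edge_param(3)[OF l t b]] by auto
  have "s = t"
  proof (rule ccontr)
    assume "s \<noteq> t"
    then consider "s < t" | "t < s" by linarith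
    then show False
    proof cases
      case 1
      then have "succ_break k s \<le> t" using succ_break(3)[OF k s] t kl(1) by auto
      then show False using edge_param(2)[OF k s a] edge_param(1)[OF l t b] kl(2) by linarith
    next
      case 2
      then have "succ_break l t \<le> s" using succ_break(3)[OF l t] s kl(1) by auto
      then show False using edge_param(1)[OF k s a] edge_param(2)[OF l t b] kl(2) by linarith
    qed
  qed
  moreover have "a = b" using kl \<open>s = t\<close> succ_break(2)[OF k s] by auto
  ultimately show "i = j \<and> a = b" using i j kl by simp
qed

lemma realization_eq: "realization = V \<union> (\<Union>k\<in>K. g k ` {0..1})"
proof
  show "realization \<subseteq> V \<union> (\<Union>k\<in>K. g k ` {0..1})"
  proof
    fix y assume "y \<in> realization"
    then consider "y \<in> V" | i where "i \<in> edges" "y \<in> edge i ` {0..1}" unfolding realization_def by blast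
    then show "y \<in> V \<union> (\<Union>k\<in>K. g k ` {0..1})"
    proof cases
      case 2
      then obtain k s u where ks: "k \<in> K" "s \<in> breaks k - {1}" and u: "u \<in> {0..1}" and y: "y = edge (k, s) u"
        unfolding edges_def by blast
      have "y \<in> g k ` {0..1}" using edge_param_closed[OF ks u] unfolding y edge_def by simp
      then show ?thesis using ks(1) by blast
    qed simp
  qed
  have "g k t \<in> realization" if k: "k \<in> K" and t: "t \<in> {0..1}" for k t
  proof (cases "t \<in> breaks k")
    case True
    then show ?thesis by (simp add: breaks_def realization_def)
  next
    case False
    let ?L = "{s \<in> breaks k. s < t}"
    have fin: "finite ?L" using finite_breaks[OF k] by simp
    have "t \<noteq> 0" "t \<noteq> 1" using False breaks_01[OF k] by auto
    then have "0 \<in> ?L" using breaks_01[OF k] t by auto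
    then have max: "Max ?L \<in> ?L" using Max_in[OF fin] by blast
    then have M: "Max ?L \<in> breaks k - {1}" using t by auto
    define s where "s = Max ?L"
    have s: "s \<in> breaks k - {1}" "s < t" using M max by (auto simp: s_def)
    have "t < succ_break k s"
    proof (rule ccontr)
      assume "\<not> t < succ_break k s"
      then have "succ_break k s < t" using succ_break(1)[OF k s(1)] False by (cases "succ_break k s = t") auto
      then have "succ_break k s \<in> ?L" using succ_break(1)[OF k s(1)] by simp
      then have "succ_break k s \<le> s" unfolding s_def using fin by (intro Max_ge)
      then show False using succ_break(2)[OF k s(1)] by simp
    qed
    define u where "u = (t - s) / (succ_break k s - s)"
    have "u \<in> {0..1}" using s(2) \<open>t < succ_break k s\<close> by (simp add: u_def)
    moreover have "edge (k, s) u = g k t" using s(2) \<open>t < succ_break k s\<close> by (simp add: edge_def u_def)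
    moreover have "(k, s) \<in> edges" using k s by (simp add: edges_def)
    ultimately show ?thesis unfolding realization_def by (metis UN_iff UnI2 imageI)
  qed
  then show "V \<union> (\<Union>k\<in>K. g k ` {0..1}) \<subseteq> realization"
    unfolding realization_def by blast
qed

lemma card_edges: "card edges = (\<Sum>k\<in>K. card (breaks k - {1}))"
  unfolding edges_def using finite_K finite_breaks by (intro card_SigmaI) auto

text \<open>
  A break point other than \<open>1\<close> is the start of an edge, and a break point other than \<open>0\<close> is the end of one.
\<close>

lemma sum_half_edges_at:
  assumes "finite N"
  shows "(\<Sum>v\<in>N. card (half_edges_at v)) =
    (\<Sum>k\<in>K. card {s \<in> breaks k - {1}. g k s \<in> N} + card {s \<in> breaks k - {0}. g k s \<in> N})"
proof -
  define E0 where "E0 = (SIGMA k:K. {s \<in> breaks k - {1}. g k s \<in> N})"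
  define E1 where "E1 = (SIGMA k:K. {s \<in> breaks k - {1}. g k (succ_break k s) \<in> N})"
  have fin: "finite {s \<in> breaks k - {1}. P s}" if "k \<in> K" for k P using finite_breaks[OF that] by simp
  have finE: "finite E0" "finite E1" unfolding E0_def E1_def using finite_K fin by (auto intro!: finite_SigmaI)
  have "(\<Sum>v\<in>N. card (half_edges_at v)) = card (\<Union>v\<in>N. half_edges_at v)"
    using assms finite_half_edges_at by (intro card_UN_disjoint[symmetric]) (auto simp: half_edges_at_def)
  also have "(\<Union>v\<in>N. half_edges_at v) = (\<lambda>i. (i, False)) ` E0 \<union> (\<lambda>i. (i, True)) ` E1"
  proof (rule Set.set_eqI)
    fix p :: "('k \<times> real) \<times> bool"
    obtain k s \<sigma> where p: "p = ((k, s), \<sigma>)" by (cases p) auto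
    have "half_edge p 0 = (if \<sigma> then g k (succ_break k s) else g k s)"
      unfolding p half_edge_def by (simp add: edge_def)
    moreover have "p \<in> (\<Union>v\<in>N. half_edges_at v) \<longleftrightarrow> (k, s) \<in> edges \<and> half_edge p 0 \<in> N"
      by (auto simp: half_edges_at_def p)
    moreover have "(k, s) \<in> edges \<longleftrightarrow> k \<in> K \<and> s \<in> breaks k - {1}" by (simp add: edges_def)
    moreover have "p \<in> (\<lambda>i. (i, False)) ` E0 \<union> (\<lambda>i. (i, True)) ` E1 \<longleftrightarrow> (k, s) \<in> (if \<sigma> then E1 else E0)"
      by (auto simp: p)
    ultimately show "p \<in> (\<Union>v\<in>N. half_edges_at v) \<longleftrightarrow> p \<in> (\<lambda>i. (i, False)) ` E0 \<union> (\<lambda>i. (i, True)) ` E1"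
      by (auto simp: E0_def E1_def)
  qed
  also have "card \<dots> = card E0 + card E1"
    using finE by (subst card_Un_disjoint) (auto simp: card_image inj_on_def)
  also have "card E0 = (\<Sum>k\<in>K. card {s \<in> breaks k - {1}. g k s \<in> N})"
    unfolding E0_def using finite_K fin by (intro card_SigmaI) auto
  also have "card E1 = (\<Sum>k\<in>K. card {s \<in> breaks k - {1}. g k (succ_break k s) \<in> N})"
    unfolding E1_def using finite_K fin by (intro card_SigmaI) auto
  also have "\<dots> = (\<Sum>k\<in>K. card {s \<in> breaks k - {0}. g k s \<in> N})"
  proof (rule sum.cong[OF refl])
    fix k assume k: "k \<in> K"
    have "bij_betw (succ_break k) {s \<in> breaks k - {1}. g k (succ_break k s) \<in> N} {s \<in> breaks k - {0}. g k s \<in> N}"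
    proof (rule bij_betw_subset[OF bij_betw_succ_break[OF k]])
      have "breaks k - {0} = succ_break k ` (breaks k - {1})"
        using bij_betw_succ_break[OF k] by (simp add: bij_betw_def)
      moreover have "succ_break k ` {s \<in> breaks k - {1}. g k (succ_break k s) \<in> N}
        = {u \<in> succ_break k ` (breaks k - {1}). g k u \<in> N}" by (auto simp del: Diff_iff)
      ultimately show "succ_break k ` {s \<in> breaks k - {1}. g k (succ_break k s) \<in> N} = {s \<in> breaks k - {0}. g k s \<in> N}"
        by (simp only:)
    qed auto
    then show "card {s \<in> breaks k - {1}. g k (succ_break k s) \<in> N} = card {s \<in> breaks k - {0}. g k s \<in> N}"
      by (rule bij_betw_same_card)
  qed
  finally show ?thesis by (simp add: sum.distrib)
qed

end

section \<open>Parametrisations of curves\<close>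

text \<open>
  In a chart the parameter interval around \<open>t\<close> already covers a neighbourhood of the point on the
  curve, since an injective continuous real function takes values on both sides of each inner one.  Parameters close to \<open>s\<close>
  land in that neighbourhood too, so infinitely many of them would share their image with another parameter.
  One-sided neighbourhoods of \<open>s\<close> suffice; this covers end points of a parameter interval.
\<close>

lemma crossing_is_singular:
  fixes f :: "real \<Rightarrow> real^2"
  assumes cont: "continuous_on S f" and img: "f ` S \<subseteq> \<gamma>"
    and fin: "finite {t \<in> S. \<exists>s\<in>S. s \<noteq> t \<and> f s = f t}"
    and t: "t \<in> interior S" and s: "s \<in> S" "s islimpt S" and st: "s \<noteq> t" "f s = f t"
  shows "singular_point \<gamma> (f t)"
proof -
  have tS: "t \<in> S" using t interior_subset by blast
  have "\<not> smooth_chart \<gamma> (f t) c" for c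
  proof
    assume "smooth_chart \<gamma> (f t) c"
    then obtain V h where c0: "c 0 = f t" and V: "open V" "f t \<in> V"
      and h: "homeomorphism {-1<..<1} (\<gamma> \<inter> V) c h" unfolding smooth_chart_def by blast
    define Bad where "Bad = {t \<in> S. \<exists>s\<in>S. s \<noteq> t \<and> f s = f t}"
    have "finite Bad" using fin unfolding Bad_def .
    have h_cont: "continuous_on (\<gamma> \<inter> V) h" and h_left: "\<And>x. x \<in> \<gamma> \<inter> V \<Longrightarrow> c (h x) = x"
      using h by (simp_all add: homeomorphism_def)
    have "h (f t) = 0" using homeomorphism_apply1[OF h, of 0] c0 by simp
    obtain d1 where d1: "d1 > 0" "ball t d1 \<subseteq> interior S" using t open_contains_ball[of "interior S"] by auto
    have near: "\<exists>d>0. \<forall>x\<in>S. dist x y < d \<longrightarrow> f x \<in> V" if y: "y \<in> S" "f y = f t" for y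
    proof -
      obtain e where e: "e > 0" "ball (f y) e \<subseteq> V" using V y(2) open_contains_ball[of V] by auto
      obtain d where "d > 0" "\<forall>x\<in>S. dist x y < d \<longrightarrow> dist (f x) (f y) < e"
        using cont e(1) y(1) unfolding continuous_on_iff by blast
      then show ?thesis using e(2) by (intro exI[of _ d]) (auto simp: dist_commute)
    qed
    obtain d2 where d2: "d2 > 0" "\<And>x. x \<in> S \<Longrightarrow> dist x t < d2 \<Longrightarrow> f x \<in> V" using near[OF tS refl] by blast
    obtain d3 where d3: "d3 > 0" "\<And>x. x \<in> S \<Longrightarrow> dist x s < d3 \<Longrightarrow> f x \<in> V" using near[OF s(1) st(2)] by blast
    obtain d4 where d4: "d4 > 0" "\<And>x. x \<in> Bad \<Longrightarrow> x \<noteq> t \<Longrightarrow> d4 \<le> dist t x"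
      using finite_set_avoid[OF \<open>finite Bad\<close>] by blast
    define \<delta> where "\<delta> = Min {d1, d2, d4, \<bar>s - t\<bar>} / 2"
    have \<delta>: "\<delta> > 0" "\<delta> < d1" "\<delta> < d2" "\<delta> < d4" "\<delta> < \<bar>s - t\<bar>"
      using d1(1) d2(1) d4(1) st(1) unfolding \<delta>_def by (auto simp: min_def)
    let ?J = "{t - \<delta>..t + \<delta>}"
    have JS: "?J \<subseteq> S"
    proof
      fix x assume "x \<in> ?J"
      then have "x \<in> ball t d1" using \<delta> by (auto simp: dist_real_def)
      then show "x \<in> S" using d1(2) interior_subset by blast
    qed
    have JV: "f x \<in> \<gamma> \<inter> V" if "x \<in> ?J" for x
    proof -
      have "x \<in> S" using that JS by blast
      then show ?thesis using that img d2(2)[of x] \<delta>(3) by (auto simp: dist_real_def)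
    qed
    have Jbad: "x = t" if "x \<in> ?J" "x \<in> Bad" for x
      using d4(2)[of x] that \<delta>(4) by (fastforce simp: dist_real_def)
    define u where "u = h \<circ> f"
    have "f ` ?J \<subseteq> \<gamma> \<inter> V" using JV by blast
    then have cont_u: "continuous_on ?J u" unfolding u_def
      by (rule continuous_on_compose[OF continuous_on_subset[OF cont JS] continuous_on_subset[OF h_cont]])
    have inj_u: "inj_on u ?J"
    proof (rule inj_onI)
      fix x y assume xy: "x \<in> ?J" "y \<in> ?J" "u x = u y"
      have "f x = c (u x)" "f y = c (u y)"
        unfolding u_def comp_apply by (rule h_left[OF JV[OF xy(1)], symmetric], rule h_left[OF JV[OF xy(2)], symmetric])
      then have "f x = f y" using xy(3) by (simp only:)
      show "x = y"
      proof (rule ccontr)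
        assume "x \<noteq> y"
        then have "x \<in> Bad" "y \<in> Bad" using xy JS \<open>f x = f y\<close> unfolding Bad_def by auto
        then show False using Jbad xy \<open>x \<noteq> y\<close> by metis
      qed
    qed
    have "u t = 0" using \<open>h (f t) = 0\<close> by (simp add: u_def)
    define m M where "m = min (u (t - \<delta>)) (u (t + \<delta>))" and "M = max (u (t - \<delta>)) (u (t + \<delta>))"
    have mM: "m < 0" "0 < M"
      using continuous_inj_imp_mono[of "t - \<delta>" t "t + \<delta>" u] \<delta>(1) cont_u inj_u \<open>u t = 0\<close>
      unfolding m_def M_def by auto
    have onto: "\<exists>x\<in>?J. u x = w" if "m < w" "w < M" for w
    proof -
      have "connected (u ` ?J)" by (intro connected_continuous_image cont_u) simp
      moreover have "m \<in> u ` ?J" "M \<in> u ` ?J" unfolding m_def M_def using \<delta>(1) by (auto simp: min_def max_def)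
      ultimately have "{m..M} \<subseteq> u ` ?J" by (rule connected_contains_Icc)
      moreover have "w \<in> {m..M}" using that by simp
      ultimately show ?thesis by blast
    qed
    have "continuous_on (S \<inter> ball s d3) (h \<circ> f)"
    proof -
      have "f ` (S \<inter> ball s d3) \<subseteq> \<gamma> \<inter> V" using img d3(2) by (auto simp: dist_commute)
      then show ?thesis
        by (intro continuous_on_compose continuous_on_subset[OF cont] continuous_on_subset[OF h_cont]) auto
    qed
    moreover have "s \<in> S \<inter> ball s d3" using s(1) d3(1) by simp
    moreover have "(h \<circ> f) s = 0" using st(2) \<open>h (f t) = 0\<close> by simp
    moreover have "min (-m) M > 0" using mM by simp
    ultimately obtain d5 where d5: "d5 > 0" "\<And>x. x \<in> S \<inter> ball s d3 \<Longrightarrow> dist x s < d5 \<Longrightarrow> dist ((h \<circ> f) x) 0 < min (-m) M"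
      unfolding continuous_on_iff by metis
    define e where "e = Min {d3, d5, \<bar>s - t\<bar> - \<delta>}"
    have e: "e > 0" "e \<le> d3" "e \<le> d5" "e \<le> \<bar>s - t\<bar> - \<delta>"
      unfolding e_def using d3(1) d5(1) \<delta>(5) by (auto simp: min_def)
    have "infinite (S \<inter> ball s e)" using s(2) e(1) unfolding islimpt_eq_infinite_ball by blast
    then have "\<not> S \<inter> ball s e \<subseteq> Bad" using \<open>finite Bad\<close> finite_subset by blast
    then obtain x where "x \<in> S \<inter> ball s e" "x \<notin> Bad" by blast
    then have x: "x \<in> S" "dist s x < e" "x \<notin> Bad" by simp_all
    have "dist (h (f x)) 0 < min (-m) M" using d5(2)[of x] x e by (auto simp: dist_commute)
    then have "m < h (f x)" "h (f x) < M" by (auto simp: dist_real_def)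
    then obtain y where y: "y \<in> ?J" "u y = h (f x)" using onto by blast
    have "f x \<in> \<gamma> \<inter> V" using x e d3(2)[of x] img by (auto simp: dist_commute)
    then have "f x = c (h (f x))" by (rule h_left[symmetric])
    also have "\<dots> = c (h (f y))" using y(2) unfolding u_def comp_apply by (rule arg_cong[OF sym])
    also have "\<dots> = f y" by (rule h_left[OF JV[OF y(1)]])
    finally have "f x = f y" .
    moreover have "x \<noteq> y" using x(2) y(1) e(4) by (auto simp: dist_real_def)
    ultimately have "x \<in> Bad" using x(1) y(1) JS unfolding Bad_def by (auto intro!: bexI[of _ y])
    with x(3) show False by simp
  qed
  then show ?thesis using img tS unfolding singular_point_def by blast
qed

lemma curve_interior_empty:
  assumes "one_dimensional \<gamma>"
  shows "interior \<gamma> = {}"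
proof (rule ccontr)
  assume "interior \<gamma> \<noteq> {}"
  then obtain x where "x \<in> interior \<gamma>" by blast
  then obtain e where e: "e > 0" "ball x e \<subseteq> \<gamma>" using mem_interior[of x \<gamma>] by blast
  have "ball x e homeomorphic ball (0::real^2) 1" using e(1) by (intro homeomorphic_balls) auto
  then show False using e(2) assms unfolding one_dimensional_def by blast
qed

definition circle_point :: "real \<Rightarrow> real^2" where
  "circle_point \<tau> = (\<chi> i. if i = 1 then cos \<tau> else sin \<tau>)"

lemma circle_point_nth [simp]: "circle_point \<tau> $ 1 = cos \<tau>" "circle_point \<tau> $ 2 = sin \<tau>"
  by (simp_all add: circle_point_def)

lemma continuous_on_circle_point [continuous_intros]:
  fixes S :: "'a::t2_space set"
  assumes "continuous_on S f"
  shows "continuous_on S (\<lambda>x. circle_point (f x))"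
  unfolding circle_point_def
proof (rule continuous_on_vec_lambda)
  fix i :: 2
  show "continuous_on S (\<lambda>x. if i = 1 then cos (f x) else sin (f x))"
    using continuous_on_cos[OF assms] continuous_on_sin[OF assms] by (cases "i = 1") simp_all
qed

lemma circle_point_in_sphere: "circle_point \<tau> \<in> sphere 0 1"
proof -
  have "(norm (circle_point \<tau>))\<^sup>2 = 1" unfolding norm_real2 by simp
  then show ?thesis by (simp add: power2_eq_1_iff) (smt (verit) norm_ge_zero)
qed

lemma circle_point_surj:
  assumes "z \<in> sphere 0 1"
  obtains \<tau> where "\<tau>0 \<le> \<tau>" "\<tau> < \<tau>0 + 2 * pi" "z = circle_point \<tau>"
proof -
  have "(z $ 1)\<^sup>2 + (z $ 2)\<^sup>2 = 1" using assms norm_real2[of z] by simp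
  then obtain t where t: "z $ 1 = cos t" "z $ 2 = sin t" by (rule sincos_total_2pi)
  define n where "n = \<lfloor>(t - \<tau>0) / (2 * pi)\<rfloor>"
  define \<tau> where "\<tau> = t - 2 * pi * of_int n"
  have n: "of_int n \<le> (t - \<tau>0) / (2 * pi)" "(t - \<tau>0) / (2 * pi) < of_int n + 1"
    unfolding n_def by (rule of_int_floor_le, rule real_of_int_floor_add_one_gt)
  have "of_int n * (2 * pi) \<le> t - \<tau>0" using n(1) by (simp only: pos_le_divide_eq[OF pi_gt_zero[THEN mult_pos_pos[OF zero_less_numeral]]])
  moreover have "t - \<tau>0 < (of_int n + 1) * (2 * pi)"
    using n(2) by (simp only: pos_divide_less_eq[OF pi_gt_zero[THEN mult_pos_pos[OF zero_less_numeral]]])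
  ultimately have "\<tau>0 \<le> \<tau>" "\<tau> < \<tau>0 + 2 * pi"
    unfolding \<tau>_def by (simp_all add: algebra_simps)
  moreover have "sin \<tau> = sin t \<and> cos \<tau> = cos t"
    unfolding sin_cos_eq_iff by (intro exI[of _ "- n"]) (simp add: \<tau>_def)
  then have "z = circle_point \<tau>" using t by (simp add: vec_eq_iff forall_2)
  ultimately show ?thesis by (rule that)
qed

lemma circle_point_eq:
  assumes "circle_point \<sigma> = circle_point \<tau>" "\<bar>\<sigma> - \<tau>\<bar> < 2 * pi"
  shows "\<sigma> = \<tau>"
proof -
  have "sin \<sigma> = sin \<tau> \<and> cos \<sigma> = cos \<tau>"
    using arg_cong[OF assms(1), of "\<lambda>z. z $ 1"] arg_cong[OF assms(1), of "\<lambda>z. z $ 2"] by simp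
  then obtain n :: int where n: "\<sigma> = \<tau> + 2 * pi * of_int n" unfolding sin_cos_eq_iff by blast
  then have "(2 * pi) * \<bar>of_int n\<bar> < (2 * pi) * 1" using assms(2) by (simp add: abs_mult)
  then have "\<bar>of_int n :: real\<bar> < 1" by (rule mult_left_less_imp_less) simp
  then have "n = 0" by linarith
  then show ?thesis using n by simp
qed

text \<open>
  The circle is unrolled starting at a preimage of \<open>v\<close>, so that the base point can be put at a vertex.
\<close>

lemma loop_from_circle_map:
  assumes f: "continuous_on (sphere 0 1) f" "f ` sphere (0::real^2) 1 = \<gamma>"
    and fin: "finite {z \<in> sphere 0 1. \<exists>w\<in>sphere 0 1. w \<noteq> z \<and> f w = f z}" and v: "v \<in> \<gamma>"
  obtains g :: "real \<Rightarrow> 'b::topological_space" where "continuous_on {0..1} g" "g ` {0..1} = \<gamma>" "g 0 = v" "g 1 = v"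
    "finite {t \<in> {0..1}. \<exists>s\<in>{0..1}. s \<noteq> t \<and> g s = g t}"
    "\<And>s t. \<lbrakk>inj_on f (sphere 0 1); s \<in> {0..1}; t \<in> {0..1}; g s = g t; s < t\<rbrakk> \<Longrightarrow> s = 0 \<and> t = 1"
proof -
  obtain z0 where z0: "z0 \<in> sphere 0 1" "f z0 = v" using f(2) v by blast
  obtain \<tau>0 where "z0 = circle_point \<tau>0" using circle_point_surj[OF z0(1)] by blast
  define q where "q = (\<lambda>t. circle_point (\<tau>0 + t * (2 * pi)))"
  have q_sphere: "q t \<in> sphere 0 1" for t unfolding q_def by (rule circle_point_in_sphere)
  have q_cont: "continuous_on {0..1} q" unfolding q_def by (intro continuous_intros)
  have q_eq: "s = 0 \<and> t = 1" if "s \<in> {0..1}" "t \<in> {0..1}" "s < t" "q s = q t" for s t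
  proof (rule ccontr)
    assume "\<not> (s = 0 \<and> t = 1)"
    then have "t - s < 1" using that by auto
    then have "(t - s) * (2 * pi) < 1 * (2 * pi)" by (intro mult_strict_right_mono) auto
    moreover have "0 < (t - s) * (2 * pi)" using that(3) by simp
    ultimately have "\<bar>(\<tau>0 + s * (2 * pi)) - (\<tau>0 + t * (2 * pi))\<bar> < 2 * pi" by (simp add: algebra_simps)
    then have "\<tau>0 + s * (2 * pi) = \<tau>0 + t * (2 * pi)" using circle_point_eq that(4) unfolding q_def by blast
    then show False using that(3) by simp
  qed
  have q_img: "q ` {0..1} = sphere 0 1"
  proof
    show "q ` {0..1} \<subseteq> sphere 0 1" using q_sphere by blast
    show "sphere 0 1 \<subseteq> q ` {0..1}"
    proof
      fix z :: "real^2" assume "z \<in> sphere 0 1"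
      then obtain \<tau> where \<tau>: "\<tau>0 \<le> \<tau>" "\<tau> < \<tau>0 + 2 * pi" "z = circle_point \<tau>" by (rule circle_point_surj)
      then have "(\<tau> - \<tau>0) / (2 * pi) \<in> {0..1}" by (simp add: field_simps)
      moreover have "q ((\<tau> - \<tau>0) / (2 * pi)) = z" by (simp add: q_def \<tau>(3))
      ultimately show "z \<in> q ` {0..1}" by blast
    qed
  qed
  have q01: "q 0 = z0" "q 1 = z0"
  proof -
    show "q 0 = z0" by (simp add: q_def \<open>z0 = circle_point \<tau>0\<close>)
    show "q 1 = z0" by (simp add: q_def \<open>z0 = circle_point \<tau>0\<close> vec_eq_iff forall_2)
  qed
  define g where "g = f \<circ> q"
  let ?B = "{z \<in> sphere 0 1. \<exists>w\<in>sphere 0 1. w \<noteq> z \<and> f w = f z}"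
  have bad: "{s, t} = {0, 1} \<or> (q s \<in> ?B \<and> q t \<in> ?B)"
    if "s \<in> {0..1}" "t \<in> {0..1}" "s \<noteq> t" "g s = g t" for s t
  proof (cases "q s = q t")
    case True
    then show ?thesis using q_eq[of s t] q_eq[of t s] that by (cases "s < t") auto
  next
    case False
    have fq: "f (q s) = f (q t)" using that(4) by (simp add: g_def)
    have "q s \<in> ?B"
      by (intro CollectI conjI q_sphere bexI[of _ "q t"]) (use False fq in auto)
    moreover have "q t \<in> ?B"
      by (intro CollectI conjI q_sphere bexI[of _ "q s"]) (use False fq in auto)
    ultimately show ?thesis by blast
  qed
  have "finite ({0, 1} \<union> (q -` ?B \<inter> {0<..<1}))"
  proof -
    have "inj_on q {0<..<1}"
    proof (rule linorder_inj_onI)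
      fix s t :: real assume "s < t" "s \<in> {0<..<1}" "t \<in> {0<..<1}"
      then show "q s \<noteq> q t" using q_eq[of s t] by auto
    qed auto
    then have "finite (q -` ?B \<inter> {0<..<1})" using fin by (intro finite_vimage_IntI)
    then show ?thesis by simp
  qed
  moreover have "{t \<in> {0..1}. \<exists>s\<in>{0..1}. s \<noteq> t \<and> g s = g t} \<subseteq> {0, 1} \<union> (q -` ?B \<inter> {0<..<1})"
  proof
    fix t assume "t \<in> {t \<in> {0..1}. \<exists>s\<in>{0..1}. s \<noteq> t \<and> g s = g t}"
    then obtain s where "t \<in> {0..1}" "s \<in> {0..1}" "s \<noteq> t" "g s = g t" by blast
    then have "t \<in> {0, 1} \<or> q t \<in> ?B" using bad[of s t] by blast
    then show "t \<in> {0, 1} \<union> (q -` ?B \<inter> {0<..<1})" using \<open>t \<in> {0..1}\<close> by (cases "t = 0 \<or> t = 1") auto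
  qed
  ultimately have fin_g: "finite {t \<in> {0..1}. \<exists>s\<in>{0..1}. s \<noteq> t \<and> g s = g t}" by (rule finite_subset[rotated])
  show ?thesis
  proof (rule that[OF _ _ _ _ fin_g])
    show "continuous_on {0..1} g" unfolding g_def
      by (intro continuous_on_compose q_cont) (simp add: q_img f(1))
    show "g ` {0..1} = \<gamma>" unfolding g_def image_comp[symmetric] q_img by (rule f(2))
    show "g 0 = v" "g 1 = v" by (simp_all add: g_def q01 z0(2))
    fix s t :: real assume inj: "inj_on f (sphere 0 1)" and st: "s \<in> {0..1}" "t \<in> {0..1}" "g s = g t" "s < t"
    have "q s = q t" using inj_onD[OF inj _ q_sphere q_sphere, of s t] st(3) by (simp add: g_def)
    then show "s = 0 \<and> t = 1" using q_eq[OF st(1,2,4)] by blast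
  qed
qed

lemma transverse_meets_inside:
  assumes "transverse_to_circle \<gamma> a P" "P \<in> sphere a r" "r > 0"
  shows "\<gamma> \<inter> ball a r \<noteq> {}"
proof -
  obtain c where chart: "smooth_chart \<gamma> P c"
    and span: "span (insert (vector_derivative c (at 0)) {v. v \<bullet> (P - a) = 0}) = UNIV"
    using assms(1) unfolding transverse_to_circle_def by blast
  from chart obtain V h D where c0: "c 0 = P" and h: "homeomorphism {-1<..<1} (\<gamma> \<inter> V) c h"
    and D: "D 0 = c" "\<And>j t. t \<in> {-1<..<1} \<Longrightarrow> (D j has_vector_derivative D (Suc j) t) (at t)"
    unfolding smooth_chart_def by blast
  \<comment> \<open>Transversality makes the squared distance to \<open>a\<close> along the chart have nonzero derivative at \<open>0\<close>.\<close>
  define w where "w = vector_derivative c (at 0)"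
  have deriv: "(c has_vector_derivative w) (at 0)"
    using D(2)[of 0 0] D(1) unfolding w_def by (metis (no_types, lifting) greaterThanLessThan_iff neg_less_0_iff_less vector_derivative_works differentiableI_vector zero_less_one)
  have in\<gamma>: "c t \<in> \<gamma>" if "t \<in> {-1<..<1}" for t using h that by (auto simp: homeomorphism_def)
  have "P \<noteq> a" using assms(2,3) by auto
  have "w \<bullet> (P - a) \<noteq> 0"
  proof
    assume "w \<bullet> (P - a) = 0"
    then have "insert w {v. v \<bullet> (P - a) = 0} \<subseteq> {v. (P - a) \<bullet> v = 0}" by (auto simp: inner_commute)
    moreover have "subspace {v. (P - a) \<bullet> v = 0}" by (rule subspace_hyperplane)
    ultimately have "span (insert w {v. v \<bullet> (P - a) = 0}) \<subseteq> {v. (P - a) \<bullet> v = 0}" by (rule span_minimal)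
    then have "P - a \<in> {v. (P - a) \<bullet> v = 0}" using span unfolding w_def by blast
    then show False using \<open>P \<noteq> a\<close> by simp
  qed
  have der: "((\<lambda>t. (c t - a) \<bullet> (c t - a)) has_real_derivative 2 * (w \<bullet> (P - a))) (at 0)"
  proof -
    have "((\<lambda>t. c t - a) has_vector_derivative w) (at 0)" using deriv by (auto intro!: derivative_eq_intros)
    then have "((\<lambda>t. (c t - a) \<bullet> (c t - a)) has_derivative (\<lambda>x. (c 0 - a) \<bullet> (x *\<^sub>R w) + (x *\<^sub>R w) \<bullet> (c 0 - a))) (at 0)"
      unfolding has_vector_derivative_def by (intro has_derivative_inner)
    then show ?thesis unfolding has_field_derivative_def
      by (rule has_derivative_eq_rhs) (auto simp: c0 inner_commute fun_eq_iff)
  qed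
  have val: "(c 0 - a) \<bullet> (c 0 - a) = r\<^sup>2"
    using assms(2) by (simp add: c0 dist_norm norm_minus_commute flip: power2_norm_eq_inner)
  obtain t where t: "t \<in> {-1<..<1}" "(c t - a) \<bullet> (c t - a) < r\<^sup>2"
  proof (cases "w \<bullet> (P - a) > 0")
    case True
    then obtain d where d: "d > 0" "\<And>h. h > 0 \<Longrightarrow> h < d \<Longrightarrow> (c (0 - h) - a) \<bullet> (c (0 - h) - a) < (c 0 - a) \<bullet> (c 0 - a)"
      using DERIV_pos_inc_left[OF der] by auto
    have "min (d/2) (1/2) > 0" "min (d/2) (1/2) < d" using d(1) by auto
    then show ?thesis using that[of "- min (d/2) (1/2)"] d(2)[of "min (d/2) (1/2)"] val by auto
  next
    case False
    then have "2 * (w \<bullet> (P - a)) < 0" using \<open>w \<bullet> (P - a) \<noteq> 0\<close> by simp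
    then obtain d where d: "d > 0" "\<And>h. h > 0 \<Longrightarrow> h < d \<Longrightarrow> (c (0 + h) - a) \<bullet> (c (0 + h) - a) < (c 0 - a) \<bullet> (c 0 - a)"
      using DERIV_neg_dec_right[OF der] by auto
    have "min (d/2) (1/2) > 0" "min (d/2) (1/2) < d" using d(1) by auto
    then show ?thesis using that[of "min (d/2) (1/2)"] d(2)[of "min (d/2) (1/2)"] val by auto
  qed
  have "r \<ge> 0" using assms(2) by auto
  have "(norm (c t - a))\<^sup>2 < r\<^sup>2" using t(2) by (simp add: power2_norm_eq_inner)
  then have "norm (c t - a) < r" using \<open>r \<ge> 0\<close> by (rule power2_less_imp_less)
  then have "c t \<in> ball a r" by (simp add: dist_norm norm_minus_commute)
  then show ?thesis using in\<gamma>[OF t(1)] by blast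
qed

text \<open>
  The points on the circle are hit once each, as they are not singular.  The three parameter intervals
  that they cut out avoid the circle, so the curve stays on one side during each of them: outside on
  the unbounded ones because it runs to infinity, and hence inside on the middle one because, by
  transversality, it enters the disk somewhere.
\<close>

lemma arc_of_open_curve_in_disk:
  assumes \<gamma>: "open_curve \<gamma>" and "r > 0" and card: "card (\<gamma> \<inter> sphere a r) = 2"
    and transverse: "\<And>P. P \<in> \<gamma> \<inter> sphere a r \<Longrightarrow> transverse_to_circle \<gamma> a P"
  obtains g where "continuous_on {0..1} g" "g ` {0..1} = \<gamma> \<inter> cball a r" "g 0 \<noteq> g 1"
    "g 0 \<in> sphere a r" "g 1 \<in> sphere a r" "\<And>t. t \<in> {0<..<1::real} \<Longrightarrow> g t \<in> ball a r"
    "finite {t \<in> {0..1}. \<exists>s\<in>{0..1}. s \<noteq> t \<and> g s = g t}"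
proof -
  obtain f :: "real \<Rightarrow> real^2" where f: "continuous_on UNIV f" "range f = \<gamma>" and fin: "finite {t. \<exists>s. s \<noteq> t \<and> f s = f t}"
    and proper: "filterlim f at_infinity at_infinity"
  proof -
    obtain f :: "real \<Rightarrow> real^2" where "traces f UNIV \<gamma>" "filterlim f at_infinity at_infinity" using \<gamma> unfolding open_curve_def by blast
    then show ?thesis using that[of f] unfolding traces_def by simp
  qed
  have not_singular: "\<not> singular_point \<gamma> P" if "P \<in> \<gamma> \<inter> sphere a r" for P
    using transverse[OF that] unfolding transverse_to_circle_def singular_point_def by blast
  have unique: "s = t" if "f s = f t" "f t \<in> sphere a r" for s t
  proof (rule ccontr)
    assume "s \<noteq> t"
    have "s islimpt UNIV" by (rule islimpt_UNIV)
    then have "singular_point \<gamma> (f t)"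
      using crossing_is_singular[of UNIV f \<gamma> t s] f fin \<open>s \<noteq> t\<close> that(1) by simp
    then show False using not_singular[of "f t"] that(2) f(2) by auto
  qed
  obtain b1 b2 where b: "\<gamma> \<inter> sphere a r = {b1, b2}" "b1 \<noteq> b2" using card unfolding card_2_iff by blast
  obtain x1 x2 where x: "f x1 = b1" "f x2 = b2" using b(1) f(2) by (metis IntD1 insertI1 insertI2 rangeE)
  define t1 t2 where "t1 = min x1 x2" and "t2 = max x1 x2"
  have t12: "t1 < t2" "f t1 \<noteq> f t2" "f ` {t1, t2} = {b1, b2}"
  proof -
    have "x1 \<noteq> x2" using x b(2) by auto
    then show "t1 < t2" unfolding t1_def t2_def by (simp add: min_def max_def)
    show "f t1 \<noteq> f t2" "f ` {t1, t2} = {b1, b2}"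
      using x b(2) unfolding t1_def t2_def by (auto simp: min_def max_def)
  qed
  have on_sphere: "t = t1 \<or> t = t2" if "f t \<in> sphere a r" for t
  proof -
    have "f t \<in> f ` {t1, t2}" using that f(2) b(1) t12(3) by blast
    then show ?thesis using unique that by fastforce
  qed
  have ends: "f t1 \<in> sphere a r" "f t2 \<in> sphere a r" using t12(3) b(1) by blast+
  let ?\<rho> = "\<lambda>t. dist a (f t)"
  have cont_\<rho>: "continuous_on A ?\<rho>" for A by (intro continuous_intros continuous_on_subset[OF f(1)]) simp
  have same_side: "(?\<rho> s < r) = (?\<rho> t < r)" if J: "is_interval J" "t1 \<notin> J" "t2 \<notin> J" "s \<in> J" "t \<in> J" for J s t
  proof -
    have "connected (?\<rho> ` J)" using J(1) by (intro connected_continuous_image cont_\<rho>) (simp add: is_interval_connected_1)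
    then have icc: "{?\<rho> x..?\<rho> y} \<subseteq> ?\<rho> ` J" if "x \<in> J" "y \<in> J" for x y
      using that by (intro connected_contains_Icc imageI)
    have "r \<notin> ?\<rho> ` J"
    proof
      assume "r \<in> ?\<rho> ` J"
      then obtain x where "x \<in> J" "f x \<in> sphere a r" by auto
      then show False using on_sphere[of x] J(2,3) by auto
    qed
    then have "r \<notin> {?\<rho> x..?\<rho> y}" if "x \<in> J" "y \<in> J" for x y using icc[OF that] by blast
    from this[OF J(4,5)] this[OF J(5,4)] show ?thesis by auto
  qed
  have "norm a + r + 1 > 0" using \<open>r > 0\<close> by (simp add: add_nonneg_pos)
  then have "\<forall>\<^sub>F t in at_infinity. norm (f t) \<ge> norm a + r + 1"
    using proper unfolding filterlim_at_infinity[OF order_refl] by blast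
  then obtain B where B: "\<And>t. norm t \<ge> B \<Longrightarrow> norm (f t) \<ge> norm a + r + 1"
    unfolding eventually_at_infinity by blast
  have far: "\<not> ?\<rho> t < r" if "\<bar>t\<bar> \<ge> B" for t
  proof -
    have "norm (f t) \<ge> norm a + r + 1" using that by (intro B) simp
    moreover have "norm (f t) - norm a \<le> norm (f t - a)" by (rule norm_triangle_ineq2)
    ultimately show ?thesis unfolding dist_norm norm_minus_commute[of a] by linarith
  qed
  have outside: "\<not> ?\<rho> t < r" if "t < t1 \<or> t > t2" for t
    using that
  proof
    assume t: "t < t1"
    have "min t (- \<bar>B\<bar>) < t1" using t by simp
    then have "(?\<rho> t < r) = (?\<rho> (min t (- \<bar>B\<bar>)) < r)"
      using t t12(1) by (intro same_side[OF is_interval_io[of t1]]) auto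
    moreover have "\<bar>min t (- \<bar>B\<bar>)\<bar> \<ge> B" by linarith
    ultimately show ?thesis using far by blast
  next
    assume t: "t > t2"
    have "max t \<bar>B\<bar> > t2" using t by simp
    then have "(?\<rho> t < r) = (?\<rho> (max t \<bar>B\<bar>) < r)"
      using t t12(1) by (intro same_side[OF is_interval_oi[of t2]]) auto
    moreover have "\<bar>max t \<bar>B\<bar>\<bar> \<ge> B" by linarith
    ultimately show ?thesis using far by blast
  qed
  have "\<gamma> \<inter> ball a r \<noteq> {}" using transverse_meets_inside[OF transverse[of b1] _ \<open>r > 0\<close>] b(1) by blast
  then obtain t0 where t0: "?\<rho> t0 < r" using f(2) by auto
  have "t0 \<in> {t1<..<t2}"
  proof -
    have "\<not> t0 < t1" "\<not> t0 > t2" using outside[of t0] t0 by blast+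
    moreover have "t0 \<noteq> t1" "t0 \<noteq> t2" using t0 ends by auto
    ultimately show ?thesis by simp
  qed
  then have inside: "?\<rho> t < r" if "t \<in> {t1<..<t2}" for t
    using same_side[OF is_interval_oo[of t1 t2], of t t0] that t0 by simp
  define \<theta> where "\<theta> = (\<lambda>t. t1 + t * (t2 - t1))"
  have \<theta>: "\<theta> 0 = t1" "\<theta> 1 = t2" by (simp_all add: \<theta>_def)
  have \<theta>_mono: "\<theta> s < \<theta> t \<longleftrightarrow> s < t" for s t using t12(1) by (simp add: \<theta>_def)
  have \<theta>_img: "\<theta> ` {0..1} = {t1..t2}"
  proof
    show "\<theta> ` {0..1} \<subseteq> {t1..t2}" using \<theta>_mono \<theta> by (metis atLeastAtMost_iff image_subsetI linorder_not_less)
    show "{t1..t2} \<subseteq> \<theta> ` {0..1}"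
    proof
      fix x assume "x \<in> {t1..t2}"
      then have "(x - t1) / (t2 - t1) \<in> {0..1}" "\<theta> ((x - t1) / (t2 - t1)) = x" using t12(1) by (auto simp: \<theta>_def)
      then show "x \<in> \<theta> ` {0..1}" by (metis imageI)
    qed
  qed
  have "inj \<theta>" using t12(1) by (auto simp: \<theta>_def inj_on_def)
  show ?thesis
  proof (rule that[of "f \<circ> \<theta>"])
    show "continuous_on {0..1} (f \<circ> \<theta>)"
      by (intro continuous_on_compose continuous_on_subset[OF f(1)]) (auto simp: \<theta>_def intro!: continuous_intros)
    show "(f \<circ> \<theta>) ` {0..1} = \<gamma> \<inter> cball a r"
    proof -
      have "f ` {t1..t2} = \<gamma> \<inter> cball a r"
      proof
        show "f ` {t1..t2} \<subseteq> \<gamma> \<inter> cball a r"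
        proof
          fix y assume "y \<in> f ` {t1..t2}"
          then obtain t where t: "t \<in> {t1..t2}" "y = f t" by blast
          then have "t = t1 \<or> t = t2 \<or> t \<in> {t1<..<t2}" by auto
          then have "?\<rho> t \<le> r" using ends inside[of t] by auto
          then show "y \<in> \<gamma> \<inter> cball a r" using t(2) f(2) by auto
        qed
        show "\<gamma> \<inter> cball a r \<subseteq> f ` {t1..t2}"
        proof
          fix y assume y: "y \<in> \<gamma> \<inter> cball a r"
          then obtain t where t: "y = f t" using f(2) by blast
          have "?\<rho> t < r \<or> f t \<in> sphere a r" using y t by auto
          then have "t \<in> {t1..t2}"
          proof
            assume "?\<rho> t < r"
            then have "\<not> t < t1" "\<not> t > t2" using outside[of t] by blast+
            then show ?thesis by simp
          next
            assume "f t \<in> sphere a r"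
            then show ?thesis using on_sphere[of t] t12(1) by auto
          qed
          then show "y \<in> f ` {t1..t2}" using t by blast
        qed
      qed
      then show ?thesis unfolding image_comp[symmetric] \<theta>_img .
    qed
    show "(f \<circ> \<theta>) 0 \<noteq> (f \<circ> \<theta>) 1" "(f \<circ> \<theta>) 0 \<in> sphere a r" "(f \<circ> \<theta>) 1 \<in> sphere a r"
      using t12 ends by (simp_all add: \<theta>)
    show "(f \<circ> \<theta>) t \<in> ball a r" if "t \<in> {0<..<1}" for t
    proof -
      have "\<theta> t \<in> {t1<..<t2}" using that \<theta>_mono \<theta> by (metis greaterThanLessThan_iff)
      then show ?thesis using inside by simp
    qed
    have "finite (\<theta> -` {t. \<exists>s. s \<noteq> t \<and> f s = f t})" using fin \<open>inj \<theta>\<close> by (rule finite_vimageI)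
    moreover have "{t \<in> {0..1}. \<exists>s\<in>{0..1}. s \<noteq> t \<and> (f \<circ> \<theta>) s = (f \<circ> \<theta>) t} \<subseteq> \<theta> -` {t. \<exists>s. s \<noteq> t \<and> f s = f t}"
    proof
      fix t assume "t \<in> {t \<in> {0..1}. \<exists>s\<in>{0..1}. s \<noteq> t \<and> (f \<circ> \<theta>) s = (f \<circ> \<theta>) t}"
      then obtain s where "s \<noteq> t" "f (\<theta> s) = f (\<theta> t)" by auto
      moreover have "\<theta> s \<noteq> \<theta> t" using \<open>s \<noteq> t\<close> injD[OF \<open>inj \<theta>\<close>] by blast
      ultimately show "t \<in> \<theta> -` {t. \<exists>s. s \<noteq> t \<and> f s = f t}" by blast
    qed
    ultimately show "finite {t \<in> {0..1}. \<exists>s\<in>{0..1}. s \<noteq> t \<and> (f \<circ> \<theta>) s = (f \<circ> \<theta>) t}" by (rule finite_subset[rotated])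
  qed
qed

section \<open>Families of curves\<close>

lemma proper_curve_closed:
  fixes f :: "real \<Rightarrow> real^2"
  assumes f: "continuous_on UNIV f" and proper: "filterlim f at_infinity at_infinity"
  shows "closed (range f)"
  unfolding closed_sequential_limits
proof (intro allI impI)
  fix x l assume x: "(\<forall>n. x n \<in> range f) \<and> x \<longlonglongrightarrow> l"
  then have "bounded (range x)" using convergent_imp_bounded by blast
  then obtain R where R: "R > 0" "\<And>n. norm (x n) \<le> R" unfolding bounded_pos by blast
  have "\<forall>\<^sub>F t in at_infinity. norm (f t) \<ge> R + 1"
    using proper R(1) unfolding filterlim_at_infinity[OF order_refl] by simp
  then obtain B where B: "\<And>t. norm t \<ge> B \<Longrightarrow> norm (f t) \<ge> R + 1" unfolding eventually_at_infinity by blast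
  have "x n \<in> f ` cball 0 B" for n
  proof -
    obtain t where t: "x n = f t" using x by blast
    have "\<not> norm t \<ge> B" using B[of t] R(2)[of n] t by auto
    then show ?thesis using t by (intro image_eqI[of _ _ t]) auto
  qed
  moreover have "closed (f ` cball 0 B)"
    by (intro compact_imp_closed compact_continuous_image continuous_on_subset[OF f]) auto
  ultimately have "l \<in> f ` cball 0 B" using x unfolding closed_sequential_limits by blast
  then show "l \<in> range f" by blast
qed

lemma open_curve_closed_unbounded:
  assumes "open_curve \<gamma>"
  shows "closed \<gamma>" "\<not> bounded \<gamma>"
proof -
  obtain f :: "real \<Rightarrow> real^2" where f: "traces f UNIV \<gamma>" and proper: "filterlim f at_infinity at_infinity"
    using assms unfolding open_curve_def by blast
  have f': "continuous_on UNIV f" "range f = \<gamma>" using f unfolding traces_def by auto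
  show "closed \<gamma>" using proper_curve_closed[OF f'(1) proper] f'(2) by simp
  show "\<not> bounded \<gamma>"
  proof
    assume "bounded \<gamma>"
    then obtain R where R: "R > 0" "\<And>x. x \<in> \<gamma> \<Longrightarrow> norm x \<le> R" unfolding bounded_pos by blast
    have "\<forall>\<^sub>F t in at_infinity. norm (f t) \<ge> R + 1"
      using proper R(1) unfolding filterlim_at_infinity[OF order_refl] by simp
    then obtain B where B: "\<And>t. norm t \<ge> B \<Longrightarrow> norm (f t) \<ge> R + 1" unfolding eventually_at_infinity by blast
    have "norm (f \<bar>B\<bar>) \<ge> R + 1" by (intro B) simp
    moreover have "f \<bar>B\<bar> \<in> \<gamma>" using f'(2) by blast
    ultimately show False using R(2)[of "f \<bar>B\<bar>"] by simp
  qed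
qed

lemma has_fold_unique:
  assumes "has_fold C P d"
    and "\<forall>\<^sub>F \<epsilon> in at_right (0::real). finite (components ((\<Union>C - {P}) \<inter> ball P \<epsilon>)) \<and>
        card (components ((\<Union>C - {P}) \<inter> ball P \<epsilon>)) = d'"
  shows "d = d'"
proof -
  have "\<forall>\<^sub>F \<epsilon> in at_right (0::real). d = d'"
    using eventually_conj[OF assms(1)[unfolded has_fold_def] assms(2)] by (rule eventually_mono) auto
  then show ?thesis by simp
qed

lemma (in traced_graph) half_edge_in_trace:
  assumes "p \<in> edges \<times> UNIV"
  shows "half_edge p ` {0..1} \<subseteq> g (fst (fst p)) ` {0..1}"
proof
  fix y assume "y \<in> half_edge p ` {0..1}"
  then obtain t where t: "t \<in> {0..1}" "y = half_edge p t" by blast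
  obtain k s \<sigma> where p: "p = ((k, s), \<sigma>)" by (cases p) auto
  have ks: "k \<in> K" "s \<in> breaks k - {1}" using assms by (auto simp: p edges_def)
  define u where "u = (if \<sigma> then 1 - t else t)"
  have "u \<in> {0..1}" using t(1) by (auto simp: u_def)
  moreover have "y = g k (s + u * (succ_break k s - s))"
    unfolding t(2) p half_edge_def by (simp add: edge_def u_def)
  ultimately show "y \<in> g (fst (fst p)) ` {0..1}" using edge_param_closed[OF ks] by (simp add: p)
qed

locale curve_family =
  fixes C :: "(real^2) set set" and a :: "real^2" and r :: real
  assumes finite_C: "finite C" and C_nonempty: "C \<noteq> {}"
    and curves: "\<And>\<gamma>. \<gamma> \<in> C \<Longrightarrow> closed_curve \<gamma> \<or> open_curve \<gamma>"
    and connected_union: "connected (\<Union>C)"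
    and finite_nodes: "finite (nodes C)"
    and disk: "kappa C \<ge> 1 \<Longrightarrow> large_disk C a r"
begin

definition opens :: "(real^2) set set" where "opens = {\<gamma> \<in> C. open_curve \<gamma>}"

definition boundary_points :: "(real^2) set" where
  "boundary_points = (\<Union>\<gamma>\<in>opens. \<gamma> \<inter> sphere a r)"

definition window :: "(real^2) set" where
  "window = (if opens = {} then UNIV else cball a r)"

lemma kappa_eq: "kappa C = card opens"
  by (simp add: kappa_def opens_def)

lemma finite_opens: "finite opens"
  using finite_C by (simp add: opens_def)

lemma disk': "opens \<noteq> {} \<Longrightarrow> large_disk C a r"
  using disk finite_opens by (simp add: kappa_eq Suc_le_eq card_gt_0_iff)

lemma in_disk:
  assumes "opens \<noteq> {}"
  shows "0 < r" "nodes C \<subseteq> ball a r" "\<And>\<gamma>. \<gamma> \<in> C \<Longrightarrow> closed_curve \<gamma> \<Longrightarrow> \<gamma> \<subseteq> ball a r"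
    "\<And>\<gamma>. \<gamma> \<in> opens \<Longrightarrow> card (\<gamma> \<inter> sphere a r) = 2"
    "\<And>\<gamma> P. \<gamma> \<in> opens \<Longrightarrow> P \<in> \<gamma> \<inter> sphere a r \<Longrightarrow> transverse_to_circle \<gamma> a P"
  using disk'[OF assms] unfolding large_disk_def opens_def by blast+

lemma curve_facts:
  assumes "\<gamma> \<in> C"
  shows "semialgebraic \<gamma>" "interior \<gamma> = {}" "closed \<gamma>" "\<gamma> \<noteq> {}"
proof -
  have sc: "semialgebraic_curve \<gamma>" using curves[OF assms] by (auto simp: closed_curve_def open_curve_def)
  then show "semialgebraic \<gamma>" "interior \<gamma> = {}"
    using curve_interior_empty unfolding semialgebraic_curve_def by blast+
  show "closed \<gamma>" using curves[OF assms] open_curve_closed_unbounded(1)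
    unfolding closed_curve_def by (blast intro: compact_imp_closed)
  show "\<gamma> \<noteq> {}"
  proof
    assume "\<gamma> = {}"
    obtain A where A: "A \<subseteq> \<gamma>" "A homeomorphic {0<..<1::real}"
      using sc unfolding semialgebraic_curve_def one_dimensional_def by blast
    have "A = {}" using A(1) \<open>\<gamma> = {}\<close> by simp
    then have "{0<..<1::real} = {}" using A(2) homeomorphic_empty(2)[of "{0<..<1::real}"] by simp
    then show False by simp
  qed
qed

lemma nodes_subset: "nodes C \<subseteq> \<Union>C"
  unfolding nodes_def singular_point_def by blast

lemma common_point_node: "\<gamma> \<in> C \<Longrightarrow> \<gamma>' \<in> C \<Longrightarrow> \<gamma> \<noteq> \<gamma>' \<Longrightarrow> P \<in> \<gamma> \<Longrightarrow> P \<in> \<gamma>' \<Longrightarrow> P \<in> nodes C"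
  unfolding nodes_def by blast

lemma singular_node: "\<gamma> \<in> C \<Longrightarrow> singular_point \<gamma> P \<Longrightarrow> P \<in> nodes C"
  unfolding nodes_def by blast

text \<open>
  A curve without nodes is disjoint from the union of the others; both sets are closed.
\<close>

lemma nodeless_curve_alone:
  assumes \<gamma>: "\<gamma> \<in> C" and "\<gamma> \<inter> nodes C = {}"
  shows "C = {\<gamma>}"
proof (rule ccontr)
  assume "C \<noteq> {\<gamma>}"
  then obtain \<gamma>' where \<gamma>': "\<gamma>' \<in> C - {\<gamma>}" using \<gamma> by blast
  have "closed (\<Union>(C - {\<gamma>}))" using finite_C curve_facts(3) by (intro closed_Union) auto
  moreover have "\<gamma> \<inter> \<Union>(C - {\<gamma>}) = {}" using common_point_node[OF \<gamma>] assms(2) by blast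
  moreover have sub: "\<Union>C \<subseteq> \<gamma> \<union> \<Union>(C - {\<gamma>})" by blast
  ultimately have "\<gamma> \<inter> \<Union>C = {} \<or> \<Union>(C - {\<gamma>}) \<inter> \<Union>C = {}"
    using connected_closedD[OF connected_union _ sub curve_facts(3)[OF \<gamma>]] by blast
  moreover have "\<gamma> \<inter> \<Union>C = \<gamma>" "\<gamma>' \<subseteq> \<Union>(C - {\<gamma>}) \<inter> \<Union>C" using \<gamma> \<gamma>' by blast+
  ultimately show False using curve_facts(4)[OF \<gamma>] curve_facts(4)[of \<gamma>'] \<gamma>' by blast
qed

lemma boundary_points_off_nodes: "boundary_points \<inter> nodes C = {}"
  using in_disk(2) unfolding boundary_points_def by fastforce

lemma card_boundary_points: "card boundary_points = 2 * kappa C" "finite boundary_points"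
proof -
  have fin: "finite (\<gamma> \<inter> sphere a r)" if "\<gamma> \<in> opens" for \<gamma>
    using in_disk(4)[OF _ that] that by (metis card.infinite empty_iff zero_neq_numeral)
  then show "finite boundary_points" unfolding boundary_points_def using finite_opens by blast
  have "card boundary_points = (\<Sum>\<gamma>\<in>opens. card (\<gamma> \<inter> sphere a r))"
    unfolding boundary_points_def
  proof (rule card_UN_disjoint[OF finite_opens])
    show "\<forall>i\<in>opens. finite (i \<inter> sphere a r)" using fin by blast
    show "\<forall>i\<in>opens. \<forall>j\<in>opens. i \<noteq> j \<longrightarrow> i \<inter> sphere a r \<inter> (j \<inter> sphere a r) = {}"
    proof (intro ballI impI)
      fix \<gamma> \<gamma>' assume *: "\<gamma> \<in> opens" "\<gamma>' \<in> opens" "\<gamma> \<noteq> \<gamma>'"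
      have "P \<in> ball a r" if "P \<in> \<gamma>" "P \<in> \<gamma>'" for P
      proof -
        have "P \<in> nodes C" using common_point_node[of \<gamma> \<gamma>' P] * that by (simp add: opens_def)
        moreover have "opens \<noteq> {}" using *(1) by blast
        ultimately show ?thesis using in_disk(2) by blast
      qed
      then show "\<gamma> \<inter> sphere a r \<inter> (\<gamma>' \<inter> sphere a r) = {}" by force
    qed
  qed
  also have "\<dots> = (\<Sum>\<gamma>\<in>opens. 2)" using in_disk(4) by (intro sum.cong) auto
  finally show "card boundary_points = 2 * kappa C" by (simp add: kappa_eq)
qed

text \<open>
  If there are open curves, only the part of the family inside the disk belongs to the complex; closed
  curves lie in the disk entirely.
\<close>

definition tracing_path :: "(real^2) set \<Rightarrow> (real \<Rightarrow> real^2) \<Rightarrow> bool" where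
  "tracing_path \<gamma> g \<longleftrightarrow> continuous_on {0..1} g \<and> g ` {0..1} = \<gamma> \<inter> window \<and>
     finite {t \<in> {0..1}. \<exists>s\<in>{0..1}. s \<noteq> t \<and> g s = g t} \<and>
     (if \<gamma> \<in> opens then g 0 \<noteq> g 1 \<and> g 0 \<in> sphere a r \<and> g 1 \<in> sphere a r \<and> (\<forall>t\<in>{0<..<1}. g t \<in> ball a r)
      else g 0 = g 1)"

lemma closed_tracing_path:
  assumes "\<gamma> \<in> C" "\<gamma> \<notin> opens" "v \<in> \<gamma>"
  obtains g where "tracing_path \<gamma> g" "g 0 = v"
proof -
  have cc: "closed_curve \<gamma>" using assms curves unfolding opens_def by blast
  then obtain f where f: "traces f (sphere (0::real^2) 1) \<gamma>" unfolding closed_curve_def by blast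
  have f': "continuous_on (sphere 0 1) f" "f ` sphere 0 1 = \<gamma>"
    "finite {z \<in> sphere 0 1. \<exists>w\<in>sphere 0 1. w \<noteq> z \<and> f w = f z}"
    using f unfolding traces_def by blast+
  have window: "\<gamma> \<inter> window = \<gamma>"
  proof (cases "opens = {}")
    case False
    have "\<gamma> \<subseteq> cball a r" using in_disk(3)[OF False assms(1) cc] ball_subset_cball by (rule subset_trans)
    then show ?thesis using False by (simp add: window_def Int_absorb2)
  qed (simp add: window_def)
  show ?thesis
  proof (rule loop_from_circle_map[OF f' assms(3)])
    fix g :: "real \<Rightarrow> real^2"
    assume "continuous_on {0..1} g" "g ` {0..1} = \<gamma>" "g 0 = v" "g 1 = v"
      "finite {t \<in> {0..1}. \<exists>s\<in>{0..1}. s \<noteq> t \<and> g s = g t}"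
    then have "tracing_path \<gamma> g" unfolding tracing_path_def window using assms(2) by simp
    then show thesis using \<open>g 0 = v\<close> by (rule that)
  qed
qed

lemma open_tracing_path:
  assumes "\<gamma> \<in> opens"
  obtains g where "tracing_path \<gamma> g"
proof -
  have ne: "opens \<noteq> {}" using assms by blast
  have "open_curve \<gamma>" using assms by (simp add: opens_def)
  from arc_of_open_curve_in_disk[OF this in_disk(1)[OF ne] in_disk(4)[OF ne assms] in_disk(5)[OF ne assms]]
  obtain g where "continuous_on {0..1} g" "g ` {0..1} = \<gamma> \<inter> cball a r" "g 0 \<noteq> g 1"
    "g 0 \<in> sphere a r" "g 1 \<in> sphere a r" "\<And>t. t \<in> {0<..<1::real} \<Longrightarrow> g t \<in> ball a r"
    "finite {t \<in> {0..1}. \<exists>s\<in>{0..1}. s \<noteq> t \<and> g s = g t}" by blast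
  then show ?thesis using that[of g] assms ne unfolding tracing_path_def window_def by simp
qed

text \<open>
  Injectivity off the nodes, except that closed curves return to their base point.
\<close>

lemma tracing_path_crossing:
  assumes "\<gamma> \<in> C" "tracing_path \<gamma> g" "s \<in> {0..1}" "t \<in> {0..1}" "s < t" "g s = g t"
  shows "g s \<in> nodes C \<or> (s = 0 \<and> t = 1 \<and> \<gamma> \<notin> opens)"
proof -
  have g: "continuous_on {0..1} g" "g ` {0..1} \<subseteq> \<gamma>" "finite {t \<in> {0..1}. \<exists>s\<in>{0..1}. s \<noteq> t \<and> g s = g t}"
    using assms(2) unfolding tracing_path_def by blast+
  have node: "g x \<in> nodes C" if "x \<in> {0<..<1}" "y \<in> {0..1}" "y \<noteq> x" "g y = g x" for x y
  proof -
    have "y islimpt {0..1}" using that(2) by (simp add: connected_imp_perfect)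
    moreover have "x \<in> interior {0..1}" using that(1) by simp
    ultimately have "singular_point \<gamma> (g x)"
      using crossing_is_singular[OF g(1,2,3)] that by blast
    then show ?thesis using singular_node[OF assms(1)] by blast
  qed
  consider "s \<in> {0<..<1}" | "t \<in> {0<..<1}" | "s = 0" "t = 1" using assms(3-5) by force
  then show ?thesis
  proof cases
    case 1
    then show ?thesis using node[of s t] assms by auto
  next
    case 2
    then show ?thesis using node[of t s] assms by auto
  next
    case 3
    then show ?thesis using assms(2,6) unfolding tracing_path_def by (auto split: if_splits)
  qed
qed

lemma Delta_eq:
  "Delta C a r = top_of_set (nodes C \<union> boundary_points \<union> (\<Union>C \<inter> window) \<union> (if opens = {} then {} else sphere a r))"
proof -
  have V: "Delta_vertices C a r = nodes C \<union> boundary_points"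
    using finite_opens unfolding Delta_vertices_def kappa_eq boundary_points_def opens_def by auto
  have UN_comp: "\<Union>(\<Union>\<gamma>\<in>C. components (F \<gamma>)) = (\<Union>\<gamma>\<in>C. F \<gamma>)" for F :: "(real^2) set \<Rightarrow> (real^2) set"
  proof -
    have "\<Union>(\<Union>\<gamma>\<in>C. components (F \<gamma>)) = (\<Union>\<gamma>\<in>C. \<Union>(components (F \<gamma>)))" by blast
    then show ?thesis by (simp add: Union_components)
  qed
  show ?thesis
  proof (cases "opens = {}")
    case True
    then have "kappa C = 0" by (simp add: kappa_eq)
    then have E: "\<Union>(Delta_edges C a r) = (\<Union>\<gamma>\<in>C. \<gamma> - Delta_vertices C a r)"
      unfolding Delta_edges_def Let_def by (simp add: UN_comp)
    have "Delta_vertices C a r \<union> \<Union>(Delta_edges C a r) = nodes C \<union> boundary_points \<union> (\<Union>C \<inter> window)"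
      unfolding E V window_def using True by auto
    then show ?thesis unfolding Delta_def using True by simp
  next
    case False
    then have "kappa C \<noteq> 0" using finite_opens by (simp add: kappa_eq)
    then have E: "\<Union>(Delta_edges C a r) = (\<Union>\<gamma>\<in>C. \<gamma> \<inter> cball a r - Delta_vertices C a r) \<union> (sphere a r - Delta_vertices C a r)"
      unfolding Delta_edges_def Let_def by (simp add: UN_comp Union_components)
    have "Delta_vertices C a r \<union> \<Union>(Delta_edges C a r) = nodes C \<union> boundary_points \<union> (\<Union>C \<inter> window) \<union> sphere a r"
      unfolding E V window_def using False by auto
    then show ?thesis unfolding Delta_def using False by simp
  qed
qed

text \<open>
  The part of the family outside the disk is pushed radially onto the circle.
\<close>

lemma connected_Delta: "connected (\<Union>C \<inter> window \<union> (if opens = {} then {} else sphere a r))"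
proof (cases "opens = {}")
  case True
  then show ?thesis using connected_union by (simp add: window_def)
next
  case False
  have r: "r > 0" using in_disk(1)[OF False] .
  \<comment> \<open>the radial retraction of the plane onto the disk\<close>
  let ?f = "\<lambda>x. a + (r / max r (dist a x)) *\<^sub>R (x - a)"
  have pos: "max r (dist a x) > 0" for x using r by simp
  have cont: "continuous_on UNIV ?f"
    by (intro continuous_intros) (use pos in \<open>simp add: less_imp_neq[symmetric]\<close>)
  have conn: "connected (?f ` \<Union>C)"
    by (intro connected_continuous_image continuous_on_subset[OF cont] connected_union) simp
  have self: "?f x = x" if "x \<in> cball a r" for x
    using that r by (simp add: max_absorb1)
  have outer: "?f x \<in> sphere a r" if "x \<notin> cball a r" for x
  proof -
    have "max r (dist a x) = norm (x - a)" "norm (x - a) > 0"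
      using that r by (auto simp: dist_norm norm_minus_commute)
    then show ?thesis using r by (simp add: dist_norm)
  qed
  obtain \<gamma> where \<gamma>: "\<gamma> \<in> opens" using False by blast
  then have "\<gamma> \<inter> sphere a r \<noteq> {}" using in_disk(4)[OF False \<gamma>] by auto
  then obtain b where b: "b \<in> \<gamma>" "b \<in> sphere a r" by blast
  have bC: "b \<in> \<Union>C" using b(1) \<gamma> by (auto simp: opens_def)
  have fb: "?f b = b" using b(2) by (intro self) auto
  have "b \<in> ?f ` \<Union>C" by (rule image_eqI[of b ?f b, OF fb[symmetric] bC])
  then have "?f ` \<Union>C \<inter> sphere a r \<noteq> {}" using b(2) by blast
  moreover have "connected (sphere a r)" by (rule connected_sphere) simp
  ultimately have "connected (?f ` \<Union>C \<union> sphere a r)" using conn by (intro connected_Un)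
  moreover have "?f ` \<Union>C \<union> sphere a r = \<Union>C \<inter> cball a r \<union> sphere a r"
  proof
    show "?f ` \<Union>C \<union> sphere a r \<subseteq> \<Union>C \<inter> cball a r \<union> sphere a r"
    proof
      fix y assume "y \<in> ?f ` \<Union>C \<union> sphere a r"
      then consider "y \<in> sphere a r" | x where "x \<in> \<Union>C" "y = ?f x" by blast
      then show "y \<in> \<Union>C \<inter> cball a r \<union> sphere a r"
      proof cases
        case 2
        then show ?thesis using self[of x] outer[of x] by (cases "x \<in> cball a r") auto
      qed simp
    qed
    show "\<Union>C \<inter> cball a r \<union> sphere a r \<subseteq> ?f ` \<Union>C \<union> sphere a r"
    proof
      fix x assume x: "x \<in> \<Union>C \<inter> cball a r \<union> sphere a r"
      show "x \<in> ?f ` \<Union>C \<union> sphere a r"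
      proof (cases "x \<in> sphere a r")
        case False
        then have x': "x \<in> \<Union>C" "x \<in> cball a r" using x by blast+
        have "x \<in> ?f ` \<Union>C" by (rule image_eqI[of x ?f x, OF self[OF x'(2), symmetric] x'(1)])
        then show ?thesis by blast
      qed simp
    qed
  qed
  ultimately show ?thesis using False by (simp add: window_def)
qed

text \<open>
  The family is then a single simple closed curve.  One of its points serves as the vertex of a graph
  with one edge.
\<close>

lemma homology_without_vertices:
  assumes "nodes C = {}" "opens = {}"
  shows "homology_group 0 (Delta C a r) \<cong> integer_group"
    "homology_group 1 (Delta C a r) \<cong> product_group {..<1::nat} (\<lambda>_. integer_group)"
    "\<And>p. p \<ge> 2 \<Longrightarrow> trivial_group (homology_group p (Delta C a r))"
proof -
  obtain \<gamma> where \<gamma>: "\<gamma> \<in> C" using C_nonempty by blast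
  have C: "C = {\<gamma>}" using nodeless_curve_alone[OF \<gamma>] assms(1) by blast
  obtain v where v: "v \<in> \<gamma>" using curve_facts(4)[OF \<gamma>] by blast
  obtain g where g: "tracing_path \<gamma> g" "g 0 = v" using closed_tracing_path[OF \<gamma> _ v] assms(2) by blast
  have g': "continuous_on {0..1} g" "g ` {0..1} = \<gamma>" "g 1 = v"
    using g assms(2) unfolding tracing_path_def window_def by simp_all
  have inj: "s = 0 \<and> t = 1" if "s \<in> {0..1}" "t \<in> {0..1}" "s < t" "g s = g t" for s t
    using tracing_path_crossing[OF \<gamma> g(1) that] assms(1) by blast
  have off: "g t \<noteq> v" if "t \<in> {0<..<1}" for t
    using inj[of 0 t] g(2) that by auto
  interpret finite_graph "{v}" "{()}" "\<lambda>_. g"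
  proof
    show "finite {v}" "finite {()}" by simp_all
    fix i j :: unit and s t :: real
    show "continuous_on {0..1} g" by (rule g'(1))
    show "g 0 \<in> {v} \<and> g 1 \<in> {v}" using g(2) g'(3) by simp
    show "g t \<notin> {v}" if "t \<in> {0<..<1}" using off[OF that] by simp
    assume st: "s \<in> {0<..<1}" "t \<in> {0<..<1}" "g s = g t"
    have "\<not> s < t" using inj[of s t] st by auto
    moreover have "\<not> t < s" using inj[of t s] st by auto
    ultimately show "i = j \<and> s = t" by simp
  qed
  have real: "realization = \<gamma>" unfolding realization_def using g'(2) v by (simp add: insert_absorb)
  have union: "\<Union>C = \<gamma>" using C by simp
  have "window = UNIV" using assms(2) by (simp add: window_def)
  then have "\<Union>C \<inter> window = \<gamma>" by (simp only: union Int_UNIV_right)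
  moreover have "boundary_points = {}" using assms(2) by (simp add: boundary_points_def)
  ultimately have Delta: "Delta C a r = top_of_set realization"
    unfolding Delta_eq real using assms by simp
  have "connected realization" using connected_union unfolding union real .
  moreover have "realization \<noteq> {}" using real v by blast
  ultimately obtain m where m: "m + card {v} = card {()} + 1"
    "homology_group 0 (top_of_set realization) \<cong> integer_group"
    "homology_group 1 (top_of_set realization) \<cong> product_group {..<m} (\<lambda>_. integer_group)"
    "\<And>p. p \<ge> 2 \<Longrightarrow> trivial_group (homology_group p (top_of_set realization))"
    using homology by blast
  have "m = 1" using m(1) by simp
  show "homology_group 0 (Delta C a r) \<cong> integer_group"
    "homology_group 1 (Delta C a r) \<cong> product_group {..<1::nat} (\<lambda>_. integer_group)"
    "\<And>p. p \<ge> 2 \<Longrightarrow> trivial_group (homology_group p (Delta C a r))"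
    using m(2-4) unfolding Delta \<open>m = 1\<close> by blast+
qed

lemma circle_path:
  assumes "opens \<noteq> {}" "v \<in> sphere a r"
  obtains g :: "real \<Rightarrow> real^2" where "continuous_on {0..1} g" "g ` {0..1} = sphere a r" "g 0 = v" "g 1 = v"
    "finite {t \<in> {0..1}. \<exists>s\<in>{0..1}. s \<noteq> t \<and> g s = g t}"
    "\<And>s t. \<lbrakk>s \<in> {0..1}; t \<in> {0..1}; g s = g t; s < t\<rbrakk> \<Longrightarrow> s = 0 \<and> t = 1"
proof -
  let ?f = "\<lambda>z. a + r *\<^sub>R z"
  have r: "r > 0" using in_disk(1)[OF assms(1)] .
  have img: "?f ` sphere 0 1 = sphere a r"
  proof
    show "?f ` sphere 0 1 \<subseteq> sphere a r" using r by (auto simp: dist_norm)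
    show "sphere a r \<subseteq> ?f ` sphere 0 1"
    proof
      fix x assume "x \<in> sphere a r"
      then have "(1/r) *\<^sub>R (x - a) \<in> sphere 0 1" using r by (simp add: dist_norm norm_minus_commute)
      moreover have "?f ((1/r) *\<^sub>R (x - a)) = x" using r by simp
      ultimately show "x \<in> ?f ` sphere 0 1" by (rule image_eqI[OF sym, rotated])
    qed
  qed
  have inj: "inj_on ?f (sphere 0 1)" using r by (simp add: inj_on_def)
  have none: "{z \<in> sphere 0 1. \<exists>w\<in>sphere 0 1. w \<noteq> z \<and> ?f w = ?f z} = {}" using r by simp
  have fin: "finite {z \<in> sphere 0 1. \<exists>w\<in>sphere 0 1. w \<noteq> z \<and> ?f w = ?f z}" unfolding none by simp
  have cont: "continuous_on (sphere 0 1) ?f" by (intro continuous_intros)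
  show ?thesis
  proof (rule loop_from_circle_map[OF cont img fin assms(2)])
    fix g :: "real \<Rightarrow> real^2"
    assume g: "continuous_on {0..1} g" "g ` {0..1} = sphere a r" "g 0 = v" "g 1 = v"
      "finite {t \<in> {0..1}. \<exists>s\<in>{0..1}. s \<noteq> t \<and> g s = g t}"
      "\<And>s t. \<lbrakk>inj_on ?f (sphere 0 1); s \<in> {0..1}; t \<in> {0..1}; g s = g t; s < t\<rbrakk> \<Longrightarrow> s = 0 \<and> t = 1"
    show thesis by (rule that[OF g(1-5) g(6)[OF inj]])
  qed
qed

end

context curve_family
begin

text \<open>
  Nodes and boundary points are the vertices of a graph traced by the curves and, if there are open
  curves, by the circle.  Its edges are counted through their ends.
\<close>

lemma homology_with_vertices:
  assumes vertex: "nodes C \<noteq> {} \<or> opens \<noteq> {}"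
    and fold: "\<And>P. P \<in> nodes C \<Longrightarrow> has_fold C P (F P)"
  obtains m where "2 * m + 2 * card (nodes C) = (\<Sum>P\<in>nodes C. F P) + 2 * kappa C + 2"
    "homology_group 0 (Delta C a r) \<cong> integer_group"
    "homology_group 1 (Delta C a r) \<cong> product_group {..<m} (\<lambda>_. integer_group)"
    "\<And>p. p \<ge> 2 \<Longrightarrow> trivial_group (homology_group p (Delta C a r))"
proof -
  let ?S = "sphere a r"
  define V where "V = nodes C \<union> boundary_points"
  define K where "K = C \<union> (if opens = {} then {} else {?S})"
  define body where "body = (\<lambda>k. if k \<in> C then k \<inter> window else ?S)"
  have finV: "finite V" and finK: "finite K"
    unfolding V_def K_def using finite_nodes card_boundary_points(2) finite_C by auto
  have S_notin: "?S \<notin> C" if "opens \<noteq> {}"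
  proof
    assume "?S \<in> C"
    then consider "closed_curve ?S" | "open_curve ?S" using curves by blast
    then show False
    proof cases
      case 1
      then have "?S \<subseteq> ball a r" using in_disk(3)[OF that \<open>?S \<in> C\<close>] by blast
      moreover have "?S \<inter> ball a r = {}" by auto
      ultimately have "?S = {}" by blast
      then show False using curve_facts(4)[OF \<open>?S \<in> C\<close>] by blast
    next
      case 2
      then show False using open_curve_closed_unbounded(2)[OF 2] by simp
    qed
  qed
  have node_ball: "P \<in> ball a r" if "P \<in> nodes C" "opens \<noteq> {}" for P
    using in_disk(2)[OF that(2)] that(1) by blast
  have boundary_sphere: "P \<in> ?S" if "P \<in> boundary_points" for P
    using that unfolding boundary_points_def by blast
  have boundary_opens: "opens \<noteq> {}" if "P \<in> boundary_points" for P
    using that unfolding boundary_points_def by blast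
  have closed_in_ball: "\<gamma> \<subseteq> ball a r" if "\<gamma> \<in> C" "\<gamma> \<notin> opens" "opens \<noteq> {}" for \<gamma>
    using in_disk(3)[OF that(3,1)] curves[OF that(1)] that(1,2) unfolding opens_def by blast
  \<comment> \<open>Besides the curves, the circle is traced as one more closed path; it starts at a boundary point.\<close>
  define Q where "Q k g \<longleftrightarrow> (k \<in> C \<longrightarrow> tracing_path k g \<and> (k \<notin> opens \<longrightarrow> g 0 \<in> nodes C)) \<and>
      (k \<notin> C \<longrightarrow> continuous_on {0..1} g \<and> g ` {0..1} = ?S \<and> g 0 \<in> boundary_points \<and> g 1 = g 0 \<and>
        finite {t \<in> {0..1}. \<exists>s\<in>{0..1}. s \<noteq> t \<and> g s = g t} \<and>
        (\<forall>s\<in>{0..1}. \<forall>t\<in>{0..1}. g s = g t \<longrightarrow> s < t \<longrightarrow> s = 0 \<and> t = 1))" for k and g :: "real \<Rightarrow> real^2"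
  have "\<exists>g. Q k g" if k: "k \<in> K" for k
  proof (cases "k \<in> C")
    case True
    show ?thesis
    proof (cases "k \<in> opens")
      case True
      obtain g where "tracing_path k g" using open_tracing_path[OF True] .
      then show ?thesis unfolding Q_def using True \<open>k \<in> C\<close> by blast
    next
      case False
      have "k \<inter> nodes C \<noteq> {}"
      proof
        assume none: "k \<inter> nodes C = {}"
        then have "C = {k}" by (rule nodeless_curve_alone[OF True])
        then have "nodes C \<subseteq> k" "opens \<subseteq> {k}" using nodes_subset unfolding opens_def by auto
        then show False using none vertex False by auto
      qed
      then obtain v where v: "v \<in> k" "v \<in> nodes C" by blast
      obtain g where "tracing_path k g" "g 0 = v" using closed_tracing_path[OF True False v(1)] .
      then show ?thesis unfolding Q_def using v(2) True by blast
    qed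
  next
    case False
    then have ne: "opens \<noteq> {}" and "k = ?S" using k unfolding K_def by (auto split: if_splits)
    have "card boundary_points \<noteq> 0" using card_boundary_points(1) ne finite_opens by (simp add: kappa_eq)
    then obtain v where v: "v \<in> boundary_points" by (metis card.empty ex_in_conv)
    obtain g :: "real \<Rightarrow> real^2" where g: "continuous_on {0..1} g" "g ` {0..1} = ?S" "g 0 = v" "g 1 = v"
      "finite {t \<in> {0..1}. \<exists>s\<in>{0..1}. s \<noteq> t \<and> g s = g t}"
      "\<And>s t. \<lbrakk>s \<in> {0..1}; t \<in> {0..1}; g s = g t; s < t\<rbrakk> \<Longrightarrow> s = 0 \<and> t = 1"
      using circle_path[OF ne boundary_sphere[OF v]] by blast
    have "g 0 \<in> boundary_points" "g 1 = g 0" using g(3,4) v by simp_all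
    then show ?thesis unfolding Q_def using False g(1,2,5,6) by blast
  qed
  then obtain g where "\<And>k. k \<in> K \<Longrightarrow> Q k (g k)" by metis
  note g = this[unfolded Q_def]
  have CK: "k \<in> K" if "k \<in> C" for k using that by (simp add: K_def)
  have trace: "tracing_path k (g k)" if "k \<in> C" for k using g[OF CK[OF that]] that by blast
  have base: "g k 0 \<in> nodes C" if "k \<in> C" "k \<notin> opens" for k using g[OF CK[OF that(1)]] that by blast
  have K_cases: "k \<in> C \<or> (k \<notin> C \<and> k = ?S \<and> opens \<noteq> {})" if "k \<in> K" for k
    using that unfolding K_def by (auto split: if_splits)
  have sphere_trace: "continuous_on {0..1} (g k)" "g k ` {0..1} = ?S" "g k 0 \<in> boundary_points" "g k 1 = g k 0"
    "finite {t \<in> {0..1}. \<exists>s\<in>{0..1}. s \<noteq> t \<and> g k s = g k t}"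
    "\<And>s t. s \<in> {0..1} \<Longrightarrow> t \<in> {0..1} \<Longrightarrow> g k s = g k t \<Longrightarrow> s < t \<Longrightarrow> s = 0 \<and> t = 1"
    if "k \<in> K" "k \<notin> C" for k
  proof -
    note H = g[OF that(1), THEN conjunct2, THEN mp, OF that(2)]
    show "continuous_on {0..1} (g k)" using H by (elim conjE)
    show "g k ` {0..1} = ?S" using H by (elim conjE)
    show "g k 0 \<in> boundary_points" using H by (elim conjE)
    show "g k 1 = g k 0" using H by (elim conjE)
    show "finite {t \<in> {0..1}. \<exists>s\<in>{0..1}. s \<noteq> t \<and> g k s = g k t}" using H by (elim conjE)
    have "\<forall>s\<in>{0..1}. \<forall>t\<in>{0..1}. g k s = g k t \<longrightarrow> s < t \<longrightarrow> s = 0 \<and> t = 1" using H by (elim conjE)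
    then show "\<And>s t. s \<in> {0..1} \<Longrightarrow> t \<in> {0..1} \<Longrightarrow> g k s = g k t \<Longrightarrow> s < t \<Longrightarrow> s = 0 \<and> t = 1" by blast
  qed
  have cont: "continuous_on {0..1} (g k)" if "k \<in> K" for k
    using K_cases[OF that] trace[of k] sphere_trace(1)[OF that] unfolding tracing_path_def by blast
  have img: "g k ` {0..1} = body k" if "k \<in> K" for k
    using K_cases[OF that] trace[of k] sphere_trace(2)[OF that] unfolding tracing_path_def body_def by auto
  have bad: "finite {t \<in> {0..1}. \<exists>s\<in>{0..1}. s \<noteq> t \<and> g k s = g k t}" if "k \<in> K" for k
    using K_cases[OF that] trace[of k] sphere_trace(5)[OF that] unfolding tracing_path_def by blast
  have open_trace: "g k 0 \<noteq> g k 1" "g k 0 \<in> ?S" "g k 1 \<in> ?S" "\<And>t. t \<in> {0<..<1} \<Longrightarrow> g k t \<in> ball a r"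
    if "k \<in> opens" for k
    using trace[of k] that unfolding tracing_path_def opens_def by auto
  have closed_ends: "g k 1 = g k 0" if "k \<in> C" "k \<notin> opens" for k
    using trace[OF that(1)] that(2) unfolding tracing_path_def by simp
  have on_curve: "g k t \<in> k" if "k \<in> C" "t \<in> {0..1}" for k t
    using img[OF CK[OF that(1)]] that unfolding body_def by auto
  have ends: "g k 0 \<in> V \<and> g k 1 \<in> V" if k: "k \<in> K" for k
  proof (cases "k \<in> C")
    case True
    show ?thesis
    proof (cases "k \<in> opens")
      case True
      have "g k t \<in> boundary_points" if "t = 0 \<or> t = 1" for t
        using that open_trace(2,3)[OF True] on_curve[OF \<open>k \<in> C\<close>, of t] True unfolding boundary_points_def by auto
      then show ?thesis unfolding V_def by blast
    next
      case False
      then show ?thesis using base[OF \<open>k \<in> C\<close> False] closed_ends[OF \<open>k \<in> C\<close> False] by (simp add: V_def)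
    qed
  next
    case False
    then show ?thesis using sphere_trace(3,4)[OF k False] by (simp add: V_def)
  qed
  have crossing: "g k s \<in> V" if k: "k \<in> K" and st: "s \<in> {0..1}" "t \<in> {0..1}" "s < t" "g k s = g k t" for k s t
  proof (cases "k \<in> C")
    case True
    then show ?thesis using tracing_path_crossing[OF True trace[OF True] st] ends[OF k] unfolding V_def by auto
  next
    case False
    then show ?thesis using sphere_trace(6)[OF k False st(1,2,4,3)] ends[OF k] by auto
  qed
  have inj: "k = l \<and> s = t" if kl: "k \<in> K" "l \<in> K" and st: "s \<in> {0..1}" "t \<in> {0..1}" and eq: "g k s = g l t" and off: "g k s \<notin> V" for k l s t
  proof -
    have off_sphere: "g k s \<notin> ?S" if "k \<in> C" "opens \<noteq> {}" "s \<in> {0..1}" "g k s \<notin> V" for k s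
    proof (cases "k \<in> opens")
      case True
      then show ?thesis using that on_curve[OF that(1,3)] unfolding V_def boundary_points_def by blast
    next
      case False
      then have "g k s \<in> ball a r" using closed_in_ball[OF that(1) False that(2)] on_curve[OF that(1,3)] by blast
      then show ?thesis by auto
    qed
    have "k = l"
    proof (rule ccontr)
      assume "k \<noteq> l"
      consider "k \<in> C" "l \<in> C" | "k \<in> C" "l \<notin> C" | "k \<notin> C" "l \<in> C" | "k \<notin> C" "l \<notin> C" by blast
      then show False
      proof cases
        case 1
        then have "g k s \<in> nodes C"
          using common_point_node[OF 1 \<open>k \<noteq> l\<close>] on_curve[OF 1(1) st(1)] on_curve[OF 1(2) st(2)] eq by simp
        then show False using off by (simp add: V_def)
      next
        case 2
        then have "g l t \<in> ?S" using sphere_trace(2)[OF kl(2)] st(2) by blast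
        then show False using off_sphere[OF 2(1) _ st(1) off] K_cases[OF kl(2)] 2(2) eq by simp
      next
        case 3
        then have "g k s \<in> ?S" using sphere_trace(2)[OF kl(1)] st(1) by blast
        then show False using off_sphere[OF 3(2) _ st(2)] off K_cases[OF kl(1)] 3(1) eq by simp
      next
        case 4
        then show False using K_cases[OF kl(1)] K_cases[OF kl(2)] \<open>k \<noteq> l\<close> by blast
      qed
    qed
    moreover have "s = t"
    proof (rule ccontr)
      assume "s \<noteq> t"
      then consider "s < t" | "t < s" by linarith
      then show False
      proof cases
        case 1
        then show False using crossing[OF kl(1) st 1] eq off \<open>k = l\<close> by simp
      next
        case 2
        then show False using crossing[OF kl(1) st(2,1) 2] eq off \<open>k = l\<close> by simp
      qed
    qed
    ultimately show ?thesis by blast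
  qed
  have fibres: "finite {t \<in> {0..1}. g k t = v}" if "k \<in> K" for k v
  proof (cases "\<exists>t0\<in>{0..1}. g k t0 = v")
    case True
    then obtain t0 where "t0 \<in> {0..1}" "g k t0 = v" by blast
    then have "{t \<in> {0..1}. g k t = v} \<subseteq> insert t0 {t \<in> {0..1}. \<exists>s\<in>{0..1}. s \<noteq> t \<and> g k s = g k t}"
      by (intro subsetI) (metis (mono_tags, lifting) insertCI mem_Collect_eq)
    then show ?thesis using bad[OF that] by (meson finite_insert finite_subset)
  next
    case False
    then have "{t \<in> {0..1}. g k t = v} = {}" by blast
    then show ?thesis by (simp only: finite.emptyI)
  qed
  interpret traced_graph V K g
    by unfold_locales (use finV finK cont ends fibres inj in blast)+
  have real: "realization = V \<union> (\<Union>C \<inter> window) \<union> (if opens = {} then {} else ?S)"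
  proof -
    have "(\<Union>k\<in>K. g k ` {0..1}) = (\<Union>k\<in>K. body k)" using img by simp
    also have "\<dots> = (\<Union>k\<in>C. k \<inter> window) \<union> (if opens = {} then {} else ?S)"
      unfolding K_def body_def using S_notin by auto
    also have "(\<Union>k\<in>C. k \<inter> window) = \<Union>C \<inter> window" by blast
    finally show ?thesis unfolding realization_eq by blast
  qed
  have Delta: "Delta C a r = top_of_set realization"
    by (simp only: Delta_eq real V_def[symmetric])
  have V_sub: "V \<subseteq> \<Union>C \<inter> window \<union> (if opens = {} then {} else ?S)"
  proof
    fix P assume "P \<in> V"
    then consider "P \<in> nodes C" | "P \<in> boundary_points" unfolding V_def by blast
    then show "P \<in> \<Union>C \<inter> window \<union> (if opens = {} then {} else ?S)"
    proof cases
      case 1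
      then have "P \<in> window" using node_ball[OF 1] unfolding window_def by (cases "opens = {}") auto
      then show ?thesis using 1 nodes_subset by blast
    next
      case 2
      then show ?thesis using boundary_sphere[OF 2] boundary_opens[OF 2] by simp
    qed
  qed
  have real': "realization = \<Union>C \<inter> window \<union> (if opens = {} then {} else ?S)"
    using V_sub unfolding real by blast
  have conn: "connected realization" unfolding real' by (rule connected_Delta)
  have "realization \<noteq> {}"
  proof -
    have "V \<noteq> {}"
    proof (cases "nodes C = {}")
      case True
      then have "card boundary_points \<noteq> 0" using vertex card_boundary_points(1) finite_opens by (simp add: kappa_eq)
      then show ?thesis unfolding V_def by auto
    qed (auto simp: V_def)
    then show ?thesis unfolding real by blast
  qed
  \<comment> \<open>No edge on the circle ends at a node, so every arc at a node is semialgebraic.\<close>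
  have degree: "card (half_edges_at P) = F P" if P: "P \<in> nodes C" for P
  proof -
    have "P \<in> V" using P by (simp add: V_def)
    have mono: "\<exists>\<delta>>0. strict_mono_on {0..\<delta>} (\<lambda>u. dist P (half_edge p u))" if p: "p \<in> half_edges_at P" for p
    proof -
      let ?k = "fst (fst p)"
      have pE: "p \<in> edges \<times> UNIV" "half_edge p 0 = P" using p by (auto simp: half_edges_at_def)
      then have kK: "?k \<in> K" by (auto simp: edges_def)
      have sub: "half_edge p ` {0..1} \<subseteq> body ?k" using half_edge_in_trace[OF pE(1)] img[OF kK] by simp
      have "?k \<in> C"
      proof (rule ccontr)
        assume "?k \<notin> C"
        then have "opens \<noteq> {}" using K_cases[OF kK] by blast
        have "half_edge p 0 \<in> half_edge p ` {0..1}" by simp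
        then have "P \<in> ?S" using sub \<open>?k \<notin> C\<close> pE(2) unfolding body_def by auto
        then show False using node_ball[OF P \<open>opens \<noteq> {}\<close>] by auto
      qed
      have "half_edge p ` {0..1/2} \<subseteq> half_edge p ` {0..1}" by (intro image_mono) auto
      then have "half_edge p ` {0..1/2} \<subseteq> ?k" using sub \<open>?k \<in> C\<close> unfolding body_def by auto
      moreover have "continuous_on {0..1/2} (half_edge p)"
        by (rule continuous_on_subset[OF half_edge_cont[OF pE(1)]]) auto
      ultimately obtain \<delta> where "0 < \<delta>" "strict_mono_on {0..\<delta>} (\<lambda>u. dist (half_edge p 0) (half_edge p u))"
        using semialgebraic_arc_radius_strict_mono[OF curve_facts(1,2)[OF \<open>?k \<in> C\<close>], of "1/2" "half_edge p"]
          half_edge_inj_on[OF pE(1)] by (metis half_gt_zero zero_less_one)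
      then show ?thesis unfolding pE(2) by blast
    qed
    obtain \<epsilon>0 where \<epsilon>0: "\<epsilon>0 > 0" "\<Union>C \<inter> ball P \<epsilon>0 = realization \<inter> ball P \<epsilon>0"
    proof (cases "opens = {}")
      case True
      have "realization = \<Union>C" unfolding real' window_def using True by simp
      then show ?thesis using that[of 1] by simp
    next
      case False
      have "P \<in> ball a r" using node_ball[OF P False] .
      then obtain e where e: "e > 0" "ball P e \<subseteq> ball a r"
        using open_ball[of a r] unfolding open_contains_ball by blast
      have "ball a r \<inter> ?S = {}" "ball a r \<subseteq> window" using False by (auto simp: window_def)
      then have "\<Union>C \<inter> ball P e = (\<Union>C \<inter> window \<union> ?S) \<inter> ball P e" using e(2) by blast
      then have "\<Union>C \<inter> ball P e = realization \<inter> ball P e" unfolding real' using False by simp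
      then show ?thesis using that[OF e(1)] by blast
    qed
    show ?thesis
      using has_fold_unique[OF fold[OF P] card_components_near_vertex[OF \<open>P \<in> V\<close> mono \<epsilon>0]] by simp
  qed
  \<comment> \<open>A break point inside a path is the end of two edges, an end point of the path of one.  So each
    path carries twice as many edge ends as edges; for an open curve two of them are not at nodes.\<close>
  have V_point: "g k s \<in> V" if "s \<in> breaks k" for k s using that by (simp add: breaks_def)
  have deg_closed: "card {s \<in> breaks k - {1}. g k s \<in> nodes C} + card {s \<in> breaks k - {0}. g k s \<in> nodes C} = 2 * card (breaks k - {1})"
    if k: "k \<in> C" "k \<notin> opens" for k
  proof -
    have "g k s \<in> nodes C" if "s \<in> breaks k" for s
    proof -
      have "g k s \<notin> boundary_points"
      proof
        assume b: "g k s \<in> boundary_points"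
        have "s \<in> {0..1}" using that by (simp add: breaks_def)
        then have "g k s \<in> ball a r" using closed_in_ball[OF k boundary_opens[OF b]] on_curve[OF k(1)] by blast
        then show False using boundary_sphere[OF b] by auto
      qed
      then show ?thesis using V_point[OF that] by (simp add: V_def)
    qed
    then have "{s \<in> breaks k - {1}. g k s \<in> nodes C} = breaks k - {1}" "{s \<in> breaks k - {0}. g k s \<in> nodes C} = breaks k - {0}"
      by auto
    moreover have "card (breaks k - {0}) = card (breaks k - {1})"
      using bij_betw_same_card[OF bij_betw_succ_break[OF CK[OF k(1)]]] by simp
    ultimately show ?thesis by simp
  qed
  have deg_open: "card {s \<in> breaks k - {1}. g k s \<in> nodes C} + card {s \<in> breaks k - {0}. g k s \<in> nodes C} + 2 = 2 * card (breaks k - {1})"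
    if k: "k \<in> opens" for k
  proof -
    have kC: "k \<in> C" using k by (simp add: opens_def)
    have node_iff: "g k s \<in> nodes C \<longleftrightarrow> s \<noteq> 0 \<and> s \<noteq> 1" if s: "s \<in> breaks k" for s
    proof
      assume "g k s \<in> nodes C"
      then have "g k s \<in> ball a r" using node_ball k by blast
      then show "s \<noteq> 0 \<and> s \<noteq> 1" using open_trace(2,3)[OF k] by auto
    next
      assume "s \<noteq> 0 \<and> s \<noteq> 1"
      then have "g k s \<in> ball a r" using s open_trace(4)[OF k, of s] by (auto simp: breaks_def)
      then have "g k s \<notin> boundary_points" using boundary_sphere by auto
      then show "g k s \<in> nodes C" using V_point[OF s] by (simp add: V_def)
    qed
    have eq: "{s \<in> breaks k - {1}. g k s \<in> nodes C} = breaks k - {0, 1}" "{s \<in> breaks k - {0}. g k s \<in> nodes C} = breaks k - {0, 1}"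
    proof -
      have iff: "s \<in> {s \<in> breaks k - {1}. g k s \<in> nodes C} \<longleftrightarrow> s \<in> breaks k - {0, 1}"
        "s \<in> {s \<in> breaks k - {0}. g k s \<in> nodes C} \<longleftrightarrow> s \<in> breaks k - {0, 1}" for s
        using node_iff[of s] by (cases "s \<in> breaks k"; simp only: mem_Collect_eq Diff_iff insert_iff empty_iff; argo)+
      show "{s \<in> breaks k - {1}. g k s \<in> nodes C} = breaks k - {0, 1}" by (rule Set.set_eqI) (rule iff(1))
      show "{s \<in> breaks k - {0}. g k s \<in> nodes C} = breaks k - {0, 1}" by (rule Set.set_eqI) (rule iff(2))
    qed
    have "card (B - {y}) = Suc (card (B - {x, y}))" if "finite B" "x \<in> B" "x \<noteq> y" for x y :: real and B
    proof -
      have "B - {y} = insert x (B - {x, y})" using that(2,3) by blast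
      moreover have "card (insert x (B - {x, y})) = Suc (card (B - {x, y}))"
        using that(1) by (intro card_insert_disjoint) auto
      ultimately show ?thesis by (rule ssubst[of _ _ "\<lambda>D. card D = _"])
    qed
    from this[OF finite_breaks[OF CK[OF kC]], of 0 1]
    have "card (breaks k - {1}) = Suc (card (breaks k - {0, 1}))" using breaks_01[OF CK[OF kC]] by simp
    then show ?thesis unfolding eq by simp
  qed
  have deg_sphere: "card {s \<in> breaks k - {1}. g k s \<in> nodes C} + card {s \<in> breaks k - {0}. g k s \<in> nodes C} = 0"
    "card (breaks k - {1}) = 2 * kappa C" if k: "k \<in> K" "k \<notin> C" for k
  proof -
    have ne: "opens \<noteq> {}" using K_cases[OF k(1)] k(2) by blast
    have on_S: "g k s \<in> ?S" if "s \<in> breaks k" for s using that sphere_trace(2)[OF k] by (auto simp: breaks_def)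
    have "g k s \<notin> nodes C" if "s \<in> breaks k" for s using on_S[OF that] node_ball[OF _ ne, of "g k s"] by auto
    then have "{s \<in> breaks k - {1}. g k s \<in> nodes C} = {}" "{s \<in> breaks k - {0}. g k s \<in> nodes C} = {}" by auto
    then show "card {s \<in> breaks k - {1}. g k s \<in> nodes C} + card {s \<in> breaks k - {0}. g k s \<in> nodes C} = 0"
      by (simp only: card.empty add_0)
    have "bij_betw (g k) (breaks k - {1}) boundary_points"
    proof (rule bij_betw_imageI)
      show "inj_on (g k) (breaks k - {1})"
      proof (rule linorder_inj_onI)
        fix s t assume st: "s < t" "s \<in> breaks k - {1}" "t \<in> breaks k - {1}"
        then show "g k s \<noteq> g k t" using sphere_trace(6)[OF k, of s t] by (auto simp: breaks_def)
      qed auto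
      show "g k ` (breaks k - {1}) = boundary_points"
      proof
        show "g k ` (breaks k - {1}) \<subseteq> boundary_points"
          using V_point on_S \<open>\<And>s. s \<in> breaks k \<Longrightarrow> g k s \<notin> nodes C\<close> unfolding V_def by blast
        show "boundary_points \<subseteq> g k ` (breaks k - {1})"
        proof
          fix P assume P: "P \<in> boundary_points"
          then obtain t where t: "t \<in> {0..1}" "g k t = P" using boundary_sphere[OF P] sphere_trace(2)[OF k] by (metis imageE)
          define t' where "t' = (if t = 1 then 0 else t)"
          have gt': "g k t' = P" using t(2) sphere_trace(4)[OF k] by (auto simp: t'_def)
          have "P \<in> V" using P by (simp add: V_def)
          moreover have "t' \<in> {0..1} - {1}" using t(1) by (auto simp: t'_def)
          ultimately have "t' \<in> breaks k - {1}" using gt' by (simp add: breaks_def)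
          then show "P \<in> g k ` (breaks k - {1})" using gt' by blast
        qed
      qed
    qed
    then show "card (breaks k - {1}) = 2 * kappa C"
      using bij_betw_same_card card_boundary_points(1) by metis
  qed
  let ?w = "\<lambda>k. card (breaks k - {1})"
  let ?h = "\<lambda>k. card {s \<in> breaks k - {1}. g k s \<in> nodes C} + card {s \<in> breaks k - {0}. g k s \<in> nodes C}"
  have sumC: "(\<Sum>k\<in>C. ?h k) + 2 * kappa C = 2 * (\<Sum>k\<in>C. ?w k)"
  proof -
    have "(\<Sum>k\<in>C. if k \<in> opens then 2 else 0::nat) = 2 * kappa C"
    proof -
      have "(\<Sum>k\<in>C. if k \<in> opens then 2 else 0::nat) = (\<Sum>k\<in>C \<inter> opens. 2)"
        by (rule sum.inter_restrict[OF finite_C, symmetric])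
      moreover have "C \<inter> opens = opens" by (auto simp: opens_def)
      ultimately show ?thesis by (simp add: kappa_eq)
    qed
    then have "(\<Sum>k\<in>C. ?h k) + 2 * kappa C = (\<Sum>k\<in>C. ?h k + (if k \<in> opens then 2 else 0))"
      by (simp add: sum.distrib)
    also have "\<dots> = (\<Sum>k\<in>C. 2 * ?w k)"
      by (rule sum.cong[OF refl]) (use deg_closed deg_open in auto)
    finally show ?thesis by (simp add: sum_distrib_left)
  qed
  have sumK: "(\<Sum>k\<in>K. ?h k) = (\<Sum>k\<in>C. ?h k) \<and> (\<Sum>k\<in>K. ?w k) = (\<Sum>k\<in>C. ?w k) + 2 * kappa C"
  proof (cases "opens = {}")
    case True
    then show ?thesis by (simp add: K_def kappa_eq)
  next
    case False
    have S: "?S \<in> K" "?S \<notin> C" using False S_notin by (auto simp: K_def)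
    have "K = insert ?S C" using False by (simp add: K_def)
    then show ?thesis using deg_sphere[OF S] S(2) finite_C by simp
  qed
  have "(\<Sum>P\<in>nodes C. F P) = (\<Sum>P\<in>nodes C. card (half_edges_at P))" using degree by simp
  also have "\<dots> = (\<Sum>k\<in>K. ?h k)" by (rule sum_half_edges_at[OF finite_nodes])
  finally have sumF: "(\<Sum>P\<in>nodes C. F P) + 2 * kappa C = 2 * (\<Sum>k\<in>C. ?w k)" using sumK sumC by simp
  have cardE: "card edges = (\<Sum>k\<in>C. ?w k) + 2 * kappa C" unfolding card_edges using sumK by simp
  have cardV: "card V = card (nodes C) + 2 * kappa C"
    unfolding V_def using boundary_points_off_nodes card_boundary_points finite_nodes
    by (subst card_Un_disjoint) auto
  obtain m where m: "m + card V = card edges + 1"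
    "homology_group 0 (top_of_set realization) \<cong> integer_group"
    "homology_group 1 (top_of_set realization) \<cong> product_group {..<m} (\<lambda>_. integer_group)"
    "\<And>p. p \<ge> 2 \<Longrightarrow> trivial_group (homology_group p (top_of_set realization))"
    using homology[OF conn \<open>realization \<noteq> {}\<close>] by blast
  have "2 * m + 2 * card (nodes C) = (\<Sum>P\<in>nodes C. F P) + 2 * kappa C + 2"
    using m(1) cardE cardV sumF by simp
  then show ?thesis using that[of m] m(2-4) unfolding Delta by blast
qed

end

theorem theorem4p2:
  fixes C :: "(real^2) set set" and k :: nat and n d :: "nat \<Rightarrow> nat"
    and a :: "real^2" and r :: real
  assumes "finite C" and "C \<noteq> {}"
    and "\<And>\<gamma>. \<gamma> \<in> C \<Longrightarrow> closed_curve \<gamma> \<or> open_curve \<gamma>"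
    and "connected (\<Union>C)"
    and "has_configuration C k n d"
    and "kappa C \<ge> 1 \<Longrightarrow> large_disk C a r"
  shows "homology_group 0 (Delta C a r) \<cong> integer_group \<and>
    (\<exists>m::nat. real m = psi k n d + real (kappa C) + 1 \<and>
       homology_group 1 (Delta C a r) \<cong> product_group {..<m} (\<lambda>_. integer_group)) \<and>
    (\<forall>q::int. q \<ge> 2 \<longrightarrow> trivial_group (homology_group q (Delta C a r)))"
proof -
  have finN: "finite (nodes C)" and inj: "inj_on d {1..k}"
    and fold: "\<And>P. P \<in> nodes C \<Longrightarrow> \<exists>i\<in>{1..k}. has_fold C P (d i)"
    and num: "\<And>i. i \<in> {1..k} \<Longrightarrow> card {P \<in> nodes C. has_fold C P (d i)} = n i"
    using assms(5) unfolding has_configuration_def by blast+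
  interpret curve_family C a r
    by unfold_locales (use assms finN in blast)+
  obtain idx where idx: "\<And>P. P \<in> nodes C \<Longrightarrow> idx P \<in> {1..k} \<and> has_fold C P (d (idx P))"
    using fold by metis
  define F where "F = (\<lambda>P. d (idx P))"
  have F: "has_fold C P (F P)" if "P \<in> nodes C" for P using idx[OF that] by (simp add: F_def)
  have fibre: "{P \<in> nodes C. has_fold C P (d i)} = {P \<in> nodes C. idx P = i}" if i: "i \<in> {1..k}" for i
  proof -
    have "idx P = i" if "P \<in> nodes C" "has_fold C P (d i)" for P
    proof -
      have "d (idx P) = d i" using has_fold_unique[of C P "d (idx P)" "d i"] idx[OF that(1)] that(2) unfolding has_fold_def by blast
      then show ?thesis using inj_onD[OF inj] idx[OF that(1)] i by blast
    qed
    then show ?thesis using idx by blast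
  qed
  have psi: "2 * psi k n d = real (\<Sum>P\<in>nodes C. F P) - 2 * real (card (nodes C))"
  proof -
    have "2 * psi k n d = (\<Sum>i=1..k. real (n i) * (real (d i) - 2))" by (simp add: psi_def)
    also have "\<dots> = (\<Sum>i=1..k. \<Sum>P\<in>{P \<in> nodes C. idx P = i}. real (F P) - 2)"
    proof (rule sum.cong[OF refl])
      fix i assume i: "i \<in> {1..k}"
      have "(\<Sum>P\<in>{P \<in> nodes C. idx P = i}. real (F P) - 2) = (\<Sum>P\<in>{P \<in> nodes C. idx P = i}. real (d i) - 2)"
        by (rule sum.cong) (auto simp: F_def)
      then show "real (n i) * (real (d i) - 2) = (\<Sum>P\<in>{P \<in> nodes C. idx P = i}. real (F P) - 2)"
        using num[OF i] fibre[OF i] by simp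
    qed
    also have "\<dots> = (\<Sum>P\<in>nodes C. real (F P) - 2)"
      using idx by (intro sum.group finN) auto
    finally show ?thesis by (simp add: sum_subtractf)
  qed
  show ?thesis
  proof (cases "nodes C = {} \<and> opens = {}")
    case True
    then have "real 1 = psi k n d + real (kappa C) + 1" using psi by (simp add: kappa_eq)
    then show ?thesis using homology_without_vertices True by blast
  next
    case False
    then obtain m where m: "2 * m + 2 * card (nodes C) = (\<Sum>P\<in>nodes C. F P) + 2 * kappa C + 2"
      "homology_group 0 (Delta C a r) \<cong> integer_group"
      "homology_group 1 (Delta C a r) \<cong> product_group {..<m} (\<lambda>_. integer_group)"
      "\<And>p. p \<ge> 2 \<Longrightarrow> trivial_group (homology_group p (Delta C a r))"
      using homology_with_vertices[of F] F by blast
    have "real (2 * m + 2 * card (nodes C)) = real ((\<Sum>P\<in>nodes C. F P) + 2 * kappa C + 2)"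
      using m(1) by (rule arg_cong)
    then have "real m = psi k n d + real (kappa C) + 1" using psi by simp
    then show ?thesis using m(2-4) by blast
  qed
qed

end
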